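(* Let $1\le p\le\infty$ and let $s\in(0,1]$ be defined by $1/s=1+|1/2-1/p|$. Let $Y$ be a Banach space which is (isomorphic to) a closed subspace or a quotient (factor) space of an $L_p(\nu)$-space for some measure $\nu$. If $T\in N_s(Y,Y)$, then: 1. the nuclear trace of $T$ is well defined, i.e. for every representation $T=\sum_{k=1}^\infty y'_k\otimes y_k$ with $y'_k\in Y^*$, $y_k\in Y$ and $\sum_k\|y'_k\|^s\|y_k\|^s<\infty$, the number $\operatorname{tr}T:=\sum_{k=1}^\infty y'_k(y_k)$ does not depend on the choice of the representation; 2. $\sum_{n=1}^\infty|\lambda_n(T)|<\infty$, where $\{\lambda_n(T)\}$ is the system of all eigenvalues of $T$ (each repeated according to its algebraic multiplicity); and moreover $$\operatorname{tr}T=\sum_{n=1}^\infty\lambda_n(T).$$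
   Context: For Banach spaces $X,Y$ and $s\in(0,1]$, an operator $T:X\to Y$ is called $s$-nuclear, written $T\in N_s(X,Y)$, if it admits a representation $T=\sum_{k=1}^\infty x'_k\otimes y_k$ (i.e. $Tx=\sum_k x'_k(x)y_k$) with $x'_k\in X^*$, $y_k\in Y$ and $\sum_{k}\|x'_k\|^s\|y_k\|^s<\infty$. Such operators are compact (Riesz) operators, so their nonzero spectrum consists of at most countably many eigenvalues of finite algebraic multiplicity. *)

theory Defs
  imports "HOL-Probability.Probability"
begin

text \<open>Isabelle/HOL has no type class of complex normed spaces. A complex Banach space is
  modelled as a real Banach space (type class banach) together with a real-linear map J
  (multiplication by the imaginary unit) such that J (J x) = - x and the induced complex
  scalar multiplication is absolutely homogeneous.\<close>

definition cscale :: "('a::real_vector \<Rightarrow> 'a) \<Rightarrow> complex \<Rightarrow> 'a \<Rightarrow> 'a" where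
  "cscale J c x = Re c *\<^sub>R x + Im c *\<^sub>R J x"

definition complex_structure :: "('a::real_normed_vector \<Rightarrow> 'a) \<Rightarrow> bool" where
  "complex_structure J \<longleftrightarrow> linear J \<and> (\<forall>x. J (J x) = - x) \<and>
     (\<forall>c x. norm (cscale J c x) = cmod c * norm x)"

definition cdual :: "('a::real_normed_vector \<Rightarrow> 'a) \<Rightarrow> ('a \<Rightarrow> complex) \<Rightarrow> bool" where
  "cdual J f \<longleftrightarrow> bounded_linear f \<and> (\<forall>x. f (J x) = \<i> * f x)"

definition nuclear_rep ::
  "('a::real_normed_vector \<Rightarrow> 'a) \<Rightarrow> real \<Rightarrow> ('a \<Rightarrow> 'a) \<Rightarrow> (nat \<Rightarrow> 'a \<Rightarrow> complex) \<Rightarrow> (nat \<Rightarrow> 'a) \<Rightarrow> bool"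
where
  "nuclear_rep J s T yd yv \<longleftrightarrow>
     (\<forall>k. cdual J (yd k)) \<and>
     summable (\<lambda>k. (onorm (yd k) * norm (yv k)) powr s) \<and>
     (\<forall>x. (\<lambda>k. cscale J (yd k x) (yv k)) sums T x)"

definition s_nuclear :: "('a::real_normed_vector \<Rightarrow> 'a) \<Rightarrow> real \<Rightarrow> ('a \<Rightarrow> 'a) \<Rightarrow> bool" where
  "s_nuclear J s T \<longleftrightarrow> (\<exists>yd yv. nuclear_rep J s T yd yv)"

definition eigenvalues :: "('a::real_normed_vector \<Rightarrow> 'a) \<Rightarrow> ('a \<Rightarrow> 'a) \<Rightarrow> complex set" where
  "eigenvalues J T = {z. \<exists>x. x \<noteq> 0 \<and> T x = cscale J z x}"

definition root_space :: "('a::real_normed_vector \<Rightarrow> 'a) \<Rightarrow> ('a \<Rightarrow> 'a) \<Rightarrow> complex \<Rightarrow> 'a set" where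
  "root_space J T z = {x. \<exists>k. ((\<lambda>v. T v - cscale J z v) ^^ k) x = 0}"

definition alg_mult :: "('a::real_normed_vector \<Rightarrow> 'a) \<Rightarrow> ('a \<Rightarrow> 'a) \<Rightarrow> complex \<Rightarrow> nat" where
  "alg_mult J T z = vector_space.dim (cscale J) (root_space J T z)"

definition Lp_mem :: "ereal \<Rightarrow> 'm measure \<Rightarrow> ('m \<Rightarrow> complex) \<Rightarrow> bool" where
  "Lp_mem p \<nu> f \<longleftrightarrow> f \<in> borel_measurable \<nu> \<and>
     (if p = \<infinity> then esssup \<nu> (\<lambda>x. ereal (cmod (f x))) < \<infinity>
      else integrable \<nu> (\<lambda>x. cmod (f x) powr real_of_ereal p))"

definition Lp_norm :: "ereal \<Rightarrow> 'm measure \<Rightarrow> ('m \<Rightarrow> complex) \<Rightarrow> real" where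
  "Lp_norm p \<nu> f =
     (if p = \<infinity> then real_of_ereal (esssup \<nu> (\<lambda>x. ereal (cmod (f x))))
      else (LINT x|\<nu>. cmod (f x) powr real_of_ereal p) powr (1 / real_of_ereal p))"

text \<open>Y (with complex structure J) is isomorphic to a (necessarily closed, Y being complete)
  subspace of L_p(\<nu>): there is a complex-linear (modulo null functions) map into L_p(\<nu>)
  with two-sided norm bounds.\<close>

definition iso_subspace_Lp :: "('a::real_normed_vector \<Rightarrow> 'a) \<Rightarrow> ereal \<Rightarrow> 'm measure \<Rightarrow> bool" where
  "iso_subspace_Lp J p \<nu> \<longleftrightarrow> (\<exists>(U :: 'a \<Rightarrow> 'm \<Rightarrow> complex) c C. c > 0 \<and>
     (\<forall>y. Lp_mem p \<nu> (U y)) \<and>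
     (\<forall>y z. AE x in \<nu>. U (y + z) x = U y x + U z x) \<and>
     (\<forall>a y. AE x in \<nu>. U (cscale J a y) x = a * U y x) \<and>
     (\<forall>y. c * norm y \<le> Lp_norm p \<nu> (U y) \<and> Lp_norm p \<nu> (U y) \<le> C * norm y))"

text \<open>Y is isomorphic to a quotient space L_p(\<nu>)/N: there is a bounded complex-linear map
  Q from L_p(\<nu>) onto Y such that the quotient norm induced by Q is equivalent to the norm of Y
  (then Y is isomorphic to L_p(\<nu>)/ker Q).\<close>

definition iso_quotient_Lp :: "('a::real_normed_vector \<Rightarrow> 'a) \<Rightarrow> ereal \<Rightarrow> 'm measure \<Rightarrow> bool" where
  "iso_quotient_Lp J p \<nu> \<longleftrightarrow> (\<exists>(Q :: ('m \<Rightarrow> complex) \<Rightarrow> 'a) C.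
     (\<forall>f g. Lp_mem p \<nu> f \<longrightarrow> Lp_mem p \<nu> g \<longrightarrow> Q (\<lambda>x. f x + g x) = Q f + Q g) \<and>
     (\<forall>a f. Lp_mem p \<nu> f \<longrightarrow> Q (\<lambda>x. a * f x) = cscale J a (Q f)) \<and>
     (\<forall>f. Lp_mem p \<nu> f \<longrightarrow> norm (Q f) \<le> C * Lp_norm p \<nu> f) \<and>
     (\<forall>y. \<exists>f. Lp_mem p \<nu> f \<and> Q f = y \<and> Lp_norm p \<nu> f \<le> C * norm y))"

end

theory Submission
  imports Defs
    "Jordan_Normal_Form.Schur_Decomposition"
    "HOL-Complex_Analysis.Complex_Analysis"
    "HOL-Library.Diagonal_Subsequence"
    "HOL-Library.Function_Algebras"
    "HOL-Real_Asymp.Real_Asymp"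
begin

text \<open>
  Normalise a representation so that $\|y'_k\| \le 1$ and $\|y_k\| \le \sigma_k^{1/s}$ with
  $\sum \sigma_k < \infty$. A change of density in $L_p$ factors every finite section of the matrix
  $m_{jk} = y'_j(y_k)$ through a Hilbert space, $m_{jk} = \langle v_j, w_k\rangle$ with
  $\|v_j\| \le \alpha_j$, $\|w_k\| \le \beta_k$ and $\sum \alpha_k\beta_k < \infty$. Together with the
  Schur decomposition this yields two facts. First, every triangular basis of a finite-dimensional
  $T$-invariant subspace with nonzero diagonal $(\lambda_i)$ satisfies
  $\sum|\lambda_i| \le \sum\alpha_k\beta_k$; this bounds dimensions of root spaces and gives absolute
  summability of the eigenvalues. Second, $|\det(1 - z m_n)| \le \prod_k (1 + |z|\alpha_k\beta_k)$
  for all finite sections, so these determinants have uniformly minimal exponential type.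

  To compute the trace, let $E$ be the sum of the root spaces for the eigenvalues of modulus at
  least $1/R$ and let $Q$ be a projection with kernel $E$. The finite sections of $QT$ have
  determinants without zeros in $|z| \le R$, and on a circle of radius between $2R$ and $3R$ these
  determinants are at most about $|\det(1 - z m_n)|$, because the quotient tends to
  $\prod (1 - z\lambda_i)$. The Borel--Caratheodory inequality then bounds the trace of $QT$, that is
  the trace of $T$ minus the sum of the large eigenvalues, by $o(1)$ as $R \to \infty$.
\<close>


section \<open>Orthonormal flags and a Hadamard-type inequality\<close>

text \<open>Independence of the representation is obtained indirectly: the trace of every
  representation is identified with the eigenvalue sum, which depends on \<open>T\<close> alone.
  Subspaces and quotients are handled together, because only a one-sided estimate is used: the norm
  of a combination of the \<open>y_k\<close> is at most a constant times the \<open>L_p\<close> norm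
  of the same combination of functions \<open>g_k\<close>, where \<open>g_k\<close> is the image of
  \<open>y_k\<close> in one case and a lift of \<open>y_k\<close> in the other. The origin of
  \<open>s\<close>: factoring through a Hilbert space costs \<open>\<sigma>_k\<close> to the power
  |1/2 - 1/p|, so vectors of size \<open>\<sigma>_k\<close> to the power 1/s leave exactly
  \<open>\<alpha>_k \<beta>_k\<close> proportional to \<open>\<sigma>_k\<close>. Minimal exponential
  type is essential at the end: Borel--Caratheodory divides the growth exponent at
  \<open>3 R\<close> by \<open>R\<close>, and ordinary exponential type would leave an error that is
  merely bounded. Eigenvalues are removed by passing to \<open>Q T\<close>, not by dividing an
  entire function by its zeros; all determinants thus remain finite-dimensional.\<close>

locale hermitian_space = vector_space sc
  for sc :: "complex \<Rightarrow> 'v::ab_group_add \<Rightarrow> 'v" +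
  fixes ip :: "'v \<Rightarrow> 'v \<Rightarrow> complex"
  assumes ip_add: "ip (x + y) z = ip x z + ip y z"
    and ip_sc: "ip (sc a x) z = a * ip x z"
    and ip_sym: "ip y x = cnj (ip x y)"
    and ip_nonneg: "0 \<le> Re (ip x x)"
begin

lemma ip_add_right: "ip z (x + y) = ip z x + ip z y"
  by (metis ip_add ip_sym complex_cnj_add)

lemma ip_sc_right: "ip z (sc a x) = cnj a * ip z x"
  by (metis ip_sc ip_sym complex_cnj_mult)

lemma ip_zero [simp]: "ip 0 x = 0" "ip x 0 = 0"
  using ip_sc[of 0 0 x] ip_sc_right[of x 0 0] by simp_all

lemma ip_minus: "ip (x - y) z = ip x z - ip y z"
  using ip_add[of "x - y" y z] by simp

lemma ip_minus_right: "ip z (x - y) = ip z x - ip z y"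
  using ip_add_right[of z "x - y" y] by simp

lemma ip_sum: "ip (\<Sum>i\<in>I. f i) z = (\<Sum>i\<in>I. ip (f i) z)"
  by (induction I rule: infinite_finite_induct) (auto simp: ip_add)

lemma ip_sum_right: "ip z (\<Sum>i\<in>I. f i) = (\<Sum>i\<in>I. ip z (f i))"
  by (induction I rule: infinite_finite_induct) (auto simp: ip_add_right)

lemma ip_self: "ip x x = complex_of_real (Re (ip x x))"
  using arg_cong[OF ip_sym[of x x], of Im] by (simp add: complex_eq_iff)

definition orthonormal :: "(nat \<Rightarrow> 'v) \<Rightarrow> nat \<Rightarrow> bool" where
  "orthonormal u d \<longleftrightarrow> (\<forall>i<d. \<forall>j<d. ip (u i) (u j) = (if i = j then 1 else 0))"

lemma orthonormal_expansion:
  assumes "orthonormal u d" "x \<in> span (u ` {..<d})"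
  shows "x = (\<Sum>i<d. sc (ip x (u i)) (u i))"
  using assms(2)
proof (induction rule: span_induct_alt)
  case base
  show ?case by (simp add: scale_zero_left)
next
  case (step c x y)
  then obtain k where k: "k < d" "x = u k" by auto
  have "(\<Sum>i<d. sc (ip (u k) (u i)) (u i)) = (\<Sum>i<d. if i = k then u k else 0)"
    using k assms(1) by (intro sum.cong) (auto simp: orthonormal_def)
  also have "\<dots> = u k" using k by simp
  finally have "(\<Sum>i<d. sc (ip (u k) (u i)) (u i)) = u k" .
  then have "(\<Sum>i<d. sc (ip (sc c x + y) (u i)) (u i)) = sc c (u k) + (\<Sum>i<d. sc (ip y (u i)) (u i))"
    by (simp add: ip_add ip_sc k scale_left_distrib sum.distrib flip: scale_scale scale_sum_right)
  with step k show ?case by simp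
qed

lemma bessel_inequality:
  assumes "orthonormal u d"
  shows "(\<Sum>i<d. (cmod (ip x (u i)))\<^sup>2) \<le> Re (ip x x)"
proof -
  define y where "y = (\<Sum>i<d. sc (ip x (u i)) (u i))"
  have yu: "ip y (u j) = ip x (u j)" if "j < d" for j
  proof -
    have "ip y (u j) = (\<Sum>i<d. if i = j then ip x (u j) else 0)"
      unfolding y_def ip_sum ip_sc using assms that
      by (intro sum.cong) (auto simp: orthonormal_def)
    then show ?thesis using that by simp
  qed
  have yy: "ip z y = (\<Sum>i<d. cnj (ip x (u i)) * ip z (u i))" for z
    by (simp add: y_def ip_sum_right ip_sc_right)
  have s: "(\<Sum>i<d. cnj (ip x (u i)) * ip x (u i)) = complex_of_real (\<Sum>i<d. (cmod (ip x (u i)))\<^sup>2)"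
    unfolding of_real_sum by (intro sum.cong refl) (metis complex_norm_square mult.commute)
  have 1: "ip x y = complex_of_real (\<Sum>i<d. (cmod (ip x (u i)))\<^sup>2)"
    by (simp only: yy s)
  have 2: "ip y y = complex_of_real (\<Sum>i<d. (cmod (ip x (u i)))\<^sup>2)"
    unfolding yy s[symmetric] by (intro sum.cong) (auto simp: yu)
  have 3: "ip y x = complex_of_real (\<Sum>i<d. (cmod (ip x (u i)))\<^sup>2)"
    by (simp add: ip_sym[of y x] 1)
  have "0 \<le> Re (ip (x - y) (x - y))" by (rule ip_nonneg)
  then show ?thesis by (simp add: ip_minus ip_minus_right 1 2 3)
qed

text \<open>Gram--Schmidt along a flag. Each new vector is a multiple of \<open>e d\<close> minus a
  component in the earlier span, and that span is invariant under \<open>T\<close>; so the defect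
  \<open>T v - sc (l d) v\<close> stays inside it and the diagonal \<open>l\<close> survives. As the
  form is only semi-definite, \<open>defin\<close> is what gives the new vector positive
  length.\<close>

lemma orthonormal_flag:
  assumes lin: "\<And>x y. T (x + y) = T x + T y" "\<And>a x. T (sc a x) = sc a (T x)"
    and indep: "\<And>i. i < d \<Longrightarrow> e i \<notin> span (e ` {..<i})"
    and flag: "\<And>i. i < d \<Longrightarrow> T (e i) - sc (l i) (e i) \<in> span (e ` {..<i})"
    and defin: "\<And>x. x \<in> span (e ` {..<d}) \<Longrightarrow> ip x x = 0 \<Longrightarrow> x = 0"
  shows "\<exists>u. orthonormal u d \<and> span (u ` {..<d}) = span (e ` {..<d}) \<and>
    (\<forall>i<d. T (u i) - sc (l i) (u i) \<in> span (u ` {..<i}))"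
  using indep flag defin
proof (induction d)
  case 0
  then show ?case by (auto simp: orthonormal_def)
next
  case (Suc d)
  have mono: "span (e ` {..<d}) \<subseteq> span (e ` {..<Suc d})" by (intro span_mono) auto
  have "\<exists>u. orthonormal u d \<and> span (u ` {..<d}) = span (e ` {..<d}) \<and>
    (\<forall>i<d. T (u i) - sc (l i) (u i) \<in> span (u ` {..<i}))"
  proof (rule Suc.IH)
    show "e i \<notin> span (e ` {..<i})" if "i < d" for i
      by (rule Suc.prems(1)) (use that in simp)
    show "T (e i) - sc (l i) (e i) \<in> span (e ` {..<i})" if "i < d" for i
      by (rule Suc.prems(2)) (use that in simp)
    show "x = 0" if "x \<in> span (e ` {..<d})" "ip x x = 0" for x
      by (rule Suc.prems(3)) (use that mono in auto)
  qed
  then obtain u where u: "orthonormal u d" and sp: "span (u ` {..<d}) = span (e ` {..<d})"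
    and fl: "\<And>i. i < d \<Longrightarrow> T (u i) - sc (l i) (u i) \<in> span (u ` {..<i})" by blast
  define S where "S = span (u ` {..<d})"
  have subS: "subspace S" by (simp add: S_def)
  note ss = subspace_add[OF subS] subspace_diff[OF subS] subspace_scale[OF subS]
  have uS: "u i \<in> S" if "i < d" for i using that by (auto simp: S_def intro!: span_base)
  have TS: "T x \<in> S" if "x \<in> S" for x
    using that unfolding S_def
  proof (induction rule: span_induct_alt)
    case base
    have "T 0 = 0" using lin(2)[of 0 0] by simp
    then show ?case using span_zero by simp
  next
    case (step c x y)
    then obtain k where k: "k < d" "x = u k" by auto
    have "span (u ` {..<k}) \<subseteq> S" unfolding S_def using k by (intro span_mono) auto
    then have "T (u k) - sc (l k) (u k) \<in> S" using fl[OF k(1)] by auto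
    then have "T (u k) - sc (l k) (u k) + sc (l k) (u k) \<in> S"
      using ss uS[OF k(1)] by blast
    then have "T (u k) \<in> S" by simp
    then show ?case using step k ss by (simp add: lin S_def)
  qed
  define v where "v = e d - (\<Sum>i<d. sc (ip (e d) (u i)) (u i))"
  have proj: "(\<Sum>i<d. sc (ip (e d) (u i)) (u i)) \<in> S"
    using uS by (intro subspace_sum subS ss(3)) auto
  have "v \<notin> S"
  proof
    assume "v \<in> S"
    then have "v + (\<Sum>i<d. sc (ip (e d) (u i)) (u i)) \<in> S" using proj ss by blast
    then show False using Suc.prems(1)[of d] by (simp add: v_def S_def sp)
  qed
  then have v0: "v \<noteq> 0" using subspace_0[OF subS] by auto
  have eS: "S \<subseteq> span (e ` {..<Suc d})" using mono by (simp add: S_def sp)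
  have "e d \<in> span (e ` {..<Suc d})" by (auto intro: span_base)
  then have vspan: "v \<in> span (e ` {..<Suc d})" 
    unfolding v_def using proj eS by (intro span_diff) auto
  then have "ip v v \<noteq> 0" using Suc.prems(3) v0 by blast
  then have pos: "0 < Re (ip v v)" using ip_nonneg[of v] ip_self[of v]
    by (cases "Re (ip v v) = 0") auto
  define c where "c = complex_of_real (1 / sqrt (Re (ip v v)))"
  have c0: "c \<noteq> 0" using pos by (simp add: c_def)
  define w where "w = sc c v"
  have vu: "ip v (u j) = 0" if "j < d" for j
  proof -
    have "ip (\<Sum>i<d. sc (ip (e d) (u i)) (u i)) (u j) = (\<Sum>i<d. if i = j then ip (e d) (u j) else 0)"
      unfolding ip_sum ip_sc using u that
      by (intro sum.cong) (auto simp: orthonormal_def)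
    then show ?thesis using that by (simp add: v_def ip_minus)
  qed
  have wu: "ip w (u j) = 0" "ip (u j) w = 0" if "j < d" for j
    using vu[OF that] ip_sym[of "u j" w] by (auto simp: w_def ip_sc)
  have ww: "ip w w = 1"
  proof -
    have "ip w w = c * cnj c * ip v v" by (simp add: w_def ip_sc ip_sc_right)
    also have "c * cnj c = complex_of_real (1 / Re (ip v v))"
      using pos by (simp add: c_def flip: of_real_mult)
    also have "\<dots> * ip v v = complex_of_real (1 / Re (ip v v) * Re (ip v v))"
      by (subst (2) ip_self) (simp only: of_real_mult)
    also have "1 / Re (ip v v) * Re (ip v v) = 1" using pos by simp
    finally show ?thesis by simp
  qed
  define u' where "u' = u(d := w)"
  have u'S: "u' ` {..<i} = u ` {..<i}" if "i \<le> d" for i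
    using that by (auto simp: u'_def)
  have on: "orthonormal u' (Suc d)"
    using u wu ww unfolding orthonormal_def u'_def by (auto simp: less_Suc_eq)
  have wspan: "w \<in> span (e ` {..<Suc d})" using vspan by (auto simp: w_def intro: span_scale)
  have im: "u' ` {..<Suc d} = insert w (u ` {..<d})"
    using u'S[of d] unfolding lessThan_Suc image_insert by (simp add: u'_def del: fun_upd_image)
  have span_eq: "span (u' ` {..<Suc d}) = span (e ` {..<Suc d})"
  proof (rule antisym)
    show "span (u' ` {..<Suc d}) \<subseteq> span (e ` {..<Suc d})"
      unfolding im using wspan uS eS by (intro span_minimal) auto
    have SS: "S \<subseteq> span (u' ` {..<Suc d})" unfolding im S_def by (intro span_mono) auto
    have "sc (1 / c) w \<in> span (u' ` {..<Suc d})" 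
      unfolding im by (intro span_scale span_base) auto
    then have "v \<in> span (u' ` {..<Suc d})" using c0 by (simp add: w_def)
    then have "v + (\<Sum>i<d. sc (ip (e d) (u i)) (u i)) \<in> span (u' ` {..<Suc d})"
      using proj SS by (intro span_add) auto
    then have ed: "e d \<in> span (u' ` {..<Suc d})" by (simp add: v_def)
    have "e i \<in> S" if "i < d" for i using that by (auto simp: S_def sp intro: span_base)
    then have "e i \<in> span (u' ` {..<Suc d})" if "i < d" for i using SS that by blast
    then show "span (e ` {..<Suc d}) \<subseteq> span (u' ` {..<Suc d})"
      using ed by (intro span_minimal) (auto simp: less_Suc_eq)
  qed
  have "T (u' i) - sc (l i) (u' i) \<in> span (u' ` {..<i})" if "i < Suc d" for i
  proof (cases "i = d")
    case False
    then show ?thesis using that fl[of i] u'S[of i] by (simp add: u'_def)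
  next
    case True
    define p where "p = (\<Sum>i<d. sc (ip (e d) (u i)) (u i))"
    have Tneg: "T (x - y) = T x - T y" for x y
      using lin(1)[of "x - y" y] by simp
    have "T (e d) - sc (l d) (e d) \<in> S" using Suc.prems(2)[of d] by (simp add: S_def sp)
    moreover have "T p - sc (l d) p \<in> S" using proj TS ss by (auto simp: p_def)
    ultimately have "(T (e d) - sc (l d) (e d)) - (T p - sc (l d) p) \<in> S" using ss by blast
    moreover have "(T (e d) - sc (l d) (e d)) - (T p - sc (l d) p) = T v - sc (l d) v"
      by (simp add: v_def p_def[symmetric] Tneg scale_right_diff_distrib)
    ultimately have "sc c (T v - sc (l d) v) \<in> S" using ss by simp
    moreover have "sc c (T v - sc (l d) v) = T w - sc (l d) w"
      by (simp add: w_def lin scale_right_diff_distrib mult.commute)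
    ultimately show ?thesis using True u'S[of d] by (simp add: u'_def S_def)
  qed
  then show ?case using on span_eq by blast
qed

text \<open>In an orthonormal flag the diagonal entries become inner products; in this shape
  eigenvalues enter the trace estimates.\<close>

lemma flag_diagonal:
  assumes "orthonormal u d" "i < d" "y - sc l (u i) \<in> span (u ` {..<i})"
  shows "ip y (u i) = l"
proof -
  have "ip x (u i) = 0" if "x \<in> span (u ` {..<i})" for x
    using that
  proof (induction rule: span_induct_alt)
    case (step c x y)
    then show ?case using assms(1,2) by (auto simp: ip_add ip_sc orthonormal_def)
  qed simp
  from this[OF assms(3)] show ?thesis
    using assms(1,2) by (simp add: ip_minus ip_sc orthonormal_def)
qed

end

section \<open>Determinant bounds from bounds on generalised diagonal sums\<close>

lemma sum_fun_apply: "(\<Sum>i\<in>I. f i) x = (\<Sum>i\<in>I. (f i x :: 'b :: comm_monoid_add))"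
  by (induction I rule: infinite_finite_induct) auto

text \<open>The matrix with entries \<open>cnj (q i j)\<close> is a contraction from
  \<open>C^n\<close> to \<open>C^r\<close>. Orthonormality would be too strong: the coordinate
  sequences of an orthonormal flag, cut off at \<open>n\<close>, keep only Bessel's
  inequality.\<close>

definition bessel_family :: "nat \<Rightarrow> nat \<Rightarrow> (nat \<Rightarrow> nat \<Rightarrow> complex) \<Rightarrow> bool" where
  "bessel_family n r q \<longleftrightarrow>
     (\<forall>c. (\<Sum>i<r. (cmod (\<Sum>j<n. cnj (q i j) * c j))\<^sup>2) \<le> (\<Sum>j<n. (cmod (c j))\<^sup>2))"

text \<open>\<open>C^n\<close> is modelled by functions on \<open>nat\<close>, so that no type
  depends on \<open>n\<close>. The form ignores coordinates from \<open>n\<close> on and is definite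
  on functions supported below \<open>n\<close>.\<close>

lemma hermitian_space_trunc:
  "hermitian_space (\<lambda>(a::complex) x (j::nat). a * x j) (\<lambda>x y. \<Sum>j<n. x j * cnj (y j))"
proof
  show "0 \<le> Re (\<Sum>j<n. x j * cnj (x j))" for x :: "nat \<Rightarrow> complex"
    by (simp add: complex_mult_cnj sum_nonneg)
  show "(\<Sum>j<n. y j * cnj (x j)) = cnj (\<Sum>j<n. x j * cnj (y j))" for x y :: "nat \<Rightarrow> complex"
    by (simp add: mult.commute)
qed (auto simp: fun_eq_iff algebra_simps sum.distrib sum_distrib_left)

text \<open>Schur triangularisation turns the hypothesis into a bound on the sum of the moduli of the
  eigenvalues; AM-GM does the rest.\<close>

lemma cmod_det_le_one:
  fixes A :: "complex mat"
  assumes A: "A \<in> carrier_mat n n"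
    and bound: "\<And>q. bessel_family n n q \<Longrightarrow>
      (\<Sum>i<n. cmod (\<Sum>j<n. \<Sum>k<n. cnj (q i j) * A $$ (j,k) * q i k)) \<le> n"
  shows "cmod (det A) \<le> 1"
proof (cases "n = 0")
  case True
  then show ?thesis using A by simp
next
  case n0: False
  obtain es where es: "char_poly A = (\<Prod>a\<leftarrow>es. [:- a, 1:])"
    using char_poly_factorized[OF A] by blast
  obtain B where B: "B \<in> carrier_mat n n" "upper_triangular B" "similar_mat A B"
    using schur_decomposition_exists[OF A es] by blast
  then obtain P Q where w: "similar_mat_wit A B P Q" by (auto simp: similar_mat_def)
  have P: "P \<in> carrier_mat n n" and Q: "Q \<in> carrier_mat n n" and QP: "Q * P = 1\<^sub>m n"
    and APBQ: "A = P * B * Q"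
    using similar_mat_witD2[OF A w] by auto
  define sc where "sc = (\<lambda>(a::complex) x (j::nat). a * x j)"
  interpret hermitian_space sc "\<lambda>x y. \<Sum>j<n. x j * cnj (y j)"
    unfolding sc_def by (rule hermitian_space_trunc)
  define T where "T = (\<lambda>x j. if j < n then \<Sum>k<n. A $$ (j,k) * x k else 0)"
  define e where "e = (\<lambda>i j. if j < n then P $$ (j,i) else 0)"
  define l where "l = (\<lambda>i. B $$ (i,i))"
  have AP: "A * P = P * B"
  proof -
    have "A * P = P * B * (Q * P)" unfolding APBQ using P B Q by (simp add: assoc_mult_mat[of _ n n _ n _ n])
    then show ?thesis using QP P B by simp
  qed
  have Te: "T (e i) = (\<Sum>k\<in>{..i}. sc (B $$ (k,i)) (e k))" if i: "i < n" for i
  proof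
    fix j
    show "T (e i) j = (\<Sum>k\<in>{..i}. sc (B $$ (k,i)) (e k)) j"
    proof (cases "j < n")
      case True
      have "T (e i) j = (A * P) $$ (j,i)"
        using True i A P by (simp add: T_def e_def scalar_prod_def lessThan_atLeast0)
      also have "\<dots> = (P * B) $$ (j,i)" by (simp add: AP)
      also have "\<dots> = (\<Sum>k<n. P $$ (j,k) * B $$ (k,i))"
        using True i P B by (simp add: scalar_prod_def lessThan_atLeast0)
      also have "\<dots> = (\<Sum>k\<in>{..i}. P $$ (j,k) * B $$ (k,i))"
        using i B by (intro sum.mono_neutral_right) (auto simp: upper_triangular_def)
      also have "\<dots> = (\<Sum>k\<in>{..i}. sc (B $$ (k,i)) (e k)) j"
        using True by (simp add: sc_def e_def sum_fun_apply mult.commute)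
      finally show ?thesis .
    qed (simp add: T_def e_def sc_def sum_fun_apply)
  qed
  have ex: "\<exists>u. orthonormal u n \<and> span (u ` {..<n}) = span (e ` {..<n}) \<and>
    (\<forall>i<n. T (u i) - sc (l i) (u i) \<in> span (u ` {..<i}))"
  proof (rule orthonormal_flag)
    show "T (x + y) = T x + T y" for x y
      by (auto simp: T_def fun_eq_iff plus_fun_def algebra_simps sum.distrib)
    show "T (sc a x) = sc a (T x)" for a x
      by (auto simp: T_def fun_eq_iff sc_def sum_distrib_left mult_ac)
    fix i assume i: "i < n"
    \<comment> \<open>Row \<open>i\<close> of \<open>Q\<close>, the inverse of \<open>P\<close>, is
      a linear functional that vanishes on the earlier columns of \<open>P\<close> and takes the
      value 1 at column \<open>i\<close>; this gives independence.\<close>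
    have "(\<Sum>j<n. Q $$ (i,j) * x j) = 0" if "x \<in> span (e ` {..<i})" for x
      using that
    proof (induction rule: span_induct_alt)
      case (step c x y)
      then obtain k where k: "k < i" "x = e k" by auto
      have "(\<Sum>j<n. Q $$ (i,j) * e k j) = (Q * P) $$ (i,k)"
        using k i P Q by (simp add: e_def scalar_prod_def lessThan_atLeast0)
      also have "\<dots> = 0" using k i by (simp add: QP)
      finally have "(\<Sum>j<n. Q $$ (i,j) * e k j) = 0" .
      moreover have "(\<Sum>j<n. Q $$ (i,j) * (c * e k j)) = c * (\<Sum>j<n. Q $$ (i,j) * e k j)"
        by (simp add: sum_distrib_left mult.left_commute)
      ultimately have "(\<Sum>j<n. Q $$ (i,j) * (c * e k j)) = 0" by simp
      then show ?case using step k by (simp add: sc_def distrib_left sum.distrib)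
    qed (simp add: zero_fun_def)
    moreover have "(\<Sum>j<n. Q $$ (i,j) * e i j) = 1"
    proof -
      have "(\<Sum>j<n. Q $$ (i,j) * e i j) = (Q * P) $$ (i,i)"
        using i P Q by (simp add: e_def scalar_prod_def lessThan_atLeast0)
      then show ?thesis using i by (simp add: QP)
    qed
    ultimately show "e i \<notin> span (e ` {..<i})" by force
    have "T (e i) - sc (l i) (e i) = (\<Sum>k<i. sc (B $$ (k,i)) (e k))"
      unfolding Te[OF i] l_def by (simp add: lessThan_Suc_atMost[symmetric])
    also have "\<dots> \<in> span (e ` {..<i})" by (intro span_sum span_scale span_base) auto
    finally show "T (e i) - sc (l i) (e i) \<in> span (e ` {..<i})" .
  next
    fix x assume x: "x \<in> span (e ` {..<n})" and 0: "(\<Sum>j<n. x j * cnj (x j)) = 0"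
    have supp: "x j = 0" if "\<not> j < n" for j
      using x
    proof (induction rule: span_induct_alt)
      case (step c x y)
      then show ?case using that by (auto simp: sc_def e_def)
    qed simp
    have "complex_of_real (\<Sum>j<n. (cmod (x j))\<^sup>2) = (\<Sum>j<n. x j * cnj (x j))"
      by (simp only: of_real_sum complex_norm_square)
    then have "(\<Sum>j<n. (cmod (x j))\<^sup>2) = 0" unfolding 0 by (metis of_real_eq_0_iff)
    then have "x j = 0" if "j < n" for j
      using that by (simp add: sum_nonneg_eq_0_iff)
    then show "x = 0" using supp by (auto simp: fun_eq_iff zero_fun_def)
  qed
  then obtain u where u: "orthonormal u n"
    and fl: "\<And>i. i < n \<Longrightarrow> T (u i) - sc (l i) (u i) \<in> span (u ` {..<i})" by blast
  have bf: "bessel_family n n u"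
    unfolding bessel_family_def
  proof
    fix c :: "nat \<Rightarrow> complex"
    show "(\<Sum>i<n. (cmod (\<Sum>j<n. cnj (u i j) * c j))\<^sup>2) \<le> (\<Sum>j<n. (cmod (c j))\<^sup>2)"
      using bessel_inequality[OF u, of c] by (simp add: mult.commute complex_mult_cnj cmod_power2)
  qed
  have "(\<Sum>j<n. \<Sum>k<n. cnj (u i j) * A $$ (j,k) * u i k) = l i" if "i < n" for i
  proof -
    have "l i = (\<Sum>j<n. T (u i) j * cnj (u i j))"
      using flag_diagonal[OF u that fl[OF that]] by simp
    also have "\<dots> = (\<Sum>j<n. \<Sum>k<n. cnj (u i j) * A $$ (j,k) * u i k)"
      by (intro sum.cong) (auto simp: T_def sum_distrib_left mult_ac)
    finally show ?thesis ..
  qed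
  then have sum: "(\<Sum>i<n. cmod (l i)) \<le> n" using bound[OF bf] by simp
  have "cmod (det A) = (\<Prod>i<n. cmod (l i))"
  proof -
    have "det A = det B" using det_similar[OF B(3)] .
    also have "\<dots> = prod_list (diag_mat B)" by (rule det_upper_triangular[OF B(2,1)])
    also have "\<dots> = (\<Prod>i<n. l i)"
      using B(1) by (simp add: diag_mat_def l_def prod.list_conv_set_nth atLeast0LessThan)
    finally show ?thesis by (simp add: prod_norm)
  qed
  moreover have "(\<Prod>i<n. cmod (l i)) powr (1 / real n) \<le> 1"
  proof -
    have "(\<Prod>i<n. cmod (l i)) powr (1 / real n) \<le> (\<Sum>i<n. cmod (l i) / real n)"
      using arith_geom_mean[of "{..<n}" "\<lambda>i. cmod (l i)"] n0 by auto
    also have "\<dots> \<le> 1" using sum n0 by (simp flip: sum_divide_distrib)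
    finally show ?thesis .
  qed
  moreover have "0 \<le> (\<Prod>i<n. cmod (l i))" by (simp add: prod_nonneg)
  ultimately show ?thesis
    using gr_one_powr[of "\<Prod>i<n. cmod (l i)" "1 / real n"] n0
    by (metis divide_pos_pos leI less_numeral_extra(1) not_less of_nat_0_less_iff gr0I)
qed

text \<open>Says that each finite section of $m$ behaves like a Gram matrix $\langle v_j, w_k\rangle$ with
  $\|v_j\| \le \alpha_j$ and $\|w_k\| \le \beta_k$, for arbitrary rescalings of rows and columns.\<close>

definition trace_bound :: "(nat \<Rightarrow> nat \<Rightarrow> complex) \<Rightarrow> (nat \<Rightarrow> real) \<Rightarrow> (nat \<Rightarrow> real) \<Rightarrow> bool" where
  "trace_bound m \<alpha> \<beta> \<longleftrightarrow> (\<forall>n r q (a::nat \<Rightarrow> real) (b::nat \<Rightarrow> real). bessel_family n r q \<longrightarrow>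
     (\<Sum>i<r. cmod (\<Sum>j<n. \<Sum>k<n. cnj (q i j) * (complex_of_real (a j) * m j k * complex_of_real (b k)) * q i k))
       \<le> sqrt (\<Sum>j<n. (a j * \<alpha> j)\<^sup>2) * sqrt (\<Sum>k<n. (b k * \<beta> k)\<^sup>2))"

lemma trace_boundD:
  assumes "trace_bound m \<alpha> \<beta>" "bessel_family n r q"
  shows "(\<Sum>i<r. cmod (\<Sum>j<n. \<Sum>k<n. cnj (q i j) * (complex_of_real (a j) * m j k * complex_of_real (b k)) * q i k))
    \<le> sqrt (\<Sum>j<n. (a j * \<alpha> j)\<^sup>2) * sqrt (\<Sum>k<n. (b k * \<beta> k)\<^sup>2)"
  using assms unfolding trace_bound_def by blast

text \<open>Contractivity tested on the \<open>j\<close>-th unit vector.\<close>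

lemma bessel_family_column:
  assumes "bessel_family n r q" "j < n"
  shows "(\<Sum>i<r. (cmod (q i j))\<^sup>2) \<le> 1"
proof -
  have *: "(\<Sum>k<n. cnj (q i k) * (if k = j then 1 else 0)) = cnj (q i j)" for i
  proof -
    have "(\<Sum>k<n. cnj (q i k) * (if k = j then 1 else 0)) = (\<Sum>k<n. if k = j then cnj (q i j) else 0)"
      by (intro sum.cong) auto
    then show ?thesis using assms(2) by simp
  qed
  have **: "(\<Sum>k<n. (cmod (if k = j then 1 else 0))\<^sup>2) = 1"
  proof -
    have "(\<Sum>k<n. (cmod (if k = j then 1 else 0))\<^sup>2) = (\<Sum>k<n. if k = j then 1 else 0)"
      by (intro sum.cong) auto
    then show ?thesis using assms(2) by simp
  qed
  show ?thesis
    using assms(1)[unfolded bessel_family_def, rule_format, of "\<lambda>k. if k = j then 1 else 0"]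
    unfolding * ** by simp
qed

lemma det_diagonal_scaling:
  fixes N :: "nat \<Rightarrow> nat \<Rightarrow> 'a::comm_ring_1"
  shows "det (mat n n (\<lambda>(i,j). a i * N i j * b j)) = (\<Prod>i<n. a i) * (\<Prod>i<n. b i) * det (mat n n (\<lambda>(i,j). N i j))"
proof -
  have "(\<Prod>i = 0..<n. mat n n (\<lambda>(i,j). a i * N i j * b j) $$ (i, p i)) =
     (\<Prod>i<n. a i) * (\<Prod>i<n. b i) * (\<Prod>i = 0..<n. mat n n (\<lambda>(i,j). N i j) $$ (i, p i))"
    if p: "p permutes {0..<n}" for p
  proof -
    have lt: "p i < n" if "i < n" for i using permutes_in_image[OF p, of i] that by simp
    have "(\<Prod>i = 0..<n. mat n n (\<lambda>(i,j). a i * N i j * b j) $$ (i, p i)) =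
      (\<Prod>i = 0..<n. a i * N i (p i) * b (p i))"
      using lt by (intro prod.cong) auto
    also have "\<dots> = (\<Prod>i=0..<n. a i) * (\<Prod>i=0..<n. b (p i)) * (\<Prod>i=0..<n. N i (p i))"
      by (simp add: prod.distrib mult_ac)
    also have "(\<Prod>i=0..<n. b (p i)) = (\<Prod>i=0..<n. b i)"
      using prod.permute[OF p, of b] by (simp add: o_def)
    also have "(\<Prod>i=0..<n. N i (p i)) = (\<Prod>i = 0..<n. mat n n (\<lambda>(i,j). N i j) $$ (i, p i))"
      using lt by (intro prod.cong) auto
    finally show ?thesis by (simp add: atLeast0LessThan)
  qed
  note perm = this
  have "det (mat n n (\<lambda>(i,j). a i * N i j * b j)) = (\<Sum>p | p permutes {0..<n}. of_int (sign p) *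
      ((\<Prod>i<n. a i) * (\<Prod>i<n. b i) * (\<Prod>i = 0..<n. mat n n (\<lambda>(i,j). N i j) $$ (i, p i))))"
    unfolding Determinant.det_def dim_row_mat dim_col_mat if_True
    by (simp only: refl if_True) (intro sum.cong refl, simp only: mem_Collect_eq perm)
  also have "\<dots> = (\<Prod>i<n. a i) * (\<Prod>i<n. b i) * det (mat n n (\<lambda>(i,j). N i j))"
    unfolding Determinant.det_def dim_row_mat dim_col_mat
    by (simp only: refl if_True sum_distrib_left mult.left_commute mult.assoc)
  finally show ?thesis .
qed

text \<open>Without the rescaling by \<open>\<rho>\<close>, Schur and AM-GM would give only
  \<open>exp (cmod z * (\<Sum>k<n. \<alpha> k * \<beta> k))\<close>. Scaling row and column
  \<open>k\<close> by \<open>\<rho> k\<close> to the power -1/2 first produces the product, whose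
  logarithm is \<open>o(cmod z)\<close> uniformly in \<open>n\<close> when the
  \<open>\<alpha> k * \<beta> k\<close> are summable.\<close>

lemma det_bound:
  assumes tb: "trace_bound m \<alpha> \<beta>" and pos: "\<And>k. 0 < \<alpha> k" "\<And>k. 0 < \<beta> k"
  shows "cmod (det (mat n n (\<lambda>(j,k). (if j = k then 1 else 0) - z * m j k)))
    \<le> (\<Prod>k<n. 1 + cmod z * (\<alpha> k * \<beta> k))"
proof -
  define \<rho> where "\<rho> k = 1 + cmod z * (\<alpha> k * \<beta> k)" for k
  have \<rho>: "1 \<le> \<rho> k" for k
    using pos[of k] by (simp add: \<rho>_def)
  have \<rho>0: "0 < \<rho> k" for k using \<rho>[of k] by simp
  \<comment> \<open>This scaling makes the diagonal part and the trace bound add up to exactly \<open>n\<close>.\<close>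
  define x where "x k = 1 / sqrt (\<rho> k)" for k
  have x2: "(x k)\<^sup>2 = 1 / \<rho> k" "x k * x k = 1 / \<rho> k" for k
    using \<rho>0[of k] by (auto simp: x_def power_divide)
  have xpos: "0 < x k" for k using \<rho>0 by (simp add: x_def)
  \<comment> \<open>\<open>\<tau>\<close> balances the two weights:
    \<open>\<tau> k * \<alpha> k\<close> and \<open>\<beta> k / \<tau> k\<close> both equal
    \<open>sqrt (\<alpha> k * \<beta> k)\<close>, so the two square roots in the trace bound
    coincide. It cancels on the diagonal and in the determinant.\<close>
  define \<tau> where "\<tau> k = sqrt (\<beta> k / \<alpha> k)" for k
  have \<tau>pos: "0 < \<tau> k" for k using pos by (simp add: \<tau>_def)
  have \<tau>2: "(\<tau> k)\<^sup>2 = \<beta> k / \<alpha> k" for k using pos[of k] by (simp add: \<tau>_def less_imp_le)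
  define N where "N j k = (if j = k then 1 else 0) - z * m j k" for j k
  define A where "A = mat n n (\<lambda>(j,k). complex_of_real (x j * \<tau> j) * N j k * complex_of_real (x k / \<tau> k))"
  have le1: "cmod (det A) \<le> 1"
  proof (rule cmod_det_le_one)
    show "A \<in> carrier_mat n n" by (simp add: A_def)
    fix q assume q: "bessel_family n n q"
    define S where "S i = (\<Sum>j<n. \<Sum>k<n. cnj (q i j) *
       (complex_of_real (x j * \<tau> j) * m j k * complex_of_real (x k / \<tau> k)) * q i k)" for i
    have eq: "(\<Sum>j<n. \<Sum>k<n. cnj (q i j) * A $$ (j,k) * q i k) =
      (\<Sum>j<n. complex_of_real ((x j)\<^sup>2 * (cmod (q i j))\<^sup>2)) - z * S i" for i
    proof -
      have "(\<Sum>j<n. \<Sum>k<n. cnj (q i j) * A $$ (j,k) * q i k) =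
        (\<Sum>j<n. \<Sum>k<n. (if k = j then complex_of_real ((x j)\<^sup>2 * (cmod (q i j))\<^sup>2) else 0)
          - z * (cnj (q i j) * (complex_of_real (x j * \<tau> j) * m j k * complex_of_real (x k / \<tau> k)) * q i k))"
      proof (intro sum.cong refl)
        fix j k assume "j \<in> {..<n}" "k \<in> {..<n}"
        then have "cnj (q i j) * A $$ (j,k) * q i k =
          (if k = j then cnj (q i j) * q i j * complex_of_real ((x j * \<tau> j) * (x j / \<tau> j)) else 0)
          - z * (cnj (q i j) * (complex_of_real (x j * \<tau> j) * m j k * complex_of_real (x k / \<tau> k)) * q i k)"
          unfolding A_def N_def by (auto simp: algebra_simps)
        moreover have "cnj (q i j) * q i j = complex_of_real ((cmod (q i j))\<^sup>2)"
          by (metis complex_norm_square mult.commute)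
        moreover have "(x j * \<tau> j) * (x j / \<tau> j) = (x j)\<^sup>2"
          using \<tau>pos[of j] by (simp add: power2_eq_square)
        ultimately show "cnj (q i j) * A $$ (j,k) * q i k = (if k = j then complex_of_real ((x j)\<^sup>2 * (cmod (q i j))\<^sup>2) else 0)
          - z * (cnj (q i j) * (complex_of_real (x j * \<tau> j) * m j k * complex_of_real (x k / \<tau> k)) * q i k)"
          by (simp add: mult.commute)
      qed
      also have "\<dots> = (\<Sum>j<n. complex_of_real ((x j)\<^sup>2 * (cmod (q i j))\<^sup>2)) - z * S i"
        by (simp add: sum_subtractf S_def sum_distrib_left)
      finally show ?thesis .
    qed
    have 1: "cmod (\<Sum>j<n. complex_of_real ((x j)\<^sup>2 * (cmod (q i j))\<^sup>2)) = (\<Sum>j<n. (x j)\<^sup>2 * (cmod (q i j))\<^sup>2)" for i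
    proof -
      have "(\<Sum>j<n. complex_of_real ((x j)\<^sup>2 * (cmod (q i j))\<^sup>2)) = complex_of_real (\<Sum>j<n. (x j)\<^sup>2 * (cmod (q i j))\<^sup>2)"
        by (simp only: of_real_sum)
      then show ?thesis by (simp only: norm_of_real) (intro abs_of_nonneg sum_nonneg, auto)
    qed
    have 2: "(\<Sum>i<n. \<Sum>j<n. (x j)\<^sup>2 * (cmod (q i j))\<^sup>2) \<le> (\<Sum>j<n. (x j)\<^sup>2)"
    proof -
      have "(\<Sum>i<n. \<Sum>j<n. (x j)\<^sup>2 * (cmod (q i j))\<^sup>2) = (\<Sum>j<n. (x j)\<^sup>2 * (\<Sum>i<n. (cmod (q i j))\<^sup>2))"
        by (subst sum.swap) (simp add: sum_distrib_left)
      also have "\<dots> \<le> (\<Sum>j<n. (x j)\<^sup>2 * 1)"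
        using bessel_family_column[OF q] by (intro sum_mono mult_left_mono) auto
      finally show ?thesis by simp
    qed
    have 3: "(\<Sum>i<n. cmod (S i)) \<le> (\<Sum>j<n. (x j)\<^sup>2 * (\<alpha> j * \<beta> j))"
    proof -
      have "(\<Sum>i<n. cmod (S i)) \<le> sqrt (\<Sum>j<n. ((x j * \<tau> j) * \<alpha> j)\<^sup>2) * sqrt (\<Sum>k<n. ((x k / \<tau> k) * \<beta> k)\<^sup>2)"
        unfolding S_def by (rule trace_boundD[OF tb q])
      also have "(\<Sum>j<n. ((x j * \<tau> j) * \<alpha> j)\<^sup>2) = (\<Sum>j<n. (x j)\<^sup>2 * (\<alpha> j * \<beta> j))"
        using pos by (intro sum.cong refl) (simp add: power_mult_distrib \<tau>2, simp add: power2_eq_square less_imp_neq[symmetric] field_simps)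
      also have "(\<Sum>k<n. ((x k / \<tau> k) * \<beta> k)\<^sup>2) = (\<Sum>j<n. (x j)\<^sup>2 * (\<alpha> j * \<beta> j))"
        using pos by (intro sum.cong refl) (simp add: power_mult_distrib power_divide \<tau>2, simp add: power2_eq_square less_imp_neq[symmetric] field_simps)
      also have "sqrt (\<Sum>j<n. (x j)\<^sup>2 * (\<alpha> j * \<beta> j)) * sqrt (\<Sum>j<n. (x j)\<^sup>2 * (\<alpha> j * \<beta> j)) = (\<Sum>j<n. (x j)\<^sup>2 * (\<alpha> j * \<beta> j))"
        using pos by (simp add: sum_nonneg less_imp_le)
      finally show ?thesis .
    qed
    have "(\<Sum>i<n. cmod (\<Sum>j<n. \<Sum>k<n. cnj (q i j) * A $$ (j,k) * q i k))
      \<le> (\<Sum>i<n. (\<Sum>j<n. (x j)\<^sup>2 * (cmod (q i j))\<^sup>2) + cmod z * cmod (S i))"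
      unfolding eq by (intro sum_mono order.trans[OF norm_triangle_ineq4]) (simp only: 1 norm_mult order.refl)
    also have "\<dots> = (\<Sum>i<n. \<Sum>j<n. (x j)\<^sup>2 * (cmod (q i j))\<^sup>2) + cmod z * (\<Sum>i<n. cmod (S i))"
      by (simp add: sum.distrib sum_distrib_left)
    also have "\<dots> \<le> (\<Sum>j<n. (x j)\<^sup>2) + cmod z * (\<Sum>j<n. (x j)\<^sup>2 * (\<alpha> j * \<beta> j))"
      by (intro add_mono 2 mult_left_mono 3) auto
    also have "\<dots> = (\<Sum>j<n. (x j)\<^sup>2 * \<rho> j)"
      by (simp add: \<rho>_def sum.distrib sum_distrib_left algebra_simps)
    also have "\<dots> = real n" using \<rho>0 by (simp add: x2 less_imp_neq[symmetric])
    finally show "(\<Sum>i<n. cmod (\<Sum>j<n. \<Sum>k<n. cnj (q i j) * A $$ (j,k) * q i k)) \<le> real n" .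
  qed
  have "det A = (\<Prod>i<n. complex_of_real (x i * \<tau> i)) * (\<Prod>i<n. complex_of_real (x i / \<tau> i)) * det (mat n n (\<lambda>(j,k). N j k))"
    unfolding A_def by (rule det_diagonal_scaling)
  also have "(\<Prod>i<n. complex_of_real (x i * \<tau> i)) * (\<Prod>i<n. complex_of_real (x i / \<tau> i)) = complex_of_real (\<Prod>i<n. 1 / \<rho> i)"
  proof -
    have "(x i * \<tau> i) * (x i / \<tau> i) = 1 / \<rho> i" for i using \<tau>pos[of i] x2[of i] by simp
    then have "complex_of_real (x i * \<tau> i) * complex_of_real (x i / \<tau> i) = complex_of_real (1 / \<rho> i)" for i
      by (metis of_real_mult)
    then show ?thesis by (simp only: prod.distrib[symmetric] of_real_prod)
  qed
  finally have "cmod (det A) = (\<Prod>i<n. 1 / \<rho> i) * cmod (det (mat n n (\<lambda>(j,k). N j k)))"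
    using \<rho>0 by (simp only: norm_mult norm_of_real) (simp add: prod_nonneg less_imp_le)
  then have "cmod (det (mat n n (\<lambda>(j,k). N j k))) / (\<Prod>i<n. \<rho> i) \<le> 1"
    using le1 by (simp add: prod_dividef)
  then show ?thesis using \<rho>0 by (simp add: prod_pos divide_le_eq N_def \<rho>_def)
qed

section \<open>Holomorphic functions and determinants\<close>

text \<open>A zero-free \<open>f\<close> has a logarithm \<open>h\<close> with
  \<open>h 0 = 0\<close> and \<open>Re h\<close> at most \<open>A\<close>. The Moebius map
  \<open>u / (2 * B - u)\<close> sends the half-plane \<open>Re u < B\<close> into the unit disc, so
  the Schwarz lemma bounds the derivative of \<open>h\<close> at 0, which is that of
  \<open>f\<close>.\<close>

lemma Borel_Caratheodory_deriv:
  assumes hol: "f holomorphic_on ball 0 R" and R: "0 < R"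
    and nz: "\<And>z. z \<in> ball 0 R \<Longrightarrow> f z \<noteq> 0"
    and bound: "\<And>z. z \<in> ball 0 R \<Longrightarrow> cmod (f z) \<le> exp A" and f0: "f 0 = 1"
  shows "cmod (deriv f 0) \<le> 2 * A / R"
proof -
  obtain h0 where h0: "h0 holomorphic_on ball 0 R" "\<And>z. z \<in> ball 0 R \<Longrightarrow> f z = exp (h0 z)"
    using holomorphic_logarithm_exists[OF _ open_ball hol nz, of 0] R
    by (metis centre_in_ball convex_ball convex_imp_contractible holomorphic_logarithm_exists)
  define h where "h z = h0 z - h0 0" for z
  have h: "h holomorphic_on ball 0 R" "\<And>z. z \<in> ball 0 R \<Longrightarrow> f z = exp (h z)" "h 0 = 0"
    using h0 f0 R unfolding h_def by (auto simp: exp_diff intro!: holomorphic_intros)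
  have ReA: "Re (h z) \<le> A" if "z \<in> ball 0 R" for z
    using bound[OF that] h(2)[OF that] by simp
  have dh: "deriv f 0 = deriv h 0"
  proof -
    have "(h has_field_derivative deriv h 0) (at 0)"
      using h(1) R by (intro holomorphic_derivI[of _ "ball 0 R"]) auto
    then have "((\<lambda>z. exp (h z)) has_field_derivative deriv h 0) (at 0)"
      by (auto intro!: derivative_eq_intros simp: h(3))
    then have "(f has_field_derivative deriv h 0) (at 0)"
      by (rule has_field_derivative_transform_within_open[where S = "ball 0 R"]) (use R h(2) in auto)
    then show ?thesis by (rule DERIV_imp_deriv)
  qed
  have A0: "0 \<le> A" using ReA[of 0] R h(3) by simp
  \<comment> \<open>The Schwarz lemma needs a strict bound on \<open>g\<close>, hence a
    \<open>B\<close> strictly above \<open>A\<close>; letting \<open>B\<close> tend to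
    \<open>A\<close> comes last.\<close>
  have main: "cmod (deriv h 0) \<le> 2 * B / R" if B: "A < B" for B
  proof -
    have B0: "0 < B" using A0 B by simp
    have ReB: "Re (h z) < B" if "z \<in> ball 0 R" for z using ReA[OF that] B by simp
    define g where "g w = h (of_real R * w) / (2 * of_real B - h (of_real R * w))" for w
    have inb: "of_real R * w \<in> ball 0 R" if "cmod w < 1" for w
      using that R by (simp add: norm_mult)
    have den: "2 * of_real B - h (of_real R * w) \<noteq> 0" if "cmod w < 1" for w
    proof
      assume "2 * of_real B - h (of_real R * w) = 0"
      then have "Re (h (of_real R * w)) = 2 * B" by (auto simp: complex_eq_iff)
      then show False using ReB[OF inb[OF that]] B0 by simp
    qed
    have holh: "(\<lambda>w. h (of_real R * w)) holomorphic_on ball 0 1"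
      using h(1) inb by (intro holomorphic_on_compose_gen[of "\<lambda>w. of_real R * w" _ h "ball 0 R", unfolded o_def])
        (auto intro!: holomorphic_intros)
    have holg: "g holomorphic_on ball 0 1"
      unfolding g_def using den by (intro holomorphic_intros holh) auto
    have g0: "g 0 = 0" by (simp add: g_def h(3))
    have lt: "cmod (g w) < 1" if "cmod w < 1" for w
    proof -
      define u where "u = h (of_real R * w)"
      have "Re u < B" unfolding u_def using ReB[OF inb[OF that]] .
      then have "(Re u)\<^sup>2 < (2 * B - Re u)\<^sup>2" 
        using B0 by (auto simp: power2_eq_square algebra_simps)
      then have "cmod u < cmod (2 * of_real B - u)"
        by (simp add: cmod_def)
      then show ?thesis unfolding g_def u_def[symmetric] 
        by (simp add: norm_divide divide_less_eq)
    qed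
    have "cmod (deriv g 0) \<le> 1" using Schwarz_Lemma(2)[OF holg g0 lt, of 0] by simp
    moreover have "deriv g 0 = of_real R * deriv h 0 / (2 * of_real B)"
    proof (rule DERIV_imp_deriv)
      have d: "(h has_field_derivative deriv h 0) (at (of_real R * 0))"
        using h(1) R by (auto intro!: holomorphic_derivI[of _ "ball 0 R"])
      have "((\<lambda>w. h (of_real R * w)) has_field_derivative of_real R * deriv h 0) (at 0)"
        using DERIV_chain2[where f = h and g = "\<lambda>w. of_real R * w" and x = 0 and Db = "of_real R" and s = UNIV, OF d DERIV_cmult_Id]
        by (simp add: mult.commute)
      then show "(g has_field_derivative of_real R * deriv h 0 / (2 * of_real B)) (at 0)"
        unfolding g_def using B0
        by (auto intro!: derivative_eq_intros simp: h(3) power2_eq_square)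
    qed
    ultimately show ?thesis using B0 R by (simp add: norm_mult norm_divide field_simps)
  qed
  show ?thesis unfolding dh
  proof (rule field_le_epsilon)
    fix e :: real assume "0 < e"
    then have "cmod (deriv h 0) \<le> 2 * (A + e * R / 2) / R" using R by (intro main) auto
    also have "\<dots> = 2 * A / R + e" using R by (simp add: field_simps)
    finally show "cmod (deriv h 0) \<le> 2 * A / R + e" .
  qed
qed

text \<open>Such a product has a zero of order at least two at 0. This discards the non-identity
  permutations in the Leibniz formula for \<open>det (1 - z N)\<close>, each of which moves at least
  two indices.\<close>

lemma deriv_prod_at_two_zeros:
  fixes f :: "nat \<Rightarrow> complex \<Rightarrow> complex"
  assumes "finite I" "i \<in> I" "j \<in> I" "i \<noteq> j" "f i 0 = 0" "f j 0 = 0"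
    and d: "\<And>k. k \<in> I \<Longrightarrow> (f k has_field_derivative D k) (at 0)"
  shows "((\<lambda>z. \<Prod>k\<in>I. f k z) has_field_derivative 0) (at 0)"
proof -
  have "((\<lambda>z. \<Prod>k\<in>I. f k z) has_field_derivative (\<Sum>k\<in>I. D k * (\<Prod>l\<in>I - {k}. f l 0))) (at 0)"
    by (rule has_field_derivative_prod) (rule d)
  moreover have "(\<Sum>k\<in>I. D k * (\<Prod>l\<in>I - {k}. f l 0)) = 0"
  proof (intro sum.neutral ballI)
    fix k assume "k \<in> I"
    have "\<exists>l\<in>I - {k}. f l 0 = 0" using assms by (cases "k = i") auto
    then show "D k * (\<Prod>l\<in>I - {k}. f l 0) = 0" using assms(1) by (simp add: prod_zero)
  qed
  ultimately show ?thesis by simp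
qed

text \<open>Reads a trace off a determinant, so that a growth bound for the determinant becomes a
  bound for the trace. Only the identity permutation contributes to first order at 0.\<close>

lemma det_one_minus_deriv:
  fixes N :: "nat \<Rightarrow> nat \<Rightarrow> complex"
  shows "((\<lambda>z. det (mat n n (\<lambda>(j,k). (if j = k then 1 else 0) - z * N j k)))
     has_field_derivative - (\<Sum>k<n. N k k)) (at 0)"
    and "(\<lambda>z. det (mat n n (\<lambda>(j,k). (if j = k then 1 else 0) - z * N j k))) holomorphic_on X"
proof -
  define f where "f p i z = (if i = p i then 1 else 0) - z * N i (p i)" for p i z
  have det: "det (mat n n (\<lambda>(j,k). (if j = k then 1 else 0) - z * N j k)) =
    (\<Sum>p | p permutes {0..<n}. of_int (sign p) * (\<Prod>i\<in>{0..<n}. f p i z))" for z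
    unfolding Determinant.det_def dim_row_mat dim_col_mat
    by (simp only: refl if_True, intro sum.cong refl arg_cong2[where f = "(*)"] prod.cong)
      (auto simp: f_def permutes_in_image)
  show "(\<lambda>z. det (mat n n (\<lambda>(j,k). (if j = k then 1 else 0) - z * N j k))) holomorphic_on X"
    unfolding det f_def by (intro holomorphic_intros)
  have df: "(f p i has_field_derivative - N i (p i)) (at 0)" for p i
    unfolding f_def by (auto intro!: derivative_eq_intros)
  have D: "((\<lambda>z. of_int (sign p) * (\<Prod>i\<in>{0..<n}. f p i z)) has_field_derivative
      (if p = id then - (\<Sum>k<n. N k k) else 0)) (at 0)" if p: "p permutes {0..<n}" for p
  proof (cases "p = id")
    case True
    have "((\<lambda>z. \<Prod>i\<in>{0..<n}. f p i z) has_field_derivative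
      (\<Sum>k\<in>{0..<n}. - N k (p k) * (\<Prod>l\<in>{0..<n} - {k}. f p l 0))) (at 0)"
      using df by (intro has_field_derivative_prod) auto
    moreover have "(\<Sum>k\<in>{0..<n}. - N k (p k) * (\<Prod>l\<in>{0..<n} - {k}. f p l 0)) = - (\<Sum>k<n. N k k)"
      using True by (simp add: f_def sum_negf atLeast0LessThan)
    ultimately show ?thesis using True by (simp add: sign_id)
  next
    case False
    then obtain i where i: "p i \<noteq> i" by (auto simp: fun_eq_iff)
    then have "i \<in> {0..<n}" using p by (meson permutes_not_in)
    moreover have "p i \<in> {0..<n}" using \<open>i \<in> {0..<n}\<close> p by (simp only: permutes_in_image)
    moreover have "p (p i) \<noteq> p i" using i permutes_inj[OF p] by (auto dest: injD)
    ultimately have "((\<lambda>z. \<Prod>i\<in>{0..<n}. f p i z) has_field_derivative 0) (at 0)"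
      using i by (intro deriv_prod_at_two_zeros[OF _ _ _ _ _ _ df, of _ i "p i"]) (auto simp: f_def)
    then have "((\<lambda>z. of_int (sign p) * (\<Prod>i\<in>{0..<n}. f p i z)) has_field_derivative of_int (sign p) * 0) (at 0)"
      by (rule DERIV_cmult)
    then show ?thesis using False by simp
  qed
  have "((\<lambda>z. \<Sum>p | p permutes {0..<n}. of_int (sign p) * (\<Prod>i\<in>{0..<n}. f p i z)) has_field_derivative
     (\<Sum>p | p permutes {0..<n}. if p = id then - (\<Sum>k<n. N k k) else 0)) (at 0)"
    using D by (intro DERIV_sum) auto
  moreover have "(\<Sum>p | p permutes {0..<n}. if p = id then - (\<Sum>k<n. N k k) else 0) = - (\<Sum>k<n. N k k)"
    by (simp add: finite_permutations permutes_id)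
  ultimately show "((\<lambda>z. det (mat n n (\<lambda>(j,k). (if j = k then 1 else 0) - z * N j k)))
     has_field_derivative - (\<Sum>k<n. N k k)) (at 0)"
    unfolding det by simp
qed

lemma det_one_minus_0: "det (mat n n (\<lambda>(j,k). (if j = k then 1 else 0) - 0 * N j k)) = (1::complex)"
proof -
  have "mat n n (\<lambda>(j,k). (if j = k then 1 else 0) - 0 * N j k) = (1\<^sub>m n :: complex mat)" by auto
  then show ?thesis by simp
qed

text \<open>Both sides are the determinant of the block matrix \<open>?L\<close>: multiplying it by
  the unipotent \<open>?U1\<close> from the right or from the left clears different blocks. It later
  reduces an \<open>n\<close> by \<open>n\<close> determinant to one whose size is the rank
  \<open>d\<close> of a perturbation.\<close>

lemma sylvester_det:
  fixes X :: "'a::idom mat"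
  assumes X: "X \<in> carrier_mat n d" and C: "C \<in> carrier_mat d n"
  shows "det (1\<^sub>m n - X * C) = det (1\<^sub>m d - C * X)"
proof -
  let ?L = "four_block_mat (1\<^sub>m n) X C (1\<^sub>m d)"
  let ?U1 = "four_block_mat (1\<^sub>m n) (0\<^sub>m n d) (- C) (1\<^sub>m d)"
  have c: "?L \<in> carrier_mat (n+d) (n+d)" "?U1 \<in> carrier_mat (n+d) (n+d)" using X C by auto
  have dU: "det ?U1 = 1" by (subst det_four_block_mat_upper_right_zero[of _ n _ d]) (use C in auto)
  have "?L * ?U1 = four_block_mat (1\<^sub>m n - X * C) X (0\<^sub>m d n) (1\<^sub>m d)"
    using X C by (subst mult_four_block_mat[of _ n n _ d _ d _ _ n _ d]) 
      (auto intro!: cong_four_block_mat simp: uminus_mult_right_mat)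
  then have "det (?L * ?U1) = det (1\<^sub>m n - X * C)"
    using X C by (simp, subst det_four_block_mat_lower_left_zero[of _ n _ d]) auto
  then have 1: "det ?L = det (1\<^sub>m n - X * C)" using det_mult[OF c] dU by simp
  have "?U1 * ?L = four_block_mat (1\<^sub>m n) X (0\<^sub>m d n) (1\<^sub>m d - C * X)"
    using X C by (subst mult_four_block_mat[of _ n n _ d _ d _ _ n _ d]) 
      (auto intro!: cong_four_block_mat simp: uminus_mult_right_mat)
  then have "det (?U1 * ?L) = det (1\<^sub>m d - C * X)"
    using X C by (simp, subst det_four_block_mat_lower_left_zero[of _ n _ d]) auto
  then have "det ?L = det (1\<^sub>m d - C * X)" using det_mult[OF c(2,1)] dU by simp
  with 1 show ?thesis by simp
qed

text \<open>Uniformity in \<open>z\<close> comes from compactness: along counterexamples for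
  \<open>\<delta> = 1 / Suc n\<close>, a subsequence of the \<open>z\<close> converges to some
  \<open>w\<close>, and both determinants then tend to \<open>D w A\<close>.\<close>

lemma det_one_minus_continuous:
  fixes A :: "nat \<Rightarrow> nat \<Rightarrow> complex"
  assumes "0 < \<epsilon>"
  shows "\<exists>\<delta>>0. \<forall>z a. cmod z \<le> R \<longrightarrow> (\<forall>i<d. \<forall>j<d. cmod (a i j - A i j) \<le> \<delta>) \<longrightarrow>
    cmod (det (mat d d (\<lambda>(i,j). (if i = j then 1 else 0) - z * a i j)) -
          det (mat d d (\<lambda>(i,j). (if i = j then 1 else 0) - z * A i j))) < \<epsilon>"
proof (rule ccontr)
  define D where "D z a = det (mat d d (\<lambda>(i,j). (if i = j then 1 else 0) - z * a i j))"
    for z :: complex and a :: "nat \<Rightarrow> nat \<Rightarrow> complex"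
  have D: "D z a = (\<Sum>p | p permutes {0..<d}. of_int (sign p) * (\<Prod>i = 0..<d. (if i = p i then 1 else 0) - z * a i (p i)))" for z a
    unfolding D_def Determinant.det_def dim_row_mat dim_col_mat
    by (simp only: refl if_True, intro sum.cong refl arg_cong2[where f = "(*)"] prod.cong)
      (auto simp: permutes_in_image)
  assume neg: "\<not> ?thesis"
  have "\<exists>z a. cmod z \<le> R \<and> (\<forall>i<d. \<forall>j<d. cmod (a i j - A i j) \<le> 1 / Suc n) \<and> \<not> cmod (D z a - D z A) < \<epsilon>"
    for n :: nat
  proof (rule ccontr)
    assume "\<not> ?thesis"
    then have "\<forall>z a. cmod z \<le> R \<longrightarrow> (\<forall>i<d. \<forall>j<d. cmod (a i j - A i j) \<le> 1 / Suc n) \<longrightarrow> cmod (D z a - D z A) < \<epsilon>"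
      by blast
    moreover have "0 < 1 / real (Suc n)" by simp
    ultimately show False using neg unfolding D_def by blast
  qed
  then obtain z a where za: "\<And>n::nat. cmod (z n) \<le> R" "\<And>n i j. i < d \<Longrightarrow> j < d \<Longrightarrow> cmod (a n i j - A i j) \<le> 1 / Suc n"
    "\<And>n. \<not> cmod (D (z n) (a n) - D (z n) A) < \<epsilon>" by metis
  have "bounded (range z)" using za(1) by (auto simp: bounded_iff)
  then obtain w r where r: "strict_mono r" "(z \<circ> r) \<longlonglongrightarrow> w"
    using bounded_imp_convergent_subsequence by blast
  have lim0: "(\<lambda>n. 1 / real (Suc n)) \<longlonglongrightarrow> 0" by (rule LIMSEQ_Suc[OF lim_1_over_n])
  have aA: "(\<lambda>n. a (r n) i j) \<longlonglongrightarrow> A i j" if "i < d" "j < d" for i j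
  proof -
    have "(\<lambda>n. a n i j - A i j) \<longlonglongrightarrow> 0"
      by (rule Lim_null_comparison[OF _ lim0]) (use za(2)[OF that] in auto)
    then have "(\<lambda>n. a n i j) \<longlonglongrightarrow> A i j" by (simp add: LIM_zero_iff)
    from LIMSEQ_subseq_LIMSEQ[OF this r(1)] show ?thesis by (simp add: o_def)
  qed
  have zr: "(\<lambda>n. z (r n)) \<longlonglongrightarrow> w" using r(2) by (simp add: o_def)
  have "(\<lambda>n. D (z (r n)) (a (r n))) \<longlonglongrightarrow> D w A"
    unfolding D using aA zr by (intro tendsto_intros) (auto simp: permutes_in_image)
  moreover have "(\<lambda>n. D (z (r n)) A) \<longlonglongrightarrow> D w A"
    unfolding D using zr by (intro tendsto_intros)
  ultimately have "(\<lambda>n. D (z (r n)) (a (r n)) - D (z (r n)) A) \<longlonglongrightarrow> D w A - D w A"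
    by (rule tendsto_diff)
  from tendsto_norm[OF this] have "(\<lambda>n. cmod (D (z (r n)) (a (r n)) - D (z (r n)) A)) \<longlonglongrightarrow> 0" by simp
  from order_tendstoD(2)[OF this assms]
  have "eventually (\<lambda>n. cmod (D (z (r n)) (a (r n)) - D (z (r n)) A) < \<epsilon>) sequentially" .
  then show False using za(3) by (auto simp: eventually_sequentially)
qed

section \<open>Operators with a trace bound\<close>

lemma bounded_bilinear_cscale:
  assumes "complex_structure J"
  shows "bounded_bilinear (cscale J)"
proof
  have lin: "linear J" and nrm: "\<And>c x. norm (cscale J c x) = cmod c * norm x"
    using assms by (auto simp: complex_structure_def)
  show "cscale J (a + a') b = cscale J a b + cscale J a' b" for a a' b
    by (simp add: cscale_def algebra_simps)
  show "cscale J a (b + b') = cscale J a b + cscale J a b'" for a b b'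
    by (simp add: cscale_def algebra_simps linear_add[OF lin])
  show "cscale J (r *\<^sub>R a) b = r *\<^sub>R cscale J a b" for r a b
    by (simp add: cscale_def algebra_simps)
  show "cscale J a (r *\<^sub>R b) = r *\<^sub>R cscale J a b" for r a b
    by (simp add: cscale_def algebra_simps linear_scale[OF lin])
  show "\<exists>K. \<forall>a b. norm (cscale J a b) \<le> norm a * norm b * K"
    by (rule exI[of _ 1]) (simp add: nrm)
qed

lemma vector_space_cscale:
  assumes "complex_structure J"
  shows "vector_space (cscale J)"
proof -
  interpret bounded_bilinear "cscale J" by (rule bounded_bilinear_cscale[OF assms])
  have lin: "linear J" and JJ: "\<And>x. J (J x) = - x"
    using assms by (auto simp: complex_structure_def)
  show ?thesis
  proof
    show "cscale J a (cscale J b x) = cscale J (a * b) x" for a b x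
      by (simp add: cscale_def algebra_simps linear_add[OF lin] linear_scale[OF lin] JJ)
    show "cscale J 1 x = x" for x by (simp add: cscale_def)
  qed (simp_all add: add_left add_right)
qed

text \<open>The interface between the spectral argument and the geometry of \<open>L_p\<close>.
  Summability of \<open>\<alpha> k * \<beta> k\<close> controls determinants and eigenvalue sums;
  summability of \<open>\<beta> k / \<alpha> k\<close> makes the weighted coordinate map land in
  \<open>l_2\<close>.\<close>

locale nuclear_operator =
  fixes J :: "'a::banach \<Rightarrow> 'a" and T :: "'a \<Rightarrow> 'a"
    and yd :: "nat \<Rightarrow> 'a \<Rightarrow> complex" and yv :: "nat \<Rightarrow> 'a" and \<alpha> \<beta> :: "nat \<Rightarrow> real"
  assumes J: "complex_structure J"
    and yd: "cdual J (yd k)" and yd_le: "cmod (yd k x) \<le> norm x"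
    and yv: "summable (\<lambda>k. norm (yv k))"
    and T: "(\<lambda>k. cscale J (yd k x) (yv k)) sums T x"
    and \<alpha>_pos: "0 < \<alpha> k" and \<beta>_pos: "0 < \<beta> k"
    and \<rho>_summable: "summable (\<lambda>k. \<alpha> k * \<beta> k)"
    and \<tau>_summable: "summable (\<lambda>k. \<beta> k / \<alpha> k)"
    and tb: "trace_bound (\<lambda>j k. yd j (yv k)) \<alpha> \<beta>"
begin

abbreviation sc where "sc \<equiv> cscale J"

sublocale sc: bounded_bilinear sc by (rule bounded_bilinear_cscale[OF J])
sublocale vs: vector_space sc by (rule vector_space_cscale[OF J])

lemma norm_sc: "norm (sc c x) = cmod c * norm x"
  using J by (simp add: complex_structure_def)

lemma yd_linear: "linear (yd k)"
  using yd[of k] by (simp add: cdual_def bounded_linear.linear)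

lemmas yd_add = linear_add[OF yd_linear] and yd_diff = linear_diff[OF yd_linear]
  and yd_sum = linear_sum[OF yd_linear] and yd_0 = linear_0[OF yd_linear]

lemma yd_sc: "yd k (sc c x) = c * yd k x"
proof -
  have "yd k (J x) = \<i> * yd k x" using yd[of k] by (simp add: cdual_def)
  then have "yd k (sc c x) = of_real (Re c) * yd k x + of_real (Im c) * (\<i> * yd k x)"
    by (simp add: cscale_def yd_add linear_scale[OF yd_linear] scaleR_conv_of_real)
  also have "\<dots> = (of_real (Re c) + \<i> * of_real (Im c)) * yd k x" by (simp add: algebra_simps)
  finally show ?thesis by (simp add: complex_eq[symmetric])
qed

definition TN :: "nat \<Rightarrow> 'a \<Rightarrow> 'a" where "TN n x = (\<Sum>k<n. sc (yd k x) (yv k))"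

text \<open>Bounds the operator norm of \<open>T - TN n\<close>; in particular
  \<open>\<epsilon> 0\<close> bounds that of \<open>T\<close>.\<close>

definition \<epsilon> :: "nat \<Rightarrow> real" where "\<epsilon> n = (\<Sum>k. norm (yv (k + n)))"

lemma \<epsilon>_tendsto: "\<epsilon> \<longlonglongrightarrow> 0"
  unfolding \<epsilon>_def using suminf_exist_split2[OF yv] by simp

lemma T_eq: "T x = (\<Sum>k. sc (yd k x) (yv k))"
  using T[of x] by (simp add: sums_iff)

lemma yv_shift: "summable (\<lambda>k. norm (yv (k + n)))"
  using summable_ignore_initial_segment[OF yv, of n] by simp

lemma norm_term_le: "norm (sc (yd k x) (yv k)) \<le> norm x * norm (yv k)"
  using yd_le[of k x] by (simp add: norm_sc mult_right_mono)

lemma T_diff_TN: "norm (T x - TN n x) \<le> \<epsilon> n * norm x"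
proof -
  have s: "summable (\<lambda>k. sc (yd k x) (yv k))" using T[of x] by (simp add: sums_iff)
  have s2: "summable (\<lambda>k. norm x * norm (yv (k + n)))"
    by (intro summable_mult yv_shift)
  have "T x - TN n x = (\<Sum>k. sc (yd (k + n) x) (yv (k + n)))"
    unfolding T_eq TN_def using suminf_split_initial_segment[OF s, of n] by simp
  also have "norm \<dots> \<le> (\<Sum>k. norm x * norm (yv (k + n)))"
    by (rule norm_suminf_le[OF norm_term_le s2])
  also have "\<dots> = \<epsilon> n * norm x"
    unfolding \<epsilon>_def by (subst suminf_mult[OF yv_shift]) (rule mult.commute)
  finally show ?thesis .
qed

lemma \<epsilon>_nonneg: "0 \<le> \<epsilon> n"
  unfolding \<epsilon>_def by (intro suminf_nonneg yv_shift) simp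

lemma T_norm: "norm (T x) \<le> \<epsilon> 0 * norm x"
  using T_diff_TN[of x 0] by (simp add: TN_def)

lemma T_add: "T (x + y) = T x + T y"
proof -
  have "(\<lambda>k. sc (yd k (x + y)) (yv k)) sums (T x + T y)"
    using sums_add[OF T[of x] T[of y]] by (simp add: yd_add sc.add_left)
  then show ?thesis using T sums_unique2 by blast
qed

lemma T_sc: "T (sc c x) = sc c (T x)"
proof -
  have "(\<lambda>k. sc c (sc (yd k x) (yv k))) sums sc c (T x)"
    by (rule bounded_linear.sums[OF sc.bounded_linear_right T])
  then have "(\<lambda>k. sc (yd k (sc c x)) (yv k)) sums sc c (T x)" by (simp add: yd_sc)
  then show ?thesis using T sums_unique2 by blast
qed

lemma T_bl: "bounded_linear T"
proof (rule bounded_linear_intro[where K = "\<epsilon> 0"])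
  show "T (r *\<^sub>R x) = r *\<^sub>R T x" for r x
    using T_sc[of "of_real r" x] by (simp add: cscale_def)
  show "norm (T x) \<le> norm x * \<epsilon> 0" for x using T_norm[of x] by (simp only: mult.commute)
qed (rule T_add)

lemmas T_diff = linear_diff[OF bounded_linear.linear[OF T_bl]]
  and T_0 = linear_0[OF bounded_linear.linear[OF T_bl]]

lemma TN_diff: "TN n (x - y) = TN n x - TN n y"
  by (simp add: TN_def yd_diff sc.diff_left sum_subtractf)

text \<open>The balancing weights of \<open>det_bound\<close> again:
  \<open>\<tau> k * \<alpha> k\<close> equals \<open>\<beta> k / \<tau> k\<close>. In the
  coordinates \<open>\<tau> k * yd k x\<close> the operator has the matrix
  \<open>\<tau> j * yd j (yv k) / \<tau> k\<close>.\<close>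

definition \<tau> :: "nat \<Rightarrow> real" where "\<tau> k = sqrt (\<beta> k / \<alpha> k)"

lemma \<tau>_pos: "0 < \<tau> k" using \<alpha>_pos \<beta>_pos by (simp add: \<tau>_def)

lemma \<tau>_sq: "(\<tau> k)\<^sup>2 = \<beta> k / \<alpha> k" 
  using \<alpha>_pos[of k] \<beta>_pos[of k] by (simp add: \<tau>_def less_imp_le)

text \<open>The weights make $x \mapsto (\tau_k y'_k(x))_k$ map into $\ell_2$; the inner product is pulled
  back along this map. It is only semi-definite, but definite on flags with nonzero eigenvalues.\<close>

definition ip :: "'a \<Rightarrow> 'a \<Rightarrow> complex" where
  "ip x y = (\<Sum>k. of_real ((\<tau> k)\<^sup>2) * yd k x * cnj (yd k y))"

lemma ip_term_le: "norm (of_real ((\<tau> k)\<^sup>2) * yd k x * cnj (yd k y)) \<le> (\<tau> k)\<^sup>2 * (norm x * norm y)"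
proof -
  have "(\<tau> k)\<^sup>2 * (cmod (yd k x) * cmod (yd k y)) \<le> (\<tau> k)\<^sup>2 * (norm x * norm y)"
    using yd_le by (intro mult_left_mono mult_mono) auto
  then show ?thesis by (simp add: norm_mult mult.assoc norm_power)
qed

lemma \<tau>2_summable: "summable (\<lambda>k. (\<tau> k)\<^sup>2)"
  using \<tau>_summable by (simp add: \<tau>_sq)

lemma ip_summable: "summable (\<lambda>k. of_real ((\<tau> k)\<^sup>2) * yd k x * cnj (yd k y))"
  by (rule summable_comparison_test'[OF summable_mult2[OF \<tau>2_summable] ip_term_le])

lemma ip_sums: "(\<lambda>k. of_real ((\<tau> k)\<^sup>2) * yd k x * cnj (yd k y)) sums ip x y"
  using ip_summable by (simp add: ip_def summable_sums)

lemma ip_le: "cmod (ip x y) \<le> (\<Sum>k. (\<tau> k)\<^sup>2) * (norm x * norm y)"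
  unfolding ip_def
  using norm_suminf_le[OF ip_term_le summable_mult2[OF \<tau>2_summable]]
  by (simp add: suminf_mult2[OF \<tau>2_summable])

lemma ip_self_sums: "(\<lambda>k. (\<tau> k)\<^sup>2 * (cmod (yd k x))\<^sup>2) sums Re (ip x x)"
proof -
  have "Re (of_real ((\<tau> k)\<^sup>2) * yd k x * cnj (yd k x)) = (\<tau> k)\<^sup>2 * (cmod (yd k x))\<^sup>2" for k
    by (simp add: mult.assoc complex_mult_cnj cmod_power2 flip: of_real_power)
  then show ?thesis using sums_Re[OF ip_sums[of x x]] by simp
qed

sublocale hs: hermitian_space sc ip
proof
  show "ip (x + y) z = ip x z + ip y z" for x y z
    unfolding ip_def by (subst suminf_add[OF ip_summable ip_summable]) (simp add: yd_add algebra_simps)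
  show "ip (sc a x) z = a * ip x z" for a x z
    unfolding ip_def by (subst suminf_mult[OF ip_summable, symmetric]) (simp add: yd_sc algebra_simps)
  show "ip y x = cnj (ip x y)" for x y
  proof -
    have "(\<lambda>k. cnj (of_real ((\<tau> k)\<^sup>2) * yd k x * cnj (yd k y))) sums cnj (ip x y)"
      using ip_sums by (subst sums_cnj)
    then have "(\<lambda>k. of_real ((\<tau> k)\<^sup>2) * yd k y * cnj (yd k x)) sums cnj (ip x y)"
      by (simp add: mult_ac)
    then show ?thesis using ip_sums sums_unique2 by blast
  qed
  show "0 \<le> Re (ip x x)" for x
    by (rule sums_le[OF _ sums_zero ip_self_sums]) simp
qed

text \<open>All weights are positive, so a null vector is annihilated by every \<open>yd k\<close>.
  Hence the form is definite wherever \<open>T\<close> is injective.\<close>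

lemma ip_zero_T: "ip x x = 0 \<Longrightarrow> T x = 0"
proof -
  assume "ip x x = 0"
  then have "(\<lambda>k. (\<tau> k)\<^sup>2 * (cmod (yd k x))\<^sup>2) sums 0" using ip_self_sums[of x] by simp
  then have "\<forall>k. (\<tau> k)\<^sup>2 * (cmod (yd k x))\<^sup>2 = 0"
    using suminf_eq_zero_iff[of "\<lambda>k. (\<tau> k)\<^sup>2 * (cmod (yd k x))\<^sup>2"] by (simp add: sums_iff)
  then have "yd k x = 0" for k using \<tau>_pos[of k] by (metis less_irrefl mult_eq_0_iff power_eq_0_iff norm_eq_zero zero_less_power)
  then show "T x = 0" using T_eq by simp
qed

text \<open>Bessel's inequality for the \<open>l_2\<close> coordinates of the \<open>u i\<close>,
  tested on a vector \<open>c\<close> supported below \<open>n\<close>. With \<open>x\<close> the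
  combination of the \<open>u i\<close> with coefficients \<open>a i\<close> and \<open>w\<close>
  its coordinates, \<open>A\<close> is the pairing of \<open>c\<close> with \<open>w\<close>; AM-GM
  and the bound of the squared norm of \<open>w\<close> by \<open>A\<close> let half of
  \<open>A\<close> be absorbed.\<close>

lemma orthonormal_bessel_family:
  assumes u: "hs.orthonormal u d"
  shows "bessel_family n d (\<lambda>i k. of_real (\<tau> k) * yd k (u i))"
  unfolding bessel_family_def
proof
  fix c :: "nat \<Rightarrow> complex"
  define a where "a i = (\<Sum>j<n. cnj (of_real (\<tau> j) * yd j (u i)) * c j)" for i
  define A where "A = (\<Sum>i<d. (cmod (a i))\<^sup>2)"
  define x where "x = (\<Sum>i<d. sc (a i) (u i))"
  define w where "w j = of_real (\<tau> j) * yd j x" for j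
  have wj: "w j = (\<Sum>i<d. a i * (of_real (\<tau> j) * yd j (u i)))" for j
    by (simp add: w_def x_def yd_sum yd_sc sum_distrib_left mult_ac)
  have xx: "ip x x = of_real A"
  proof -
    have xu: "ip x (u i) = a i" if "i < d" for i
    proof -
      have "ip x (u i) = (\<Sum>k<d. if k = i then a i else 0)"
        unfolding x_def hs.ip_sum hs.ip_sc using u that
        by (intro sum.cong) (auto simp: hs.orthonormal_def)
      then show ?thesis using that by simp
    qed
    have "ip x x = (\<Sum>i<d. cnj (a i) * ip x (u i))"
      by (subst (2) x_def) (simp add: hs.ip_sum_right hs.ip_sc_right)
    also have "\<dots> = (\<Sum>i<d. of_real ((cmod (a i))\<^sup>2))"
      by (intro sum.cong refl) (metis xu lessThan_iff complex_norm_square mult.commute)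
    finally show ?thesis by (simp add: A_def)
  qed
  have "(\<Sum>j<n. (cmod (w j))\<^sup>2) \<le> Re (ip x x)"
    using sum_le_suminf[OF sums_summable[OF ip_self_sums[of x]], of "{..<n}"] sums_unique[OF ip_self_sums[of x]]
    by (simp add: w_def norm_mult power_mult_distrib)
  then have w_le: "(\<Sum>j<n. (cmod (w j))\<^sup>2) \<le> A" by (simp add: xx)
  have "of_real A = (\<Sum>i<d. cnj (a i) * a i)"
    by (simp add: A_def complex_norm_square mult.commute del: of_real_power)
  also have "\<dots> = (\<Sum>i<d. \<Sum>j<n. cnj (a i) * (cnj (of_real (\<tau> j) * yd j (u i)) * c j))"
    by (subst (2) a_def) (simp only: sum_distrib_left)
  also have "\<dots> = (\<Sum>j<n. c j * cnj (w j))"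
    by (subst sum.swap) (simp add: wj sum_distrib_left mult_ac)
  finally have Aeq: "complex_of_real A = (\<Sum>j<n. c j * cnj (w j))" .
  have "A \<le> cmod (complex_of_real A)" by simp
  also have "\<dots> \<le> (\<Sum>j<n. cmod (c j) * cmod (w j))"
    unfolding Aeq by (rule order.trans[OF norm_sum]) (simp add: norm_mult)
  also have "\<dots> \<le> (\<Sum>j<n. ((cmod (c j))\<^sup>2 + (cmod (w j))\<^sup>2) / 2)"
  proof (intro sum_mono)
    show "cmod (c j) * cmod (w j) \<le> ((cmod (c j))\<^sup>2 + (cmod (w j))\<^sup>2) / 2" for j
      using sum_squares_bound[of "cmod (c j)" "cmod (w j)"] by simp
  qed
  also have "\<dots> \<le> ((\<Sum>j<n. (cmod (c j))\<^sup>2) + A) / 2"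
    using w_le by (simp add: sum.distrib flip: sum_divide_distrib)
  finally have "A \<le> (\<Sum>j<n. (cmod (c j))\<^sup>2)" by simp
  then show "(\<Sum>i<d. (cmod (\<Sum>j<n. cnj (of_real (\<tau> j) * yd j (u i)) * c j))\<^sup>2) \<le> (\<Sum>j<n. (cmod (c j))\<^sup>2)"
    by (simp add: A_def a_def)
qed

text \<open>The left side has the form required by \<open>trace_boundD\<close>, with row weights
  \<open>\<tau>\<close> and column weights \<open>1 / \<tau>\<close>. The factors with index
  \<open>k\<close> cancel and leave the partial sum of the inner product with \<open>TN n x\<close>
  in place of \<open>T x\<close>.\<close>

lemma diagonal_limit:
  "(\<lambda>n. \<Sum>j<n. \<Sum>k<n. cnj (of_real (\<tau> j) * yd j x) * (of_real (\<tau> j) * yd j (yv k) * of_real (1 / \<tau> k)) *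
     (of_real (\<tau> k) * yd k x)) \<longlonglongrightarrow> ip (T x) x" (is "?S \<longlonglongrightarrow> _")
proof -
  have S: "?S n = (\<Sum>j<n. of_real ((\<tau> j)\<^sup>2) * yd j (TN n x) * cnj (yd j x))" for n
  proof -
    have "(\<Sum>k<n. cnj (of_real (\<tau> j) * yd j x) * (of_real (\<tau> j) * yd j (yv k) * of_real (1 / \<tau> k)) *
      (of_real (\<tau> k) * yd k x)) = (\<Sum>k<n. of_real ((\<tau> j)\<^sup>2) * (yd k x * yd j (yv k)) * cnj (yd j x))" for j
    proof (intro sum.cong refl)
      fix k
      have 1: "complex_of_real (1 / \<tau> k) * of_real (\<tau> k) = 1" using \<tau>_pos[of k] by simp
      have "cnj (of_real (\<tau> j) * yd j x) * (of_real (\<tau> j) * yd j (yv k) * of_real (1 / \<tau> k)) * (of_real (\<tau> k) * yd k x)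
        = of_real ((\<tau> j)\<^sup>2) * (yd k x * yd j (yv k)) * cnj (yd j x) * (of_real (1 / \<tau> k) * of_real (\<tau> k))"
        unfolding complex_cnj_mult complex_cnj_complex_of_real power2_eq_square of_real_mult by (simp only: mult_ac)
      then show "cnj (of_real (\<tau> j) * yd j x) * (of_real (\<tau> j) * yd j (yv k) * of_real (1 / \<tau> k)) * (of_real (\<tau> k) * yd k x)
        = of_real ((\<tau> j)\<^sup>2) * (yd k x * yd j (yv k)) * cnj (yd j x)" unfolding 1 by simp
    qed
    then show ?thesis
      by (simp add: TN_def yd_sum yd_sc sum_distrib_left sum_distrib_right)
  qed
  define B where "B = (\<Sum>k. (\<tau> k)\<^sup>2)"
  have diff: "cmod (?S n - (\<Sum>j<n. of_real ((\<tau> j)\<^sup>2) * yd j (T x) * cnj (yd j x))) \<le> B * (\<epsilon> n * norm x * norm x)" for n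
  proof -
    have "?S n - (\<Sum>j<n. of_real ((\<tau> j)\<^sup>2) * yd j (T x) * cnj (yd j x)) =
      (\<Sum>j<n. of_real ((\<tau> j)\<^sup>2) * yd j (TN n x - T x) * cnj (yd j x))"
      unfolding S by (simp add: yd_diff algebra_simps sum_subtractf)
    also have "cmod \<dots> \<le> (\<Sum>j<n. (\<tau> j)\<^sup>2 * (norm (TN n x - T x) * norm x))"
      by (intro sum_norm_le ip_term_le)
    also have "\<dots> \<le> (\<Sum>j<n. (\<tau> j)\<^sup>2 * (\<epsilon> n * norm x * norm x))"
      using T_diff_TN[of x n] by (intro sum_mono mult_left_mono mult_right_mono) (auto simp: norm_minus_commute)
    also have "\<dots> = (\<Sum>j<n. (\<tau> j)\<^sup>2) * (\<epsilon> n * norm x * norm x)" by (simp add: sum_distrib_right)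
    also have "\<dots> \<le> B * (\<epsilon> n * norm x * norm x)"
      unfolding B_def using \<epsilon>_nonneg by (intro mult_right_mono sum_le_suminf[OF \<tau>2_summable]) auto
    finally show ?thesis .
  qed
  have "(\<lambda>n. B * (\<epsilon> n * norm x * norm x)) \<longlonglongrightarrow> B * (0 * norm x * norm x)"
    by (intro tendsto_intros \<epsilon>_tendsto)
  then have "(\<lambda>n. ?S n - (\<Sum>j<n. of_real ((\<tau> j)\<^sup>2) * yd j (T x) * cnj (yd j x))) \<longlonglongrightarrow> 0"
    by (intro Lim_null_comparison[OF always_eventually[OF allI[OF diff]]]) simp
  from tendsto_add[OF this ip_sums[of "T x" x, unfolded sums_def]]
  show ?thesis by simp
qed

definition trace_const :: real where "trace_const = (\<Sum>k. \<alpha> k * \<beta> k)"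

text \<open>A Weyl-type inequality: by \<open>flag_diagonal\<close> the \<open>l i\<close> are the
  limits of the diagonal sums in \<open>diagonal_limit\<close>, and for each \<open>n\<close> these
  obey the trace bound, whose two square roots coincide thanks to \<open>\<tau>\<close>.\<close>

lemma flag_eigenvalue_sum_orthonormal:
  assumes u: "hs.orthonormal u d"
    and fl: "\<And>i. i < d \<Longrightarrow> T (u i) - sc (l i) (u i) \<in> vs.span (u ` {..<i})"
  shows "(\<Sum>i<d. cmod (l i)) \<le> trace_const"
proof -
  define S where "S n i = (\<Sum>j<n. \<Sum>k<n. cnj (of_real (\<tau> j) * yd j (u i)) *
    (of_real (\<tau> j) * yd j (yv k) * of_real (1 / \<tau> k)) * (of_real (\<tau> k) * yd k (u i)))" for n i
  have lim: "(\<lambda>n. S n i) \<longlonglongrightarrow> l i" if "i < d" for i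
    using diagonal_limit[of "u i"] hs.flag_diagonal[OF u that fl[OF that]] by (simp add: S_def)
  have "(\<lambda>n. \<Sum>i<d. cmod (S n i)) \<longlonglongrightarrow> (\<Sum>i<d. cmod (l i))"
    using lim by (intro tendsto_intros) auto
  moreover have "(\<Sum>i<d. cmod (S n i)) \<le> trace_const" for n
  proof -
    have "(\<Sum>i<d. cmod (S n i)) \<le> sqrt (\<Sum>j<n. (\<tau> j * \<alpha> j)\<^sup>2) * sqrt (\<Sum>k<n. (1 / \<tau> k * \<beta> k)\<^sup>2)"
      unfolding S_def by (rule trace_boundD[OF tb orthonormal_bessel_family[OF u]])
    also have "(\<Sum>j<n. (\<tau> j * \<alpha> j)\<^sup>2) = (\<Sum>j<n. \<alpha> j * \<beta> j)"
      using \<alpha>_pos \<beta>_pos by (intro sum.cong refl) (simp add: power_mult_distrib \<tau>_sq, simp add: power2_eq_square less_imp_neq[symmetric] field_simps)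
    also have "(\<Sum>k<n. (1 / \<tau> k * \<beta> k)\<^sup>2) = (\<Sum>j<n. \<alpha> j * \<beta> j)"
      using \<alpha>_pos \<beta>_pos by (intro sum.cong refl) (simp add: power_mult_distrib power_divide \<tau>_sq, simp add: power2_eq_square less_imp_neq[symmetric] field_simps)
    also have "sqrt (\<Sum>j<n. \<alpha> j * \<beta> j) * sqrt (\<Sum>j<n. \<alpha> j * \<beta> j) = (\<Sum>j<n. \<alpha> j * \<beta> j)"
      using \<alpha>_pos \<beta>_pos by (simp add: sum_nonneg less_imp_le)
    also have "\<dots> \<le> trace_const" unfolding trace_const_def
      using \<alpha>_pos \<beta>_pos by (intro sum_le_suminf[OF \<rho>_summable]) (auto simp: less_imp_le)
    finally show ?thesis .
  qed
  ultimately show ?thesis by (intro LIMSEQ_le_const2) auto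
qed

subsection \<open>Root spaces\<close>

text \<open>A triangular basis of an invariant subspace. Nonzero diagonal entries make
  \<open>T\<close> injective on the span, which is what makes \<open>ip\<close> definite
  there.\<close>

definition flag :: "nat \<Rightarrow> (nat \<Rightarrow> 'a) \<Rightarrow> (nat \<Rightarrow> complex) \<Rightarrow> bool" where
  "flag d e l \<longleftrightarrow> (\<forall>i<d. e i \<notin> vs.span (e ` {..<i}) \<and>
     T (e i) - sc (l i) (e i) \<in> vs.span (e ` {..<i}) \<and> l i \<noteq> 0)"

lemma flag_Suc: "flag (Suc d) e l \<longleftrightarrow> flag d e l \<and> e d \<notin> vs.span (e ` {..<d}) \<and>
     T (e d) - sc (l d) (e d) \<in> vs.span (e ` {..<d}) \<and> l d \<noteq> 0"
  by (auto simp: flag_def less_Suc_eq)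

lemma span_Suc: "vs.span (e ` {..<Suc d}) = {x. \<exists>c. x - sc c (e d) \<in> vs.span (e ` {..<d})}"
proof -
  have "e ` {..<Suc d} = insert (e d) (e ` {..<d})" by (auto simp: lessThan_Suc)
  then show ?thesis by (simp add: vs.span_insert)
qed

lemma flag_invariant:
  assumes "flag d e l" "x \<in> vs.span (e ` {..<d})"
  shows "T x \<in> vs.span (e ` {..<d})"
  using assms(2)
proof (induction rule: vs.span_induct_alt)
  case base
  then show ?case by (simp add: T_0 vs.span_zero)
next
  case (step c x y)
  then obtain k where k: "k < d" "x = e k" by auto
  have "vs.span (e ` {..<k}) \<subseteq> vs.span (e ` {..<d})" using k by (intro vs.span_mono) auto
  then have "T (e k) - sc (l k) (e k) \<in> vs.span (e ` {..<d})" using assms(1) k by (auto simp: flag_def)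
  moreover have "sc (l k) (e k) \<in> vs.span (e ` {..<d})" using k by (intro vs.span_scale vs.span_base) auto
  ultimately have "T (e k) - sc (l k) (e k) + sc (l k) (e k) \<in> vs.span (e ` {..<d})" by (rule vs.span_add)
  then show ?case using step k by (simp add: T_add T_sc vs.span_add vs.span_scale)
qed

text \<open>Modulo the lower span, \<open>T - \<mu>\<close> multiplies the coefficient of the top
  vector by \<open>l d - \<mu>\<close>, which is nonzero; so that coefficient vanishes and induction
  applies.\<close>

lemma flag_injective:
  assumes "flag d e l" "\<And>i. i < d \<Longrightarrow> l i \<noteq> \<mu>" "x \<in> vs.span (e ` {..<d})" "T x = sc \<mu> x"
  shows "x = 0"
  using assms
proof (induction d)
  case 0
  then show ?case by simp
next
  case (Suc d)
  let ?V = "vs.span (e ` {..<d})"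
  have fl: "flag d e l" using Suc.prems(1) by (simp add: flag_Suc)
  obtain c where c: "x - sc c (e d) \<in> ?V" using Suc.prems(3) by (auto simp: span_Suc)
  define y where "y = x - sc c (e d)"
  have y: "y \<in> ?V" using c by (simp add: y_def)
  have ed: "T (e d) - sc (l d) (e d) \<in> ?V" using Suc.prems(1) by (simp add: flag_Suc)
  have "0 = T x - sc \<mu> x" using Suc.prems(4) by simp
  also have "\<dots> = (T y - sc \<mu> y) + sc c (T (e d) - sc (l d) (e d)) + sc (c * (l d - \<mu>)) (e d)"
    by (simp add: y_def T_diff T_sc vs.scale_right_diff_distrib vs.scale_left_diff_distrib algebra_simps)
  finally have "sc (c * (l d - \<mu>)) (e d) = - ((T y - sc \<mu> y) + sc c (T (e d) - sc (l d) (e d)))"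
    by (metis add.commute eq_neg_iff_add_eq_0)
  moreover have "- ((T y - sc \<mu> y) + sc c (T (e d) - sc (l d) (e d))) \<in> ?V"
    by (intro vs.span_neg vs.span_add[OF vs.span_diff[OF flag_invariant[OF fl y] vs.span_scale[OF y]] vs.span_scale[OF ed]])
  ultimately have in_V: "sc (c * (l d - \<mu>)) (e d) \<in> ?V" by simp
  have "c = 0"
  proof (rule ccontr)
    assume "c \<noteq> 0"
    moreover have "l d \<noteq> \<mu>" using Suc.prems(2)[of d] by simp
    ultimately have "sc (1 / (c * (l d - \<mu>))) (sc (c * (l d - \<mu>)) (e d)) = e d" by simp
    then have "e d \<in> ?V" using vs.span_scale[OF in_V, of "1 / (c * (l d - \<mu>))"] by simp
    then show False using Suc.prems(1) by (simp add: flag_Suc)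
  qed
  then have "x \<in> ?V" using c by simp
  then show ?case using Suc.IH fl Suc.prems by simp
qed

text \<open>Back substitution: \<open>a = c / (l d - \<mu>)\<close> corrects the top coefficient,
  and the remainder is solved in the smaller span.\<close>

lemma flag_surjective:
  assumes "flag d e l" "\<And>i. i < d \<Longrightarrow> l i \<noteq> \<mu>" "y \<in> vs.span (e ` {..<d})"
  shows "\<exists>x\<in>vs.span (e ` {..<d}). T x - sc \<mu> x = y"
  using assms
proof (induction d arbitrary: y)
  case 0
  then show ?case by (auto simp: T_0)
next
  case (Suc d)
  let ?V = "vs.span (e ` {..<d})"
  have fl: "flag d e l" using Suc.prems(1) by (simp add: flag_Suc)
  obtain c where c: "y - sc c (e d) \<in> ?V" using Suc.prems(3) by (auto simp: span_Suc)
  define a where "a = c / (l d - \<mu>)"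
  have ed: "T (e d) - sc (l d) (e d) \<in> ?V" using Suc.prems(1) by (simp add: flag_Suc)
  have ne: "l d - \<mu> \<noteq> 0" using Suc.prems(2)[of d] by simp
  have "y - (T (sc a (e d)) - sc \<mu> (sc a (e d))) = (y - sc c (e d)) - sc a (T (e d) - sc (l d) (e d))"
  proof -
    have "sc c (e d) = sc (a * (l d - \<mu>)) (e d)" using ne by (simp add: a_def)
    then show ?thesis
      by (simp add: T_sc vs.scale_right_diff_distrib vs.scale_left_diff_distrib algebra_simps)
  qed
  also have "\<dots> \<in> ?V" by (rule vs.span_diff[OF c vs.span_scale[OF ed]])
  finally obtain x2 where x2: "x2 \<in> ?V" "T x2 - sc \<mu> x2 = y - (T (sc a (e d)) - sc \<mu> (sc a (e d)))"
    using Suc.IH[OF fl] Suc.prems(2) by (metis less_Suc_eq)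
  have "x2 + sc a (e d) \<in> vs.span (e ` {..<Suc d})"
    unfolding span_Suc using x2(1) by (auto intro!: exI[of _ a])
  moreover have "T (x2 + sc a (e d)) - sc \<mu> (x2 + sc a (e d)) = y"
    using x2(2) by (simp add: T_add vs.scale_right_distrib algebra_simps)
  ultimately show ?case by blast
qed

text \<open>Definiteness comes from \<open>flag_injective\<close> at \<open>\<mu> = 0\<close>: a
  null vector of \<open>ip\<close> lies in the kernel of \<open>T\<close>, and \<open>T\<close> is
  injective on the span.\<close>

lemma flag_orthonormal:
  assumes "flag d e l"
  shows "\<exists>u. hs.orthonormal u d \<and> vs.span (u ` {..<d}) = vs.span (e ` {..<d}) \<and>
    (\<forall>i<d. T (u i) - sc (l i) (u i) \<in> vs.span (u ` {..<i}))"
proof (rule hs.orthonormal_flag)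
  show "x = 0" if "x \<in> vs.span (e ` {..<d})" "ip x x = 0" for x
    using flag_injective[OF assms, of 0 x] that ip_zero_T[OF that(2)] assms
    by (auto simp: flag_def)
qed (use assms in \<open>auto simp: T_add T_sc flag_def\<close>)

lemma flag_eigenvalue_sum: "flag d e l \<Longrightarrow> (\<Sum>i<d. cmod (l i)) \<le> trace_const"
  using flag_orthonormal flag_eigenvalue_sum_orthonormal by blast

lemma flag_independent:
  assumes "flag d e l"
  shows "inj_on e {..<d} \<and> vs.independent (e ` {..<d})"
  using assms
proof (induction d)
  case 0
  then show ?case by (simp add: vs.independent_empty)
next
  case (Suc d)
  then have nsp: "e d \<notin> vs.span (e ` {..<d})" and IH: "inj_on e {..<d}" "vs.independent (e ` {..<d})"
    by (auto simp: flag_Suc)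
  have "e d \<notin> e ` {..<d}"
  proof
    assume "e d \<in> e ` {..<d}"
    then have "e d \<in> vs.span (e ` {..<d})" by (rule vs.span_base)
    with nsp show False by contradiction
  qed
  then show ?case using nsp IH by (simp add: lessThan_Suc vs.independent_insert)
qed

lemma flag_dim: "flag d e l \<Longrightarrow> vs.dim (vs.span (e ` {..<d})) = d"
  using flag_independent[of d e l] vs.dim_eq_card[of "e ` {..<d}" "vs.span (e ` {..<d})"]
  by (simp add: card_image vs.span_span)

definition shifted :: "complex \<Rightarrow> 'a \<Rightarrow> 'a" where "shifted \<mu> v = T v - sc \<mu> v"

lemma shifted_add: "shifted \<mu> (x + y) = shifted \<mu> x + shifted \<mu> y"
  by (simp add: shifted_def T_add vs.scale_right_distrib)
lemma shifted_sc: "shifted \<mu> (sc c x) = sc c (shifted \<mu> x)"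
  by (simp add: shifted_def T_sc vs.scale_right_diff_distrib mult.commute)
lemma shifted_pow_add: "(shifted \<mu> ^^ k) (x + y) = (shifted \<mu> ^^ k) x + (shifted \<mu> ^^ k) y"
  by (induction k) (simp_all add: shifted_add)
lemma shifted_pow_sc: "(shifted \<mu> ^^ k) (sc c x) = sc c ((shifted \<mu> ^^ k) x)"
  by (induction k) (simp_all add: shifted_sc)
lemma shifted_pow_0: "(shifted \<mu> ^^ k) 0 = 0"
  using shifted_pow_sc[of k \<mu> 0 0] by simp

lemma root_space_iff: "x \<in> root_space J T \<mu> \<longleftrightarrow> (\<exists>k. (shifted \<mu> ^^ k) x = 0)"
proof -
  have "shifted \<mu> = (\<lambda>v. T v - cscale J \<mu> v)" by (simp add: shifted_def fun_eq_iff)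
  then show ?thesis by (simp add: root_space_def)
qed

lemma root_space_subspace: "vs.subspace (root_space J T \<mu>)"
proof (rule vs.subspaceI)
  show "0 \<in> root_space J T \<mu>" using root_space_iff by (auto intro: exI[of _ 0])
  fix x y assume "x \<in> root_space J T \<mu>" "y \<in> root_space J T \<mu>"
  then obtain k j where "(shifted \<mu> ^^ k) x = 0" "(shifted \<mu> ^^ j) y = 0" by (auto simp: root_space_iff)
  then have "(shifted \<mu> ^^ (j + k)) x = 0" "(shifted \<mu> ^^ (k + j)) y = 0"
    using shifted_pow_0 unfolding funpow_add by simp_all
  then have "(shifted \<mu> ^^ (k + j)) x = 0" "(shifted \<mu> ^^ (k + j)) y = 0" by (simp_all only: add.commute)
  then show "x + y \<in> root_space J T \<mu>"
    using shifted_pow_add[of "k + j" \<mu> x y] by (auto simp: root_space_iff)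
next
  fix c x assume "x \<in> root_space J T \<mu>"
  then show "sc c x \<in> root_space J T \<mu>" by (auto simp: root_space_iff shifted_pow_sc)
qed

lemma root_space_shifted: "shifted \<mu> x \<in> root_space J T \<mu> \<longleftrightarrow> x \<in> root_space J T \<mu>"
proof
  assume "shifted \<mu> x \<in> root_space J T \<mu>"
  then obtain k where "(shifted \<mu> ^^ k) (shifted \<mu> x) = 0" by (auto simp: root_space_iff)
  then have "(shifted \<mu> ^^ Suc k) x = 0" by (simp add: funpow_swap1)
  then show "x \<in> root_space J T \<mu>" by (auto simp: root_space_iff simp del: funpow.simps)
next
  assume "x \<in> root_space J T \<mu>"
  then obtain k where "(shifted \<mu> ^^ k) x = 0" by (auto simp: root_space_iff)
  then have "(shifted \<mu> ^^ k) (shifted \<mu> x) = 0" using shifted_pow_0[of 1 \<mu>] by (simp add: funpow_swap1[symmetric])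
  then show "shifted \<mu> x \<in> root_space J T \<mu>" by (auto simp: root_space_iff)
qed

text \<open>The span is invariant and \<open>T - \<mu>\<close> is injective on it, hence so are all
  its powers.\<close>

lemma root_space_avoid:
  assumes fl: "flag d e l" and ne: "\<And>i. i < d \<Longrightarrow> l i \<noteq> \<mu>"
    and x: "x \<in> vs.span (e ` {..<d})" "x \<in> root_space J T \<mu>"
  shows "x = 0"
proof -
  have "(shifted \<mu> ^^ k) x = 0 \<Longrightarrow> x \<in> vs.span (e ` {..<d}) \<Longrightarrow> x = 0" for k x
  proof (induction k arbitrary: x)
    case (Suc k)
    have "shifted \<mu> x \<in> vs.span (e ` {..<d})"
      unfolding shifted_def using flag_invariant[OF fl Suc.prems(2)] Suc.prems(2) by (intro vs.span_diff vs.span_scale)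
    then have "shifted \<mu> x = 0" using Suc by (simp add: funpow_swap1)
    then show ?case using flag_injective[OF fl ne Suc.prems(2)] by (simp add: shifted_def)
  qed simp
  then show ?thesis using x by (auto simp: root_space_iff)
qed

text \<open>Finite dimension is extracted from the eigenvalue estimate: a flag of length
  \<open>d\<close> with constant diagonal \<open>\<mu>\<close> forces \<open>d * cmod \<mu>\<close>
  to be at most \<open>trace_const\<close>. A longest flag inside the root space must then span
  it.\<close>

lemma root_space_flag:
  assumes \<mu>: "\<mu> \<noteq> 0"
  shows "\<exists>d e. flag d e (\<lambda>_. \<mu>) \<and> vs.span (e ` {..<d}) = root_space J T \<mu>"
proof -
  define D where "D = {d. \<exists>e. flag d e (\<lambda>_. \<mu>) \<and> (\<forall>i<d. e i \<in> root_space J T \<mu>)}"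
  have bd: "real d \<le> trace_const / cmod \<mu>" if dD: "d \<in> D" for d
  proof -
    obtain e where "flag d e (\<lambda>_. \<mu>)" using dD unfolding D_def by blast
    from flag_eigenvalue_sum[OF this] have "real d * cmod \<mu> \<le> trace_const" by simp
    then show ?thesis using \<mu> by (simp add: field_simps)
  qed
  have fin: "finite D"
    by (rule finite_subset[of _ "{..nat \<lfloor>trace_const / cmod \<mu>\<rfloor>}"]) (use bd in \<open>auto simp: le_nat_floor\<close>)
  have "0 \<in> D" by (auto simp: D_def flag_def)
  define d where "d = Max D"
  have "d \<in> D" unfolding d_def using fin \<open>0 \<in> D\<close> by (intro Max_in) auto
  then obtain e where e: "flag d e (\<lambda>_. \<mu>)" "\<And>i. i < d \<Longrightarrow> e i \<in> root_space J T \<mu>" by (auto simp: D_def)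
  let ?V = "vs.span (e ` {..<d})"
  have "?V \<subseteq> root_space J T \<mu>" using e by (intro vs.span_minimal root_space_subspace) auto
  moreover have "x \<in> ?V" if x: "x \<in> root_space J T \<mu>" for x
  proof (rule ccontr)
    assume nx: "x \<notin> ?V"
    obtain k where "(shifted \<mu> ^^ k) x = 0" using x by (auto simp: root_space_iff)
    then have ex: "(shifted \<mu> ^^ k) x \<in> ?V" by (simp add: vs.span_zero)
    define k0 where "k0 = (LEAST k. (shifted \<mu> ^^ k) x \<in> ?V)"
    have k0: "(shifted \<mu> ^^ k0) x \<in> ?V" unfolding k0_def by (rule LeastI[of "\<lambda>k. (shifted \<mu> ^^ k) x \<in> ?V" k]) (rule ex)
    then have "k0 \<noteq> 0" using nx by (cases k0) auto
    then obtain j where j: "k0 = Suc j" by (cases k0) auto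
    \<comment> \<open>The last iterate of \<open>x\<close> outside the span: its image under
      \<open>shifted \<mu>\<close> lies in the span, so it is an admissible next flag
      vector.\<close>
    define y where "y = (shifted \<mu> ^^ j) x"
    have yV: "y \<notin> ?V" unfolding y_def using not_less_Least[of j "\<lambda>k. (shifted \<mu> ^^ k) x \<in> ?V"] j by (simp add: k0_def)
    have NyV: "shifted \<mu> y \<in> ?V" using k0 j by (simp add: y_def)
    have yr: "y \<in> root_space J T \<mu>" unfolding y_def
      by (induction j) (use x in \<open>auto simp: root_space_shifted\<close>)
    define e' where "e' = e(d := y)"
    have im: "e' ` {..<i} = e ` {..<i}" if "i \<le> d" for i using that by (auto simp: e'_def)
    have "flag d e' (\<lambda>_. \<mu>)" unfolding flag_def
    proof (intro allI impI)
      fix i assume "i < d"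
      then show "e' i \<notin> vs.span (e' ` {..<i}) \<and> T (e' i) - sc \<mu> (e' i) \<in> vs.span (e' ` {..<i}) \<and> \<mu> \<noteq> 0"
        using e(1) im[of i] by (simp add: flag_def e'_def)
    qed
    then have "flag (Suc d) e' (\<lambda>_. \<mu>)"
      using yV NyV \<mu> im[of d] by (simp add: flag_Suc e'_def shifted_def)
    moreover have "\<forall>i<Suc d. e' i \<in> root_space J T \<mu>" using e(2) yr by (auto simp: e'_def less_Suc_eq)
    ultimately have "Suc d \<in> D" by (auto simp: D_def)
    then show False using Max_ge[OF fin, of "Suc d"] by (simp add: d_def)
  qed
  ultimately show ?thesis using e(1) by blast
qed

definition root_sum :: "complex set \<Rightarrow> 'a set" where
  "root_sum \<Lambda> = vs.span (\<Union>\<mu>\<in>\<Lambda>. root_space J T \<mu>)"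

lemma root_sum_insert: "root_sum (insert \<mu> \<Lambda>) = {r + y |r y. r \<in> root_space J T \<mu> \<and> y \<in> root_sum \<Lambda>}"
proof -
  have "root_sum (insert \<mu> \<Lambda>) = vs.span (root_space J T \<mu> \<union> (\<Union>\<mu>\<in>\<Lambda>. root_space J T \<mu>))"
    by (simp add: root_sum_def)
  also have "\<dots> = {x + y |x y. x \<in> vs.span (root_space J T \<mu>) \<and> y \<in> root_sum \<Lambda>}"
    by (simp add: vs.span_Un root_sum_def)
  also have "vs.span (root_space J T \<mu>) = root_space J T \<mu>"
    using root_space_subspace vs.span_eq_iff by blast
  finally show ?thesis .
qed

lemma root_sum_flag:
  assumes "finite \<Lambda>" "0 \<notin> \<Lambda>"
  shows "\<exists>d e l. flag d e l \<and> vs.span (e ` {..<d}) = root_sum \<Lambda> \<and> (\<forall>i<d. l i \<in> \<Lambda>) \<and>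
    (\<forall>\<mu>\<in>\<Lambda>. card {i. i < d \<and> l i = \<mu>} = alg_mult J T \<mu>)"
  using assms
proof (induction \<Lambda> rule: finite_induct)
  case empty
  then show ?case by (intro exI[of _ 0]) (auto simp: flag_def root_sum_def)
next
  case (insert \<mu> \<Lambda>)
  then obtain d1 e1 l1 where 1: "flag d1 e1 l1" "vs.span (e1 ` {..<d1}) = root_sum \<Lambda>" "\<forall>i<d1. l1 i \<in> \<Lambda>"
    "\<forall>\<mu>\<in>\<Lambda>. card {i. i < d1 \<and> l1 i = \<mu>} = alg_mult J T \<mu>" by auto
  obtain d2 e2 where 2: "flag d2 e2 (\<lambda>_. \<mu>)" "vs.span (e2 ` {..<d2}) = root_space J T \<mu>"
    using root_space_flag[of \<mu>] insert by auto
  have dim2: "alg_mult J T \<mu> = d2" using flag_dim[OF 2(1)] 2(2) by (simp add: alg_mult_def)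
  define e where "e i = (if i < d1 then e1 i else e2 (i - d1))" for i
  define l where "l i = (if i < d1 then l1 i else \<mu>)" for i
  have im1: "e ` {..<i} = e1 ` {..<i}" if "i \<le> d1" for i using that by (auto simp: e_def)
  have im2: "e ` {..<d1 + j} = e1 ` {..<d1} \<union> e2 ` {..<j}" for j
  proof -
    have "{..<d1 + j} = {..<d1} \<union> (\<lambda>i. d1 + i) ` {..<j}"
    proof (rule Set.set_eqI)
      fix x
      show "x \<in> {..<d1 + j} \<longleftrightarrow> x \<in> {..<d1} \<union> (\<lambda>i. d1 + i) ` {..<j}"
        by (cases "x < d1") (auto simp: image_iff intro!: bexI[of _ "x - d1"])
    qed
    then have "e ` {..<d1 + j} = e ` {..<d1} \<union> (\<lambda>i. e (d1 + i)) ` {..<j}" by (simp add: image_Un image_image)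
    then show ?thesis using im1[of d1] by (simp add: e_def)
  qed
  have fl: "flag (d1 + d2) e l"
    unfolding flag_def
  proof (intro allI impI)
    fix i assume i: "i < d1 + d2"
    show "e i \<notin> vs.span (e ` {..<i}) \<and> T (e i) - sc (l i) (e i) \<in> vs.span (e ` {..<i}) \<and> l i \<noteq> 0"
    proof (cases "i < d1")
      case True
      then show ?thesis using 1(1) im1[of i] by (simp add: flag_def e_def l_def)
    next
      case False
      then have j: "i = d1 + (i - d1)" "i - d1 < d2" using i by auto
      then obtain j where j: "i = d1 + j" "j < d2" by blast
      have f2: "e2 j \<notin> vs.span (e2 ` {..<j})" "T (e2 j) - sc \<mu> (e2 j) \<in> vs.span (e2 ` {..<j})"
        using 2(1) j by (auto simp: flag_def)
      have sub: "vs.span (e2 ` {..<k}) \<subseteq> root_space J T \<mu>" if "k \<le> d2" for k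
        unfolding 2(2)[symmetric] using that by (intro vs.span_mono) auto
      have "e2 j \<notin> vs.span (e1 ` {..<d1} \<union> e2 ` {..<j})"
      proof
        assume "e2 j \<in> vs.span (e1 ` {..<d1} \<union> e2 ` {..<j})"
        then obtain x1 x2 where x: "e2 j = x1 + x2" "x1 \<in> vs.span (e1 ` {..<d1})" "x2 \<in> vs.span (e2 ` {..<j})"
          by (auto simp: vs.span_Un)
        have "e2 j \<in> root_space J T \<mu>" unfolding 2(2)[symmetric] using j by (intro vs.span_base) auto
        moreover have "x2 \<in> root_space J T \<mu>" using sub[of j] j x(3) by auto
        ultimately have "e2 j - x2 \<in> root_space J T \<mu>" by (rule vs.subspace_diff[OF root_space_subspace])
        then have "x1 \<in> root_space J T \<mu>" using x(1) by simp
        moreover have ne: "l1 i \<noteq> \<mu>" if "i < d1" for i using 1(3) insert.hyps(2) that by auto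
        ultimately have "x1 = 0" using root_space_avoid[OF 1(1) ne x(2)] by blast
        then show False using x f2(1) by simp
      qed
      moreover have "vs.span (e2 ` {..<j}) \<subseteq> vs.span (e1 ` {..<d1} \<union> e2 ` {..<j})" by (intro vs.span_mono) auto
      ultimately show ?thesis unfolding j(1) im2 using f2(2) insert.prems
        by (auto simp: e_def l_def)
    qed
  qed
  moreover have "vs.span (e ` {..<d1 + d2}) = root_sum (insert \<mu> \<Lambda>)"
    unfolding im2 vs.span_Un 1(2) 2(2) root_sum_insert using add.commute by blast
  moreover have "\<forall>i<d1 + d2. l i \<in> insert \<mu> \<Lambda>" using 1(3) by (auto simp: l_def)
  moreover have "card {i. i < d1 + d2 \<and> l i = \<nu>} = alg_mult J T \<nu>" if "\<nu> \<in> insert \<mu> \<Lambda>" for \<nu>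
  proof (cases "\<nu> = \<mu>")
    case True
    then have "{i. i < d1 + d2 \<and> l i = \<nu>} = {d1..<d1 + d2}"
      using 1(3) insert.hyps(2) by (auto simp: l_def not_less[symmetric])
    then show ?thesis using True dim2 by simp
  next
    case False
    then have "{i. i < d1 + d2 \<and> l i = \<nu>} = {i. i < d1 \<and> l1 i = \<nu>}" by (auto simp: l_def)
    then show ?thesis using 1(4) that False by simp
  qed
  ultimately show ?case by (intro exI[of _ "d1 + d2"] exI[of _ e] exI[of _ l]) simp
qed

lemma sum_over_flag:
  fixes g :: "complex \<Rightarrow> 'b::comm_semiring_1" and l :: "nat \<Rightarrow> complex"
  assumes "finite \<Lambda>" "\<forall>i<d. l i \<in> \<Lambda>" "\<forall>\<mu>\<in>\<Lambda>. card {i. i < d \<and> l i = \<mu>} = m \<mu>"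
  shows "(\<Sum>i<d. g (l i)) = (\<Sum>\<mu>\<in>\<Lambda>. of_nat (m \<mu>) * g \<mu>)"
proof -
  have "(\<Sum>i<d. g (l i)) = (\<Sum>\<mu>\<in>\<Lambda>. \<Sum>i\<in>{i \<in> {..<d}. l i = \<mu>}. g (l i))"
    by (rule sum.group[of "{..<d}" \<Lambda> l "\<lambda>i. g (l i)", symmetric]) (use assms(1,2) in auto)
  also have "\<dots> = (\<Sum>\<mu>\<in>\<Lambda>. of_nat (m \<mu>) * g \<mu>)"
    using assms(3) by (intro sum.cong refl) (simp add: Collect_conj_eq lessThan_def)
  finally show ?thesis .
qed

lemma eigenvalue_sum_le:
  assumes "finite \<Lambda>" "0 \<notin> \<Lambda>"
  shows "(\<Sum>\<mu>\<in>\<Lambda>. real (alg_mult J T \<mu>) * cmod \<mu>) \<le> trace_const"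
proof -
  obtain d e l where f: "flag d e l" "\<forall>i<d. l i \<in> \<Lambda>"
    "\<forall>\<mu>\<in>\<Lambda>. card {i. i < d \<and> l i = \<mu>} = alg_mult J T \<mu>"
    using root_sum_flag[OF assms] by blast
  show ?thesis using flag_eigenvalue_sum[OF f(1)] sum_over_flag[OF assms(1) f(2,3), of cmod] by simp
qed

lemma eigenvalue_iff: "\<mu> \<in> eigenvalues J T \<longleftrightarrow> (\<exists>x. x \<noteq> 0 \<and> shifted \<mu> x = 0)"
  by (auto simp: eigenvalues_def shifted_def)

lemma alg_mult_pos:
  assumes "\<mu> \<in> eigenvalues J T" "\<mu> \<noteq> 0"
  shows "1 \<le> alg_mult J T \<mu>"
proof -
  obtain d e where f: "flag d e (\<lambda>_. \<mu>)" "vs.span (e ` {..<d}) = root_space J T \<mu>"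
    using root_space_flag[OF assms(2)] by blast
  obtain x where x: "x \<noteq> 0" "shifted \<mu> x = 0" using assms(1) by (auto simp: eigenvalue_iff)
  then have "x \<in> root_space J T \<mu>" by (auto simp: root_space_iff intro: exI[of _ 1])
  then have "d \<noteq> 0" using f(2) x(1) by (cases d) auto
  then show ?thesis using flag_dim[OF f(1)] f(2) by (simp add: alg_mult_def)
qed

text \<open>Each of these eigenvalues adds at least \<open>\<delta>\<close> to a sum bounded by
  \<open>trace_const\<close>.\<close>

lemma finite_large_eigenvalues:
  assumes "0 < \<delta>"
  shows "finite {\<mu> \<in> eigenvalues J T. \<delta> \<le> cmod \<mu>}"
proof (rule finite_if_finite_subsets_card_bdd[THEN conjunct1])
  fix F assume F: "F \<subseteq> {\<mu> \<in> eigenvalues J T. \<delta> \<le> cmod \<mu>}" "finite F"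
  have "real (card F) * \<delta> = (\<Sum>\<mu>\<in>F. 1 * \<delta>)" by simp
  also have "\<dots> \<le> (\<Sum>\<mu>\<in>F. real (alg_mult J T \<mu>) * cmod \<mu>)"
    using F assms alg_mult_pos by (intro sum_mono mult_mono) force+
  also have "\<dots> \<le> trace_const" using F assms by (intro eigenvalue_sum_le) auto
  finally have "real (card F) \<le> trace_const / \<delta>" using assms by (simp add: field_simps)
  then show "card F \<le> nat \<lfloor>trace_const / \<delta>\<rfloor>" by (simp add: le_nat_floor)
qed

text \<open>Says that the operator induced on the quotient by \<open>root_sum \<Lambda>\<close> does
  not have the eigenvalue \<open>\<mu>\<close>. The part of \<open>shifted \<mu> x\<close> outside
  the \<open>\<mu>\<close> root space is \<open>shifted \<mu> x'\<close> for some \<open>x'\<close>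
  in the other root spaces, by \<open>flag_surjective\<close>; then \<open>x - x'\<close> lies in
  the root space of \<open>\<mu>\<close>, which is trivial if \<open>\<mu>\<close> is no
  eigenvalue.\<close>

lemma root_sum_absorbs:
  assumes fin: "finite \<Lambda>" "0 \<notin> \<Lambda>" and \<mu>: "\<mu> \<in> \<Lambda> \<or> \<mu> \<notin> eigenvalues J T"
    and x: "shifted \<mu> x \<in> root_sum \<Lambda>"
  shows "x \<in> root_sum \<Lambda>"
proof -
  obtain d e l where f: "flag d e l" "vs.span (e ` {..<d}) = root_sum (\<Lambda> - {\<mu>})" "\<forall>i<d. l i \<in> \<Lambda> - {\<mu>}"
    using root_sum_flag[of "\<Lambda> - {\<mu>}"] fin by auto
  have "\<exists>r y. shifted \<mu> x = r + y \<and> r \<in> root_space J T \<mu> \<and> y \<in> root_sum (\<Lambda> - {\<mu>})"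
  proof (cases "\<mu> \<in> \<Lambda>")
    case True
    then have "root_sum \<Lambda> = root_sum (insert \<mu> (\<Lambda> - {\<mu>}))" by (simp add: insert_absorb)
    then have "shifted \<mu> x \<in> root_sum (insert \<mu> (\<Lambda> - {\<mu>}))" using x by simp
    then show ?thesis unfolding root_sum_insert by blast
  next
    case False
    then show ?thesis using x vs.subspace_0[OF root_space_subspace] by (intro exI[of _ 0] exI[of _ "shifted \<mu> x"]) auto
  qed
  then obtain r y where ry: "shifted \<mu> x = r + y" "r \<in> root_space J T \<mu>" "y \<in> root_sum (\<Lambda> - {\<mu>})" by blast
  obtain x' where x': "x' \<in> root_sum (\<Lambda> - {\<mu>})" "shifted \<mu> x' = y"
    using flag_surjective[OF f(1), of \<mu> y] f(2,3) ry(3) by (auto simp: shifted_def)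
  have "shifted \<mu> (x - x') = r"
    using ry(1) x'(2) shifted_add[of \<mu> "x - x'" x'] by simp
  then have r: "x - x' \<in> root_space J T \<mu>" using ry(2) root_space_shifted[of \<mu> "x - x'"] by simp
  have sub: "root_sum (\<Lambda> - {\<mu>}) \<subseteq> root_sum \<Lambda>" unfolding root_sum_def by (intro vs.span_mono) auto
  have "x - x' \<in> root_sum \<Lambda>"
  proof (cases "\<mu> \<in> \<Lambda>")
    case True
    then show ?thesis unfolding root_sum_def using r by (intro vs.span_base) auto
  next
    case False
    then have inj: "shifted \<mu> z = 0 \<Longrightarrow> z = 0" for z using \<mu> by (auto simp: eigenvalue_iff)
    have "(shifted \<mu> ^^ k) z = 0 \<Longrightarrow> z = 0" for k z by (induction k) (auto dest: inj)
    then have "x - x' = 0" using r unfolding root_space_iff by blast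
    then show ?thesis by (simp add: root_sum_def vs.span_zero)
  qed
  then have "(x - x') + x' \<in> root_sum \<Lambda>" using x'(1) sub unfolding root_sum_def by (intro vs.span_add) auto
  then show ?thesis by simp
qed

subsection \<open>Compactness and finite-rank approximation\<close>

text \<open>A diagonal subsequence makes all scalar sequences \<open>yd k (x n)\<close> converge, so
  every \<open>TN N0\<close> converges along it; the uniform error \<open>\<epsilon> N0\<close>
  transfers the Cauchy property to \<open>T\<close>.\<close>

lemma T_compact:
  fixes x :: "nat \<Rightarrow> 'a"
  assumes x: "\<And>n. norm (x n) \<le> 1"
  shows "\<exists>r w. strict_mono (r::nat \<Rightarrow> nat) \<and> (\<lambda>n. T (x (r n))) \<longlonglongrightarrow> w"
proof -
  interpret subseqs "\<lambda>k s. convergent (\<lambda>n. yd k (x (s n)))"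
  proof
    fix k and s :: "nat \<Rightarrow> nat"
    have "bounded (range (\<lambda>n. yd k (x (s n))))"
      using order.trans[OF yd_le x] by (auto simp: bounded_iff)
    then obtain l r where "strict_mono r" "((\<lambda>n. yd k (x (s n))) \<circ> r) \<longlonglongrightarrow> l"
      using bounded_imp_convergent_subsequence by blast
    then show "\<exists>r'. strict_mono r' \<and> convergent (\<lambda>n. yd k (x ((s \<circ> r') n)))"
      by (auto simp: convergent_def o_def)
  qed
  define r where "r = diagseq"
  have r: "strict_mono r" unfolding r_def by (rule subseq_diagseq)
  have conv: "convergent (\<lambda>n. yd k (x (r n)))" for k
  proof -
    \<comment> \<open>The diagonal sequence is a subsequence of the stage that handles
      \<open>k\<close> only after an initial segment, hence the shift by
      \<open>Suc k\<close>.\<close>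
    have "convergent (\<lambda>n. yd k (x ((diagseq \<circ> (+) (Suc k)) n)))"
    proof (rule diagseq_holds)
      fix q s :: "nat \<Rightarrow> nat" and n
      assume "strict_mono q" "convergent (\<lambda>i. yd n (x (s i)))"
      then show "convergent (\<lambda>i. yd n (x ((s \<circ> q) i)))"
        using convergent_subseq_convergent[of "\<lambda>i. yd n (x (s i))" q] by (simp add: o_def)
    qed
    then have "convergent (\<lambda>n. yd k (x (r (n + Suc k))))" by (simp add: r_def o_def add.commute)
    then show ?thesis using convergent_ignore_initial_segment[of "\<lambda>n. yd k (x (r n))" "Suc k"] by simp
  qed
  have "Cauchy (\<lambda>n. T (x (r n)))"
  proof (rule metric_CauchyI)
    fix e :: real assume e: "0 < e"
    obtain N0 where N0: "\<epsilon> N0 < e / 3"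
      using order_tendstoD(2)[OF \<epsilon>_tendsto, of "e / 3"] e by (auto simp: eventually_sequentially)
    have "convergent (\<lambda>n. TN N0 (x (r n)))"
    proof -
      obtain l where l: "\<And>k. (\<lambda>n. yd k (x (r n))) \<longlonglongrightarrow> l k" using conv unfolding convergent_def by metis
      have "(\<lambda>n. TN N0 (x (r n))) \<longlonglongrightarrow> (\<Sum>k<N0. sc (l k) (yv k))"
        unfolding TN_def by (intro tendsto_sum sc.tendsto l tendsto_const)
      then show ?thesis by (auto simp: convergent_def)
    qed
    then have "Cauchy (\<lambda>n. TN N0 (x (r n)))" by (rule convergent_Cauchy)
    then obtain M where M: "\<And>m n. m \<ge> M \<Longrightarrow> n \<ge> M \<Longrightarrow> dist (TN N0 (x (r m))) (TN N0 (x (r n))) < e / 3"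
      using metric_CauchyD[of "\<lambda>n. TN N0 (x (r n))" "e / 3"] e by auto
    have near: "dist (T (x (r n))) (TN N0 (x (r n))) < e / 3" for n
    proof -
      have "norm (T (x (r n)) - TN N0 (x (r n))) \<le> \<epsilon> N0 * 1"
        using T_diff_TN[of "x (r n)" N0] mult_left_mono[OF x[of "r n"] \<epsilon>_nonneg[of N0]] by linarith
      then show ?thesis using N0 by (simp add: dist_norm)
    qed
    show "\<exists>M. \<forall>m\<ge>M. \<forall>n\<ge>M. dist (T (x (r m))) (T (x (r n))) < e"
    proof (intro exI allI impI)
      fix m n assume mn: "M \<le> m" "M \<le> n"
      show "dist (T (x (r m))) (T (x (r n))) < e"
        using near[of m] near[of n] M[OF mn]
          dist_triangle[of "T (x (r m))" "T (x (r n))" "TN N0 (x (r m))"]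
          dist_triangle[of "TN N0 (x (r m))" "T (x (r n))" "TN N0 (x (r n))"]
        by (simp add: dist_commute)
    qed
  qed
  then show ?thesis using r Cauchy_convergent convergent_def by metis
qed

text \<open>A quantitative Fredholm alternative, uniform in \<open>z\<close>. Along unit vectors
  violating it, \<open>T x\<close> and \<open>z\<close> converge after passing to subsequences;
  hence \<open>x\<close> itself converges, to a unit vector fixed by \<open>z0\<close> times
  \<open>Q T\<close>, contrary to \<open>inj\<close>.\<close>

lemma uniform_lower_bound:
  assumes Q: "bounded_linear Q" and Z: "compact Z"
    and inj: "\<And>z x. z \<in> Z \<Longrightarrow> x = sc z (Q (T x)) \<Longrightarrow> x = 0"
  shows "\<exists>c>0. \<forall>z\<in>Z. \<forall>x. c * norm x \<le> norm (x - sc z (Q (T x)))"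
proof (rule ccontr)
  interpret Q: bounded_linear Q by fact
  interpret Tl: bounded_linear T by (rule T_bl)
  assume neg: "\<not> ?thesis"
  have ex: "\<exists>z x. z \<in> Z \<and> norm x = 1 \<and> norm (x - sc z (Q (T x))) < 1 / Suc n" for n :: nat
  proof -
    have "0 < 1 / real (Suc n)" by simp
    then have "\<not> (\<forall>z\<in>Z. \<forall>x. 1 / real (Suc n) * norm x \<le> norm (x - sc z (Q (T x))))"
      using neg by blast
    then obtain z x where zx: "z \<in> Z" "norm (x - sc z (Q (T x))) < (1 / Suc n) * norm x"
      by (auto simp: not_le)
    have x0: "x \<noteq> 0" using zx(2) by (auto simp: Tl.zero Q.zero)
    define y where "y = (1 / norm x) *\<^sub>R x"
    have "y - sc z (Q (T y)) = (1 / norm x) *\<^sub>R (x - sc z (Q (T x)))"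
      by (simp add: y_def Tl.scaleR Q.scaleR sc.scaleR_right scaleR_diff_right)
    then have "norm (y - sc z (Q (T y))) = norm (x - sc z (Q (T x))) / norm x" by simp
    also have "\<dots> < 1 / Suc n" using zx(2) x0 by (simp add: field_simps)
    finally show ?thesis using zx(1) x0 by (intro exI[of _ z] exI[of _ y]) (simp add: y_def)
  qed
  then obtain z x where zx: "\<And>n. z n \<in> Z" "\<And>n. norm (x n) = 1" "\<And>n::nat. norm (x n - sc (z n) (Q (T (x n)))) < 1 / Suc n"
    by metis
  obtain z0 r1 where r1: "z0 \<in> Z" "strict_mono (r1::nat\<Rightarrow>nat)" "(z \<circ> r1) \<longlonglongrightarrow> z0"
    using Z zx(1) unfolding compact_def by metis
  obtain r2 w where r2: "strict_mono (r2::nat\<Rightarrow>nat)" "(\<lambda>n. T (x (r1 (r2 n)))) \<longlonglongrightarrow> w"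
    using T_compact[of "\<lambda>n. x (r1 n)"] zx(2) by auto
  define s where "s n = r1 (r2 n)" for n
  have sm: "strict_mono s" using r1(2) r2(1) by (auto simp: s_def strict_mono_def)
  have zs: "(\<lambda>n. z (s n)) \<longlonglongrightarrow> z0"
    using LIMSEQ_subseq_LIMSEQ[OF r1(3) r2(1)] by (simp add: s_def o_def)
  have Ts: "(\<lambda>n. T (x (s n))) \<longlonglongrightarrow> w" using r2(2) by (simp add: s_def)
  have lim0: "(\<lambda>n. 1 / real (Suc n)) \<longlonglongrightarrow> 0" by (rule LIMSEQ_Suc[OF lim_1_over_n])
  have "(\<lambda>n. x n - sc (z n) (Q (T (x n)))) \<longlonglongrightarrow> 0"
    by (rule Lim_null_comparison[OF _ lim0]) (intro always_eventually allI less_imp_le zx(3))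
  then have d0: "(\<lambda>n. x (s n) - sc (z (s n)) (Q (T (x (s n))))) \<longlonglongrightarrow> 0"
    using LIMSEQ_subseq_LIMSEQ[OF _ sm] by (fastforce simp: o_def)
  have "(\<lambda>n. sc (z (s n)) (Q (T (x (s n))))) \<longlonglongrightarrow> sc z0 (Q w)"
    by (intro sc.tendsto zs Q.tendsto Ts)
  from tendsto_add[OF d0 this] have xs: "(\<lambda>n. x (s n)) \<longlonglongrightarrow> sc z0 (Q w)" by simp
  have "(\<lambda>n. T (x (s n))) \<longlonglongrightarrow> T (sc z0 (Q w))" by (rule Tl.tendsto[OF xs])
  then have "w = T (sc z0 (Q w))" using Ts LIMSEQ_unique by blast
  then have zero: "sc z0 (Q w) = 0" using inj[OF r1(1), of "sc z0 (Q w)"] by simp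
  have "norm (sc z0 (Q w)) = 1"
    using tendsto_norm[OF xs] zx(2) by (simp add: LIMSEQ_const_iff)
  then show False unfolding zero by simp
qed

text \<open>Stability under the norm convergence of \<open>TN n\<close> to \<open>T\<close>. Half of
  the constant pays for the perturbation, which is where the threshold
  \<open>c / (2 * R * C)\<close> comes from.\<close>

lemma uniform_lower_bound_TN:
  assumes Q: "bounded_linear Q" and Z: "compact Z"
    and inj: "\<And>z x. z \<in> Z \<Longrightarrow> x = sc z (Q (T x)) \<Longrightarrow> x = 0"
  shows "\<exists>c>0. \<exists>n0. \<forall>n\<ge>n0. \<forall>z\<in>Z. \<forall>x. c * norm x \<le> norm (x - sc z (Q (TN n x)))"
proof -
  interpret Q: bounded_linear Q by fact
  have "\<exists>c>0. \<forall>z\<in>Z. \<forall>x. c * norm x \<le> norm (x - sc z (Q (T x)))"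
    by (rule uniform_lower_bound[OF Q Z]) (rule inj)
  then obtain c where c: "c > 0" "\<And>z x. z \<in> Z \<Longrightarrow> c * norm x \<le> norm (x - sc z (Q (T x)))"
    by blast
  obtain C where C: "0 < C" "\<And>x. norm (Q x) \<le> norm x * C" using Q.pos_bounded by blast
  obtain R where R: "0 < R" "\<And>z. z \<in> Z \<Longrightarrow> cmod z \<le> R"
    using compact_imp_bounded[OF Z] by (auto simp: bounded_pos)
  have "0 < c / (2 * R * C)" using c C R by simp
  then obtain n0 where n0: "\<And>n. n \<ge> n0 \<Longrightarrow> \<epsilon> n < c / (2 * R * C)"
    using order_tendstoD(2)[OF \<epsilon>_tendsto] by (auto simp: eventually_sequentially)
  have "c / 2 * norm x \<le> norm (x - sc z (Q (TN n x)))" if "n \<ge> n0" "z \<in> Z" for n z x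
  proof -
    have eq: "x - sc z (Q (T x)) = (x - sc z (Q (TN n x))) - sc z (Q (T x - TN n x))"
      by (simp add: Q.diff sc.diff_right)
    have "norm (sc z (Q (T x - TN n x))) \<le> R * (\<epsilon> n * norm x * C)"
    proof -
      have "norm (Q (T x - TN n x)) \<le> norm (T x - TN n x) * C" by (rule C(2))
      also have "\<dots> \<le> \<epsilon> n * norm x * C" using T_diff_TN C(1) by (intro mult_right_mono) auto
      finally show ?thesis unfolding norm_sc using R that(2) by (intro mult_mono) auto
    qed
    also have "\<dots> = \<epsilon> n * (R * C) * norm x" by simp
    also have "\<dots> \<le> c / 2 * norm x"
      using n0[OF that(1)] R(1) C(1) by (intro mult_right_mono) (auto simp: field_simps)
    finally have "norm (sc z (Q (T x - TN n x))) \<le> c / 2 * norm x" .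
    moreover have "c * norm x \<le> norm (x - sc z (Q (TN n x))) + norm (sc z (Q (T x - TN n x)))"
      using c(2)[OF that(2), of x] norm_triangle_ineq4 unfolding eq by (rule order.trans)
    ultimately show ?thesis by simp
  qed
  then show ?thesis using c(1) by (intro exI[of _ "c / 2"]) auto
qed

subsection \<open>The trace formula\<close>

definition truncated_det :: "nat \<Rightarrow> complex \<Rightarrow> complex" where
  "truncated_det n z = det (mat n n (\<lambda>(j,k). (if j = k then 1 else 0) - z * yd j (yv k)))"

text \<open>The map \<open>x \<mapsto> Q (TN n x)\<close> factors through \<open>C^n\<close>, where
  its matrix is \<open>yd j (Q (yv k))\<close>; so this is its Fredholm determinant.\<close>

definition quotient_det :: "('a \<Rightarrow> 'a) \<Rightarrow> nat \<Rightarrow> complex \<Rightarrow> complex" where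
  "quotient_det Q n z = det (mat n n (\<lambda>(j,k). (if j = k then 1 else 0) - z * yd j (Q (yv k))))"

text \<open>A kernel vector \<open>v\<close> of the matrix lifts to the fixed vector
  \<open>x\<close> below, whose coordinates \<open>yd j x\<close> are again the entries of
  \<open>v\<close>.\<close>

lemma quotient_det_nonzero:
  assumes Q: "\<And>x y. Q (x + y) = Q x + Q y" "\<And>a x. Q (sc a x) = sc a (Q x)"
    and inj: "\<And>x. x = sc z (Q (TN n x)) \<Longrightarrow> x = 0"
  shows "quotient_det Q n z \<noteq> 0"
proof
  assume 0: "quotient_det Q n z = 0"
  let ?A = "mat n n (\<lambda>(j,k). (if j = k then 1 else 0) - z * yd j (Q (yv k)))"
  have A: "?A \<in> carrier_mat n n" by simp
  have Q0: "Q 0 = 0" using Q(2)[of 0 0] by simp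
  have Qs: "Q (\<Sum>i\<in>I. f i) = (\<Sum>i\<in>I. Q (f i))" for f and I :: "nat set"
    by (induction I rule: infinite_finite_induct) (auto simp: Q0 Q(1))
  obtain v where v: "v \<in> carrier_vec n" "v \<noteq> 0\<^sub>v n" "?A *\<^sub>v v = 0\<^sub>v n"
    using det_0_iff_vec_prod_zero_field[OF A] 0 by (auto simp: quotient_det_def)
  define x where "x = sc z (Q (\<Sum>k<n. sc (v $ k) (yv k)))"
  have ydx: "yd j x = v $ j" if j: "j < n" for j
  proof -
    have "0 = (?A *\<^sub>v v) $ j" using v(3) j by simp
    also have "\<dots> = (\<Sum>k<n. ((if j = k then 1 else 0) - z * yd j (Q (yv k))) * v $ k)"
      using j v(1) by (simp add: scalar_prod_def atLeast0LessThan)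
    also have "\<dots> = (\<Sum>k<n. (if j = k then v $ k else 0) - z * (v $ k * yd j (Q (yv k))))"
      by (intro sum.cong) (auto simp: algebra_simps)
    also have "\<dots> = v $ j - yd j x"
      using j by (simp add: sum_subtractf x_def Qs Q(2) yd_sc yd_sum sum_distrib_left)
    finally show ?thesis by simp
  qed
  have "TN n x = (\<Sum>k<n. sc (v $ k) (yv k))"
    unfolding TN_def by (intro sum.cong refl) (simp add: ydx)
  then have "x = 0" by (intro inj) (simp add: x_def)
  then have "v = 0\<^sub>v n" using ydx v(1) by (intro eq_vecI) (auto simp: yd_0)
  then show False using v(2) by contradiction
qed

text \<open>Since \<open>1 - Q\<close> has rank at most \<open>d\<close>, the matrix of the
  truncated determinant is \<open>A - B * C\<close> with \<open>A\<close> the matrix of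
  \<open>quotient_det\<close> and inner dimension \<open>d\<close>. Pulling out \<open>A\<close> and
  applying \<open>sylvester_det\<close> leaves a \<open>d\<close> by \<open>d\<close> determinant,
  which will be compared with that of \<open>T\<close> on the sum of root spaces.\<close>

lemma truncated_det_factorization:
  assumes Q_def: "\<And>y. Q y = y - (\<Sum>i<d. sc (ip y (u i)) (u i))"
    and Q: "\<And>x y. Q (x + y) = Q x + Q y" "\<And>a x. Q (sc a x) = sc a (Q x)"
    and nz: "quotient_det Q n z \<noteq> 0"
  shows "\<exists>x. (\<forall>i<d. x i - sc z (Q (TN n (x i))) = u i) \<and>
    truncated_det n z = quotient_det Q n z * det (mat d d (\<lambda>(l,i). (if l = i then 1 else 0) - z * ip (TN n (x i)) (u l)))"
proof -
  define A where "A = mat n n (\<lambda>(j,k). (if j = k then 1 else 0) - z * yd j (Q (yv k)))"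
  have A: "A \<in> carrier_mat n n" by (simp add: A_def)
  have dA: "det A = quotient_det Q n z" by (simp add: A_def quotient_det_def)
  have Q0: "Q 0 = 0" using Q(2)[of 0 0] by simp
  have Qs: "Q (\<Sum>i\<in>I. f i) = (\<Sum>i\<in>I. Q (f i))" for f and I :: "nat set"
    by (induction I rule: infinite_finite_induct) (auto simp: Q0 Q(1))
  define B where "B = mat n d (\<lambda>(j,i). yd j (u i))"
  define C where "C = mat d n (\<lambda>(i,k). z * ip (yv k) (u i))"
  \<comment> \<open>The inverse of \<open>A\<close> applied to \<open>B\<close>, written with the
    adjugate.\<close>
  define X where "X = (1 / det A) \<cdot>\<^sub>m (adj_mat A * B)"
  have B: "B \<in> carrier_mat n d" and C: "C \<in> carrier_mat d n" by (simp_all add: B_def C_def)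
  have X: "X \<in> carrier_mat n d" using adj_mat(1)[OF A] B by (simp add: X_def)
  have AX: "A * X = B"
  proof -
    have "A * X = (1 / det A) \<cdot>\<^sub>m (A * (adj_mat A * B))"
      unfolding X_def using A adj_mat(1)[OF A] B by (intro mult_smult_distrib[of _ n n _ d]) auto
    also have "A * (adj_mat A * B) = (A * adj_mat A) * B"
      using A adj_mat(1)[OF A] B by (simp add: assoc_mult_mat[of _ n n _ n _ d])
    also have "A * adj_mat A = det A \<cdot>\<^sub>m 1\<^sub>m n" by (rule adj_mat(2)[OF A])
    also have "(det A \<cdot>\<^sub>m 1\<^sub>m n) * B = det A \<cdot>\<^sub>m B"
      using B by (simp add: mult_smult_assoc_mat[of _ n n _ d])
    finally show ?thesis using nz B by (intro eq_matI) (auto simp: dA)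
  qed
  \<comment> \<open>The solution of \<open>x - sc z (Q (TN n x)) = u i\<close>; its coordinates turn
    out to be column \<open>i\<close> of \<open>X\<close>.\<close>
  define x where "x i = u i + sc z (Q (\<Sum>k<n. sc (X $$ (k,i)) (yv k)))" for i
  have ydx: "yd j (x i) = X $$ (j,i)" if "j < n" "i < d" for i j
  proof -
    have "yd j (u i) = (A * X) $$ (j,i)" unfolding AX using that by (simp add: B_def)
    also have "\<dots> = (\<Sum>k<n. ((if j = k then 1 else 0) - z * yd j (Q (yv k))) * X $$ (k,i))"
      using that A X by (simp add: scalar_prod_def atLeast0LessThan A_def)
    also have "\<dots> = (\<Sum>k<n. (if j = k then X $$ (k,i) else 0) - z * (X $$ (k,i) * yd j (Q (yv k))))"
      by (intro sum.cong) (auto simp: algebra_simps)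
    also have "\<dots> = X $$ (j,i) - (yd j (x i) - yd j (u i))"
      using that by (simp add: sum_subtractf x_def Qs Q(2) yd_add yd_sc yd_sum sum_distrib_left)
    finally show ?thesis by simp
  qed
  have TNx: "TN n (x i) = (\<Sum>k<n. sc (X $$ (k,i)) (yv k))" if "i < d" for i
    unfolding TN_def using that by (intro sum.cong refl) (simp add: ydx)
  have 1: "\<forall>i<d. x i - sc z (Q (TN n (x i))) = u i"
    by (simp add: TNx, simp add: x_def)
  have "mat n n (\<lambda>(j,k). (if j = k then 1 else 0) - z * yd j (yv k)) = A - B * C"
  proof (rule eq_matI)
    fix j k assume "j < dim_row (A - B * C)" "k < dim_col (A - B * C)"
    then have jk: "j < n" "k < n" using A B C by auto
    have "(B * C) $$ (j,k) = (\<Sum>i<d. yd j (u i) * (z * ip (yv k) (u i)))"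
      using jk by (simp add: B_def C_def scalar_prod_def atLeast0LessThan)
    also have "\<dots> = z * (yd j (yv k) - yd j (Q (yv k)))"
      by (simp add: Q_def yd_diff yd_sum yd_sc sum_distrib_left mult_ac)
    finally show "mat n n (\<lambda>(j,k). (if j = k then 1 else 0) - z * yd j (yv k)) $$ (j,k) = (A - B * C) $$ (j,k)"
      using jk A B C by (simp add: A_def algebra_simps)
  qed (use A B C in auto)
  also have "A - B * C = A * (1\<^sub>m n - X * C)"
  proof -
    have "A * (1\<^sub>m n - X * C) = A * 1\<^sub>m n - A * (X * C)"
      using A X C by (intro mult_minus_distrib_mat[of _ n n _ n]) auto
    also have "A * (X * C) = B * C" using assoc_mult_mat[OF A X C] by (simp add: AX)
    finally show ?thesis using A by simp
  qed
  finally have "truncated_det n z = det A * det (1\<^sub>m n - X * C)"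
    unfolding truncated_det_def using det_mult[OF A minus_carrier_mat[OF mult_carrier_mat[OF X C]], of "1\<^sub>m n"] by simp
  also have "det (1\<^sub>m n - X * C) = det (1\<^sub>m d - C * X)" by (rule sylvester_det[OF X C])
  also have "1\<^sub>m d - C * X = mat d d (\<lambda>(l,i). (if l = i then 1 else 0) - z * ip (TN n (x i)) (u l))"
  proof (rule eq_matI)
    fix l i assume "l < dim_row (mat d d (\<lambda>(l,i). (if l = i then 1 else 0) - z * ip (TN n (x i)) (u l)))"
      "i < dim_col (mat d d (\<lambda>(l,i). (if l = i then 1 else 0) - z * ip (TN n (x i)) (u l)))"
    then have li: "l < d" "i < d" by auto
    have "(C * X) $$ (l,i) = (\<Sum>k<n. z * ip (yv k) (u l) * X $$ (k,i))"
      using li X by (simp add: C_def scalar_prod_def atLeast0LessThan)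
    also have "\<dots> = z * ip (TN n (x i)) (u l)"
      by (simp add: TNx[OF li(2)] hs.ip_sum hs.ip_sc sum_distrib_left mult_ac)
    finally show "(1\<^sub>m d - C * X) $$ (l,i) = mat d d (\<lambda>(l,i). (if l = i then 1 else 0) - z * ip (TN n (x i)) (u l)) $$ (l,i)"
      using li X C by simp
  qed (use X C in auto)
  finally show ?thesis using 1 by (auto simp: dA)
qed

lemma trace_summable: "summable (\<lambda>k. norm (yd k (yv k)))"
  by (rule summable_comparison_test'[OF yv, of 0]) (use yd_le in auto)

lemma ln_growth_summable: "0 \<le> t \<Longrightarrow> summable (\<lambda>k. ln (1 + t * (\<alpha> k * \<beta> k)))"
proof (rule summable_comparison_test'[OF summable_mult[OF \<rho>_summable, of t], of 0])
  fix k assume "0 \<le> t"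
  then have "0 \<le> t * (\<alpha> k * \<beta> k)" using \<alpha>_pos[of k] \<beta>_pos[of k] by simp
  then show "norm (ln (1 + t * (\<alpha> k * \<beta> k))) \<le> t * (\<alpha> k * \<beta> k)"
    using ln_add_one_self_le_self[of "t * (\<alpha> k * \<beta> k)"] by simp
qed

lemma truncated_det_growth:
  assumes "cmod z \<le> t"
  shows "cmod (truncated_det n z) \<le> exp (\<Sum>k. ln (1 + t * (\<alpha> k * \<beta> k)))"
proof -
  have t: "0 \<le> t" using assms norm_ge_zero order.trans by blast
  have pos: "1 \<le> 1 + t * (\<alpha> k * \<beta> k)" for k using t \<alpha>_pos[of k] \<beta>_pos[of k] by simp
  have "cmod (truncated_det n z) \<le> (\<Prod>k<n. 1 + cmod z * (\<alpha> k * \<beta> k))"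
    unfolding truncated_det_def by (rule det_bound[OF tb \<alpha>_pos \<beta>_pos])
  also have "\<dots> \<le> (\<Prod>k<n. 1 + t * (\<alpha> k * \<beta> k))"
    using assms \<alpha>_pos \<beta>_pos by (intro prod_mono) (auto intro!: mult_right_mono add_nonneg_nonneg mult_nonneg_nonneg simp: less_imp_le)
  also have "\<dots> = exp (\<Sum>k<n. ln (1 + t * (\<alpha> k * \<beta> k)))"
    unfolding exp_sum[OF finite_lessThan]
  proof (intro prod.cong refl)
    show "1 + t * (\<alpha> k * \<beta> k) = exp (ln (1 + t * (\<alpha> k * \<beta> k)))" for k
      using pos[of k] by (intro exp_ln[symmetric]) linarith
  qed
  also have "\<dots> \<le> exp (\<Sum>k. ln (1 + t * (\<alpha> k * \<beta> k)))"
    using pos by (simp, intro sum_le_suminf ln_growth_summable t) (auto intro!: ln_ge_zero)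
  finally show ?thesis .
qed

text \<open>In the variable \<open>z = 1 / \<mu>\<close> these correspond to the points of the
  closed disc of radius \<open>R\<close> where \<open>1 - z T\<close> fails to be injective.\<close>

definition large_eigenvalues :: "real \<Rightarrow> complex set" where
  "large_eigenvalues R = {\<mu> \<in> eigenvalues J T. 1 / R \<le> cmod \<mu>}"

lemma finite_large_eigenvalues': "0 < R \<Longrightarrow> finite (large_eigenvalues R)"
  unfolding large_eigenvalues_def by (rule finite_large_eigenvalues) simp

text \<open>From \<open>x = sc z (Q (T x))\<close> the vector \<open>shifted (1 / z) x\<close>
  equals \<open>T x - Q (T x)\<close>, which lies in the root sum; by
  \<open>root_sum_absorbs\<close> so does \<open>x\<close>, and thus \<open>Q x = 0\<close>. But
  \<open>x\<close> is in the range of the idempotent \<open>Q\<close>, so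
  \<open>x = Q x\<close>.\<close>

lemma quotient_injective:
  assumes \<Lambda>: "finite \<Lambda>" "0 \<notin> \<Lambda>"
    and PE: "\<And>y. y - Q y \<in> root_sum \<Lambda>" and Q0: "\<And>y. y \<in> root_sum \<Lambda> \<Longrightarrow> Q y = 0"
    and Qd: "\<And>x y. Q (x - y) = Q x - Q y" "\<And>a x. Q (sc a x) = sc a (Q x)"
    and z: "z = 0 \<or> 1 / z \<in> \<Lambda> \<or> 1 / z \<notin> eigenvalues J T"
    and x: "x = sc z (Q (T x))"
  shows "x = 0"
proof (cases "z = 0")
  case True
  then show ?thesis using x by simp
next
  case False
  have "sc (1 / z) x = Q (T x)"
    by (subst x) (simp add: False)
  then have "shifted (1 / z) x = T x - Q (T x)" by (simp add: shifted_def)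
  then have "shifted (1 / z) x \<in> root_sum \<Lambda>" using PE by simp
  then have xE: "x \<in> root_sum \<Lambda>" using root_sum_absorbs[OF \<Lambda>] z False by blast
  have "Q (T x - Q (T x)) = 0" using Q0 PE by blast
  then have "Q (Q (T x)) = Q (T x)" using Qd(1) by simp
  then have "Q x = sc z (Q (T x))" using arg_cong[OF x, of Q] by (simp add: Qd(2))
  then show ?thesis using x Q0[OF xE] by simp
qed

text \<open>Origin of the constants: the comparison circle has radius below \<open>3 * R\<close>,
  where the growth is measured; \<open>ln 2\<close> pays for a comparison of determinants up to the
  factor 2; and \<open>2 / R\<close> is the factor in
  \<open>Borel_Caratheodory_deriv\<close>.\<close>

lemma trace_estimate:
  assumes R: "0 < R"
  shows "cmod ((\<Sum>k. yd k (yv k)) - (\<Sum>\<mu>\<in>large_eigenvalues R. of_nat (alg_mult J T \<mu>) * \<mu>))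
    \<le> 2 * (ln 2 + (\<Sum>k. ln (1 + 3 * R * (\<alpha> k * \<beta> k)))) / R"
proof -
  define \<Lambda> where "\<Lambda> = large_eigenvalues R"
  have \<Lambda>: "finite \<Lambda>" "0 \<notin> \<Lambda>" using finite_large_eigenvalues'[OF R] R by (auto simp: \<Lambda>_def large_eigenvalues_def)
  obtain d e l where f: "flag d e l" "vs.span (e ` {..<d}) = root_sum \<Lambda>" "\<forall>i<d. l i \<in> \<Lambda>"
    "\<forall>\<mu>\<in>\<Lambda>. card {i. i < d \<and> l i = \<mu>} = alg_mult J T \<mu>"
    using root_sum_flag[OF \<Lambda>] by blast
  have lsum: "(\<Sum>i<d. l i) = (\<Sum>\<mu>\<in>\<Lambda>. of_nat (alg_mult J T \<mu>) * \<mu>)"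
    using sum_over_flag[OF \<Lambda>(1) f(3,4), of "\<lambda>x. x"] by simp
  obtain u where u: "hs.orthonormal u d" and spu: "vs.span (u ` {..<d}) = root_sum \<Lambda>"
    and fl: "\<And>i. i < d \<Longrightarrow> T (u i) - sc (l i) (u i) \<in> vs.span (u ` {..<i})"
    using flag_orthonormal[OF f(1)] f(2) by auto
  define P where "P y = (\<Sum>i<d. sc (ip y (u i)) (u i))" for y
  define Q where "Q y = y - P y" for y
  have PE: "P y \<in> root_sum \<Lambda>" for y
    unfolding P_def spu[symmetric] by (intro vs.span_sum vs.span_scale vs.span_base) auto
  have Q0: "Q y = 0" if "y \<in> root_sum \<Lambda>" for y
    using hs.orthonormal_expansion[OF u, of y] that by (simp add: Q_def P_def spu)
  have Q_lin: "Q (x + y) = Q x + Q y" "Q (x - y) = Q x - Q y" "Q (sc a x) = sc a (Q x)" for x y a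
    by (simp_all add: Q_def P_def hs.ip_add hs.ip_minus hs.ip_sc sc.add_left sc.diff_left sum.distrib
        sum_subtractf vs.scale_right_diff_distrib vs.scale_sum_right)
  define BI where "BI = (\<Sum>k. (\<tau> k)\<^sup>2)"
  have BI: "0 \<le> BI" unfolding BI_def by (intro suminf_nonneg \<tau>2_summable) simp
  define U where "U = (\<Sum>i<d. norm (u i))"
  have U: "norm (u i) \<le> U" if "i < d" for i
    unfolding U_def using that by (intro member_le_sum) auto
  have U0: "0 \<le> U" unfolding U_def by (intro sum_nonneg) simp
  define CQ where "CQ = 1 + (\<Sum>i<d. BI * norm (u i) * norm (u i))"
  have CQ: "norm (Q x) \<le> CQ * norm x" for x
  proof -
    have "norm (P x) \<le> (\<Sum>i<d. BI * (norm x * norm (u i)) * norm (u i))"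
      unfolding P_def by (intro sum_norm_le) (auto simp: norm_sc BI_def intro!: mult_right_mono ip_le)
    also have "\<dots> = (CQ - 1) * norm x" by (simp add: CQ_def sum_distrib_left mult_ac)
    finally have "norm (P x) \<le> (CQ - 1) * norm x" .
    then show ?thesis using norm_triangle_ineq4[of x "P x"] by (simp add: Q_def algebra_simps)
  qed
  have CQ0: "0 \<le> CQ" unfolding CQ_def using BI by (intro add_nonneg_nonneg sum_nonneg) auto
  have Q_bl: "bounded_linear Q"
  proof (rule bounded_linear_intro[where K = CQ])
    show "Q (a *\<^sub>R x) = a *\<^sub>R Q x" for a x using Q_lin(3)[of "of_real a" x] by (simp add: cscale_def)
    show "norm (Q x) \<le> norm x * CQ" for x using CQ[of x] by (simp add: mult.commute)
  qed (rule Q_lin(1))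
  \<comment> \<open>Above \<open>2 * R\<close>, every factor \<open>1 - z * l i\<close> with
    \<open>cmod z = r\<close> has modulus at least 1. Avoiding finitely many moduli keeps the circle
    free of reciprocals of eigenvalues.\<close>
  obtain r where r: "2 * R < r" "r < 3 * R" "r \<notin> (\<lambda>\<mu>. cmod (1 / \<mu>)) ` large_eigenvalues (3 * R)"
  proof -
    have "infinite {2 * R<..<3 * R}" using R by (simp add: infinite_Ioo)
    moreover have "finite ((\<lambda>\<mu>. cmod (1 / \<mu>)) ` large_eigenvalues (3 * R))"
      using finite_large_eigenvalues'[of "3 * R"] R by simp
    ultimately have "\<not> {2 * R<..<3 * R} \<subseteq> (\<lambda>\<mu>. cmod (1 / \<mu>)) ` large_eigenvalues (3 * R)"
      using finite_subset by blast
    then show ?thesis using that by (meson greaterThanLessThan_iff subsetI)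
  qed
  \<comment> \<open>The disc is where the logarithm is taken and the circle is where determinants
    are compared. Zeros in the annulus between them are harmless, because the maximum principle
    carries the upper bound inwards from the circle.\<close>
  define Z where "Z = cball (0::complex) R \<union> sphere 0 r"
  have Z: "compact Z" unfolding Z_def by (intro compact_Un compact_cball compact_sphere)
  have Zle: "cmod z \<le> 3 * R" if "z \<in> Z" for z using that r R by (auto simp: Z_def)
  have inj: "x = 0" if "z \<in> Z" "x = sc z (Q (T x))" for z x
  proof (rule quotient_injective[OF \<Lambda> _ Q0 Q_lin(2,3) _ that(2)])
    show "y - Q y \<in> root_sum \<Lambda>" for y using PE by (simp add: Q_def)
    show "z = 0 \<or> 1 / z \<in> \<Lambda> \<or> 1 / z \<notin> eigenvalues J T"
    proof (rule ccontr)
      assume "\<not> ?thesis"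
      then have z: "z \<noteq> 0" "1 / z \<notin> \<Lambda>" "1 / z \<in> eigenvalues J T" by auto
      have "\<not> cmod z \<le> R"
      proof
        assume "cmod z \<le> R"
        then have "1 / R \<le> cmod (1 / z)" using z(1) R by (simp add: norm_divide frac_le)
        then show False using z by (simp add: \<Lambda>_def large_eigenvalues_def)
      qed
      then have zr: "cmod z = r" using that(1) by (auto simp: Z_def)
      then have "1 / (3 * R) \<le> cmod (1 / z)" using z(1) r R by (simp add: norm_divide frac_le)
      then have "1 / z \<in> large_eigenvalues (3 * R)" using z by (simp add: large_eigenvalues_def)
      moreover have "cmod (1 / (1 / z)) = r" using zr by simp
      ultimately show False using r(3) by (metis image_eqI)
    qed
  qed
  have "\<exists>c>0. \<exists>n0. \<forall>n\<ge>n0. \<forall>z\<in>Z. \<forall>x. c * norm x \<le> norm (x - sc z (Q (TN n x)))"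
    by (rule uniform_lower_bound_TN[OF Q_bl Z]) (rule inj)
  then obtain c n0 where c: "0 < c" and lb: "\<And>n z x. n \<ge> n0 \<Longrightarrow> z \<in> Z \<Longrightarrow> c * norm x \<le> norm (x - sc z (Q (TN n x)))"
    by blast
  have nz: "quotient_det Q n z \<noteq> 0" if "n \<ge> n0" "z \<in> Z" for n z
  proof (rule quotient_det_nonzero)
    fix x assume "x = sc z (Q (TN n x))"
    then have "c * norm x \<le> 0" using lb[OF that, of x] by simp
    then show "x = 0" using c by (simp add: mult_le_0_iff)
  qed (rule Q_lin)+
  \<comment> \<open>The limit of the small matrix in \<open>truncated_det_factorization\<close>:
    \<open>Q T\<close> vanishes on the root sum, so the solutions \<open>x i\<close> tend to
    \<open>u i\<close>. It is upper triangular with diagonal \<open>l\<close>.\<close>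
  define A where "A l' i = ip (T (u i)) (u l')" for l' i
  define G where "G z = det (mat d d (\<lambda>(l',i). (if l' = i then 1 else 0) - z * A l' i))" for z
  have G1: "1 \<le> cmod (G z)" if z: "cmod z = r" for z
  proof -
    let ?M = "mat d d (\<lambda>(l',i). (if l' = i then 1 else 0) - z * A l' i)"
    have Al: "A i i = l i" if "i < d" for i
      unfolding A_def by (rule hs.flag_diagonal[OF u that fl[OF that]])
    have A0: "A l' i = 0" if "i < l'" "l' < d" for l' i
    proof -
      have "ip x (u l') = 0" if "x \<in> vs.span (u ` {..<i})" for x
        using that
      proof (induction rule: vs.span_induct_alt)
        case (step c x y)
        then show ?case using u \<open>i < l'\<close> \<open>l' < d\<close> by (auto simp: hs.ip_add hs.ip_sc hs.orthonormal_def)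
      qed simp
      then have "ip (T (u i) - sc (l i) (u i)) (u l') = 0" using fl[of i] that by simp
      then show ?thesis using u that by (simp add: A_def hs.ip_minus hs.ip_sc hs.orthonormal_def)
    qed
    have "G z = prod_list (diag_mat ?M)"
      unfolding G_def by (rule det_upper_triangular[of _ d]) (auto simp: upper_triangular_def A0)
    also have "\<dots> = (\<Prod>i<d. 1 - z * l i)"
      by (simp add: diag_mat_def prod.list_conv_set_nth atLeast0LessThan Al)
    finally have "cmod (G z) = (\<Prod>i<d. cmod (1 - z * l i))" by (simp add: prod_norm)
    also have "(\<Prod>i<d. cmod (1 - z * l i)) \<ge> 1"
    proof (rule prod_ge_1)
      fix i assume "i \<in> {..<d}"
      then have "1 / R \<le> cmod (l i)" using f(3) by (auto simp: \<Lambda>_def large_eigenvalues_def)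
      then have "(2 * R) * (1 / R) \<le> r * cmod (l i)" using r R by (intro mult_mono) auto
      then have "2 \<le> cmod (z * l i)" using R z by (simp add: norm_mult)
      then show "1 \<le> cmod (1 - z * l i)" using norm_triangle_ineq2[of "z * l i" 1] by (simp add: norm_minus_commute)
    qed
    finally show ?thesis .
  qed
  \<comment> \<open>As \<open>cmod (G z)\<close> is at least 1 on the circle, an error below 1/2
    keeps the perturbed determinant at least 1/2 in modulus.\<close>
  obtain \<delta> where \<delta>: "0 < \<delta>" "\<And>z a. cmod z \<le> 3 * R \<Longrightarrow> (\<forall>i<d. \<forall>j<d. cmod (a i j - A i j) \<le> \<delta>) \<Longrightarrow>
    cmod (det (mat d d (\<lambda>(i,j). (if i = j then 1 else 0) - z * a i j)) - G z) < 1 / 2"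
    using det_one_minus_continuous[of "1/2" "3 * R" d A] unfolding G_def by auto
  \<comment> \<open>\<open>\<eta> n\<close> will bound \<open>norm (x i - u i)\<close>, and
    \<open>b n\<close> the resulting error in the matrix entries.\<close>
  define \<eta> where "\<eta> n = 3 * R * (CQ * (\<epsilon> n * U)) / c" for n
  define b where "b n = BI * ((\<epsilon> n * (U + \<eta> n) + \<epsilon> 0 * \<eta> n) * U)" for n
  have \<eta>_lim: "\<eta> \<longlonglongrightarrow> 3 * R * (CQ * (0 * U)) / c" unfolding \<eta>_def using c by (intro tendsto_intros \<epsilon>_tendsto) auto
  have "b \<longlonglongrightarrow> BI * ((0 * (U + 3 * R * (CQ * (0 * U)) / c) + \<epsilon> 0 * (3 * R * (CQ * (0 * U)) / c)) * U)"
    unfolding b_def by (intro tendsto_intros \<epsilon>_tendsto \<eta>_lim)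
  then have "b \<longlonglongrightarrow> 0" by simp
  then obtain n1 where n1: "\<And>n. n \<ge> n1 \<Longrightarrow> b n < \<delta>"
    using order_tendstoD(2)[OF _ \<delta>(1)] by (fastforce simp: eventually_sequentially)
  have half: "cmod (quotient_det Q n z) \<le> 2 * cmod (truncated_det n z)" if n: "n \<ge> n0" "n \<ge> n1" and z: "cmod z = r" for n z
  proof -
    have zZ: "z \<in> Z" using z by (simp add: Z_def)
    obtain x where x: "\<And>i. i < d \<Longrightarrow> x i - sc z (Q (TN n (x i))) = u i"
      and fac: "truncated_det n z = quotient_det Q n z * det (mat d d (\<lambda>(l,i). (if l = i then 1 else 0) - z * ip (TN n (x i)) (u l)))"
      using truncated_det_factorization[where Q = Q and d = d and u = u and n = n and z = z, OF _ Q_lin(1,3) nz[OF n(1) zZ]]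
      by (auto simp: Q_def[symmetric] P_def[symmetric])
    have xu: "norm (x i - u i) \<le> \<eta> n" if i: "i < d" for i
    proof -
      \<comment> \<open>The root sum is \<open>T\<close>-invariant and killed by \<open>Q\<close>;
        hence \<open>u i\<close> satisfies the equation of \<open>x i\<close> up to the truncation
        error of \<open>T\<close>.\<close>
      have "u i \<in> root_sum \<Lambda>" unfolding spu[symmetric] using i by (intro vs.span_base) auto
      then have "T (u i) \<in> root_sum \<Lambda>" using flag_invariant[OF f(1)] f(2) by auto
      then have "Q (T (u i)) = 0" by (rule Q0)
      then have "(x i - u i) - sc z (Q (TN n (x i - u i))) = sc z (Q (TN n (u i) - T (u i)))"
        using x[OF i] by (simp add: TN_diff Q_lin(2) sc.diff_right algebra_simps)
      then have "c * norm (x i - u i) \<le> cmod z * norm (Q (TN n (u i) - T (u i)))"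
        using lb[OF n(1) zZ, of "x i - u i"] by (simp add: norm_sc)
      also have "\<dots> \<le> 3 * R * (CQ * (\<epsilon> n * U))"
      proof (intro mult_mono Zle zZ)
        have "norm (Q (TN n (u i) - T (u i))) \<le> CQ * norm (TN n (u i) - T (u i))" by (rule CQ)
        also have "\<dots> \<le> CQ * (\<epsilon> n * norm (u i))"
          using T_diff_TN[of "u i" n] CQ0 by (intro mult_left_mono) (auto simp: norm_minus_commute)
        also have "\<dots> \<le> CQ * (\<epsilon> n * U)"
          using U[OF i] CQ0 \<epsilon>_nonneg by (intro mult_left_mono) auto
        finally show "norm (Q (TN n (u i) - T (u i))) \<le> CQ * (\<epsilon> n * U)" .
      qed (use R in auto)
      finally show ?thesis using c by (simp add: \<eta>_def field_simps)
    qed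
    have "cmod (ip (TN n (x i)) (u j) - A j i) \<le> \<delta>" if "i < d" "j < d" for i j
    proof -
      have \<eta>0: "0 \<le> \<eta> n" using xu[OF that(1)] norm_ge_zero order.trans by blast
      have nx: "norm (x i) \<le> U + \<eta> n"
        using norm_triangle_sub[of "x i" "u i"] U[OF that(1)] xu[OF that(1)] by simp
      have "norm (TN n (x i) - T (u i)) \<le> norm (TN n (x i) - T (x i)) + norm (T (x i) - T (u i))"
        using norm_triangle_ineq[of "TN n (x i) - T (x i)" "T (x i) - T (u i)"] by simp
      also have "\<dots> \<le> \<epsilon> n * norm (x i) + \<epsilon> 0 * norm (x i - u i)"
        using T_diff_TN[of "x i" n] T_norm[of "x i - u i"] by (simp add: norm_minus_commute T_diff)
      also have "\<dots> \<le> \<epsilon> n * (U + \<eta> n) + \<epsilon> 0 * \<eta> n"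
        using nx xu[OF that(1)] \<epsilon>_nonneg by (intro add_mono mult_left_mono) auto
      finally have 1: "norm (TN n (x i) - T (u i)) \<le> \<epsilon> n * (U + \<eta> n) + \<epsilon> 0 * \<eta> n" .
      have "cmod (ip (TN n (x i)) (u j) - A j i) \<le> BI * (norm (TN n (x i) - T (u i)) * norm (u j))"
        unfolding A_def hs.ip_minus[symmetric] BI_def by (rule ip_le)
      also have "\<dots> \<le> b n"
        unfolding b_def using 1 U[OF that(2)] U0 BI \<epsilon>_nonneg \<eta>0 by (intro mult_left_mono mult_mono) auto
      finally show ?thesis using n1[OF n(2)] by simp
    qed
    then have "cmod (det (mat d d (\<lambda>(i,j). (if i = j then 1 else 0) - z * ip (TN n (x j)) (u i))) - G z) < 1 / 2"
      using \<delta>(2)[OF Zle[OF zZ], of "\<lambda>i j. ip (TN n (x j)) (u i)"] by simp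
    then have "1 / 2 \<le> cmod (det (mat d d (\<lambda>(i,j). (if i = j then 1 else 0) - z * ip (TN n (x j)) (u i))))"
      using G1[OF z] norm_triangle_ineq2[of "G z" "det (mat d d (\<lambda>(i,j). (if i = j then 1 else 0) - z * ip (TN n (x j)) (u i)))"]
      by (simp add: norm_minus_commute)
    then have "cmod (quotient_det Q n z) * (1 / 2) \<le> cmod (truncated_det n z)"
      unfolding fac norm_mult by (intro mult_left_mono) auto
    then show ?thesis by simp
  qed
  define L where "L = (\<Sum>k. ln (1 + 3 * R * (\<alpha> k * \<beta> k)))"
  \<comment> \<open>The trace of the finite section of \<open>Q T\<close>, that is, minus the
    derivative of \<open>quotient_det Q n\<close> at 0.\<close>
  define t where "t n = (\<Sum>k<n. yd k (Q (yv k)))" for n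
  have t_le: "cmod (t n) \<le> 2 * (ln 2 + L) / R" if n: "n \<ge> n0" "n \<ge> n1" for n
  proof -
    have hol: "quotient_det Q n holomorphic_on X" for X
      unfolding quotient_det_def[abs_def] by (rule det_one_minus_deriv(2))
    have der: "(quotient_det Q n has_field_derivative - t n) (at 0)"
      unfolding quotient_det_def[abs_def] t_def by (rule det_one_minus_deriv(1))
    have bnd: "cmod (quotient_det Q n z) \<le> exp (ln 2 + L)" if "z \<in> ball 0 r" for z
    proof (rule maximum_modulus_frontier[of "quotient_det Q n" "ball 0 r"])
      show "quotient_det Q n holomorphic_on interior (ball 0 r)" "bounded (ball (0::complex) r)" by (auto intro: hol)
      show "continuous_on (closure (ball 0 r)) (quotient_det Q n)" by (intro holomorphic_on_imp_continuous_on hol)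
      show "z \<in> ball 0 r" by fact
      fix w :: complex assume "w \<in> frontier (ball 0 r)"
      then have w: "cmod w = r" using r R by (simp add: frontier_ball)
      have "cmod (quotient_det Q n w) \<le> 2 * cmod (truncated_det n w)" by (rule half[OF n w])
      also have "\<dots> \<le> 2 * exp L" unfolding L_def using w r by (intro mult_left_mono truncated_det_growth) auto
      finally show "cmod (quotient_det Q n w) \<le> exp (ln 2 + L)" by (simp add: exp_add)
    qed
    have "cmod (deriv (quotient_det Q n) 0) \<le> 2 * (ln 2 + L) / R"
    proof (rule Borel_Caratheodory_deriv[OF hol R])
      show "quotient_det Q n z \<noteq> 0" if "z \<in> ball 0 R" for z using that by (intro nz n) (auto simp: Z_def)
      show "cmod (quotient_det Q n z) \<le> exp (ln 2 + L)" if "z \<in> ball 0 R" for z using that r R by (intro bnd) auto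
      show "quotient_det Q n 0 = 1" unfolding quotient_det_def by (rule det_one_minus_0)
    qed
    then show ?thesis using DERIV_imp_deriv[OF der] by simp
  qed
  have "t \<longlonglongrightarrow> (\<Sum>k. yd k (yv k)) - (\<Sum>i<d. l i)"
  proof -
    \<comment> \<open>The trace removed by \<open>P\<close> is that of the truncation on the span of
      the \<open>u i\<close>; it tends to the sum of the diagonal entries
      \<open>l i\<close>.\<close>
    have t: "t n = (\<Sum>k<n. yd k (yv k)) - (\<Sum>i<d. ip (TN n (u i)) (u i))" for n
    proof -
      have "(\<Sum>k<n. yd k (P (yv k))) = (\<Sum>i<d. \<Sum>k<n. ip (yv k) (u i) * yd k (u i))"
        by (subst sum.swap) (simp add: P_def yd_sum yd_sc)
      also have "\<dots> = (\<Sum>i<d. ip (TN n (u i)) (u i))"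
        by (simp add: TN_def hs.ip_sum hs.ip_sc mult.commute)
      finally show ?thesis by (simp add: t_def Q_def yd_diff sum_subtractf)
    qed
    have "(\<lambda>n. ip (TN n (u i)) (u i)) \<longlonglongrightarrow> l i" if i: "i < d" for i
    proof -
      have le: "cmod (ip (TN n (u i)) (u i) - l i) \<le> BI * (\<epsilon> n * norm (u i) * norm (u i))" for n
      proof -
        have "ip (TN n (u i)) (u i) - l i = ip (TN n (u i) - T (u i)) (u i)"
          using hs.flag_diagonal[OF u i fl[OF i]] by (simp add: hs.ip_minus)
        also have "cmod \<dots> \<le> BI * (norm (TN n (u i) - T (u i)) * norm (u i))" unfolding BI_def by (rule ip_le)
        also have "\<dots> \<le> BI * (\<epsilon> n * norm (u i) * norm (u i))"
          using T_diff_TN[of "u i" n] BI by (intro mult_left_mono mult_right_mono) (auto simp: norm_minus_commute)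
        finally show ?thesis .
      qed
      have "(\<lambda>n. BI * (\<epsilon> n * norm (u i) * norm (u i))) \<longlonglongrightarrow> BI * (0 * norm (u i) * norm (u i))"
        by (intro tendsto_intros \<epsilon>_tendsto)
      then have "(\<lambda>n. BI * (\<epsilon> n * norm (u i) * norm (u i))) \<longlonglongrightarrow> 0" by simp
      then have "(\<lambda>n. ip (TN n (u i)) (u i) - l i) \<longlonglongrightarrow> 0"
        by (rule Lim_null_comparison[OF always_eventually[OF allI[OF le]]])
      then show ?thesis by (simp add: LIM_zero_iff)
    qed
    then show ?thesis unfolding t
      using summable_LIMSEQ[OF summable_norm_cancel[OF trace_summable]] by (intro tendsto_intros) auto
  qed
  from tendsto_norm[OF this]
  have "cmod ((\<Sum>k. yd k (yv k)) - (\<Sum>i<d. l i)) \<le> 2 * (ln 2 + L) / R"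
    by (rule tendsto_upperbound[OF _ eventually_sequentiallyI[of "max n0 n1"]]) (use t_le in auto)
  then show ?thesis by (simp add: lsum \<Lambda>_def L_def)
qed

lemma eigenvalue_sum_abs_summable:
  "(\<lambda>\<mu>. real (alg_mult J T \<mu>) * cmod \<mu>) summable_on (eigenvalues J T - {0})"
proof (rule nonneg_bdd_above_summable_on)
  show "bdd_above (sum (\<lambda>\<mu>. real (alg_mult J T \<mu>) * cmod \<mu>) ` {F. F \<subseteq> eigenvalues J T - {0} \<and> finite F})"
    by (rule bdd_aboveI[of _ trace_const]) (auto intro: eigenvalue_sum_le)
qed auto

text \<open>Minimal type in the form needed: each summand tends to 0 and is dominated by
  \<open>3 * (\<alpha> k * \<beta> k)\<close>, so Tannery's theorem applies.\<close>

lemma growth_limit: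
  "(\<lambda>n. 2 * (ln 2 + (\<Sum>k. ln (1 + 3 * real (Suc n) * (\<alpha> k * \<beta> k)))) / real (Suc n)) \<longlonglongrightarrow> 0"
proof -
  have pos: "0 < \<alpha> k * \<beta> k" for k using \<alpha>_pos[of k] \<beta>_pos[of k] by simp
  have "(\<lambda>n. \<Sum>k. ln (1 + 3 * real (Suc n) * (\<alpha> k * \<beta> k)) / real (Suc n)) \<longlonglongrightarrow> (\<Sum>k. 0)"
  proof (rule tannerys_theorem[THEN conjunct2, THEN conjunct2])
    show "(\<lambda>n. ln (1 + 3 * real (Suc n) * (\<alpha> k * \<beta> k)) / real (Suc n)) \<longlonglongrightarrow> 0" for k
    proof -
      have "((\<lambda>x::real. ln (1 + 3 * x * (\<alpha> k * \<beta> k)) / x) \<longlongrightarrow> 0) at_top"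
        using pos[of k] by real_asymp
      then show ?thesis
        by (rule filterlim_compose) (rule filterlim_compose[OF filterlim_real_sequentially filterlim_Suc])
    qed
    show "\<forall>\<^sub>F (k, n) in at_top \<times>\<^sub>F sequentially. norm (ln (1 + 3 * real (Suc n) * (\<alpha> k * \<beta> k)) / real (Suc n)) \<le> 3 * (\<alpha> k * \<beta> k)"
    proof (intro always_eventually allI, clarify)
      fix k n
      have p: "0 \<le> 3 * real (Suc n) * (\<alpha> k * \<beta> k)" using pos[of k] by simp
      then have "ln (1 + 3 * real (Suc n) * (\<alpha> k * \<beta> k)) \<le> 3 * real (Suc n) * (\<alpha> k * \<beta> k)"
        by (rule ln_add_one_self_le_self)
      moreover have "0 \<le> ln (1 + 3 * real (Suc n) * (\<alpha> k * \<beta> k))" using p by (intro ln_ge_zero) linarith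
      ultimately show "norm (ln (1 + 3 * real (Suc n) * (\<alpha> k * \<beta> k)) / real (Suc n)) \<le> 3 * (\<alpha> k * \<beta> k)"
        by (simp add: field_simps)
    qed
    show "summable (\<lambda>k. 3 * (\<alpha> k * \<beta> k))" by (rule summable_mult[OF \<rho>_summable])
  qed simp
  moreover have "(\<Sum>k. ln (1 + 3 * real (Suc n) * (\<alpha> k * \<beta> k)) / real (Suc n)) =
    (\<Sum>k. ln (1 + 3 * real (Suc n) * (\<alpha> k * \<beta> k))) / real (Suc n)" for n
    by (rule suminf_divide) (rule ln_growth_summable, simp)
  ultimately have 1: "(\<lambda>n. (\<Sum>k. ln (1 + 3 * real (Suc n) * (\<alpha> k * \<beta> k))) / real (Suc n)) \<longlonglongrightarrow> 0" by simp
  have "(\<lambda>n. 2 * (ln 2 * (1 / real (Suc n)) + (\<Sum>k. ln (1 + 3 * real (Suc n) * (\<alpha> k * \<beta> k))) / real (Suc n))) \<longlonglongrightarrow> 2 * (ln 2 * 0 + 0)"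
    by (intro tendsto_intros 1 LIMSEQ_Suc[OF lim_1_over_n])
  then show ?thesis by (simp add: add_divide_distrib distrib_left)
qed

text \<open>The finite sets \<open>large_eigenvalues (real (Suc n))\<close> exhaust the nonzero
  eigenvalues, so the absolutely convergent sum may be evaluated along them, where
  \<open>trace_estimate\<close> identifies its limit.\<close>

theorem trace_formula:
  "((\<lambda>\<mu>. of_nat (alg_mult J T \<mu>) * \<mu>) has_sum (\<Sum>k. yd k (yv k))) (eigenvalues J T - {0})"
proof -
  let ?g = "\<lambda>\<mu>. of_nat (alg_mult J T \<mu>) * \<mu>" and ?E = "eigenvalues J T - {0}"
  have "?g summable_on ?E"
    by (rule abs_summable_summable) (use eigenvalue_sum_abs_summable in \<open>simp add: norm_mult\<close>)
  then obtain S where S: "(?g has_sum S) ?E" by (auto simp: summable_on_def)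
  have "S = (\<Sum>k. yd k (yv k))"
  proof -
    have "(\<lambda>n. \<Sum>\<mu>\<in>large_eigenvalues (real (Suc n)). ?g \<mu>) \<longlonglongrightarrow> S"
    proof (rule filterlim_compose[OF S[unfolded has_sum_def]])
      show "filterlim (\<lambda>n. large_eigenvalues (real (Suc n))) (finite_subsets_at_top ?E) sequentially"
        unfolding filterlim_finite_subsets_at_top
      proof (intro allI impI)
        fix X assume X: "finite X \<and> X \<subseteq> ?E"
        have "eventually (\<lambda>n. 1 / real (Suc n) < cmod \<mu>) sequentially" if "\<mu> \<in> X" for \<mu>
          using order_tendstoD(2)[OF LIMSEQ_Suc[OF lim_1_over_n], of "cmod \<mu>"] X that by auto
        then have "eventually (\<lambda>n. \<forall>\<mu>\<in>X. 1 / real (Suc n) < cmod \<mu>) sequentially"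
          using X by (simp add: eventually_ball_finite)
        then show "eventually (\<lambda>n. finite (large_eigenvalues (real (Suc n))) \<and> X \<subseteq> large_eigenvalues (real (Suc n)) \<and>
          large_eigenvalues (real (Suc n)) \<subseteq> ?E) sequentially"
        proof eventually_elim
          case (elim n)
          have "0 \<notin> large_eigenvalues (real (Suc n))" by (simp add: large_eigenvalues_def not_le)
          then show ?case using elim X finite_large_eigenvalues'[of "real (Suc n)"]
            by (auto simp: large_eigenvalues_def less_imp_le)
        qed
      qed
    qed
    moreover have "(\<lambda>n. \<Sum>\<mu>\<in>large_eigenvalues (real (Suc n)). ?g \<mu>) \<longlonglongrightarrow> (\<Sum>k. yd k (yv k))"
    proof -
      have "(\<lambda>n. (\<Sum>k. yd k (yv k)) - (\<Sum>\<mu>\<in>large_eigenvalues (real (Suc n)). ?g \<mu>)) \<longlonglongrightarrow> 0"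
        by (rule Lim_null_comparison[OF always_eventually[OF allI[OF trace_estimate]] growth_limit]) simp
      from tendsto_diff[OF tendsto_const[of "\<Sum>k. yd k (yv k)"] this] show ?thesis by simp
    qed
    ultimately show ?thesis by (rule LIMSEQ_unique)
  qed
  then show ?thesis using S by simp
qed

end

section \<open>Trace bounds from the geometry of $L_p$\<close>

text \<open>Optimisation at \<open>t = sqrt B / sqrt A\<close>; if \<open>A\<close> or
  \<open>B\<close> vanishes, a large or a small \<open>t\<close> shows that \<open>S\<close> is not
  positive. It turns a pointwise AM-GM with a free parameter into a Cauchy--Schwarz bound.\<close>

lemma le_sqrt_mult_sqrt:
  fixes S A B :: real
  assumes "0 \<le> A" "0 \<le> B" and le: "\<And>t. 0 < t \<Longrightarrow> 2 * S \<le> t * A + B / t"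
  shows "S \<le> sqrt A * sqrt B"
proof (cases "A = 0 \<or> B = 0")
  case False
  then have pos: "0 < A" "0 < B" using assms by auto
  have "2 * S \<le> (sqrt B / sqrt A) * A + B / (sqrt B / sqrt A)" using pos by (intro le) simp
  also have "(sqrt B / sqrt A) * A = sqrt A * sqrt B"
    using pos by (metis mult.commute times_divide_eq_right real_div_sqrt less_imp_le mult.left_commute times_divide_eq_left)
  also have "B / (sqrt B / sqrt A) = sqrt A * sqrt B"
    using pos by (simp add: real_div_sqrt less_imp_le field_simps) 
  finally show ?thesis by simp
next
  case True
  have "S \<le> 0"
  proof (rule ccontr)
    assume "\<not> S \<le> 0"
    then have S: "0 < S" by simp
    show False
    proof (cases "A = 0")
      case True
      have "2 * S \<le> B / ((B + 1) / S)" using le[of "(B + 1) / S"] True assms(2) S by simp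
      also have "\<dots> \<le> S" using assms(2) S by (simp add: field_simps)
      finally show False using S by simp
    next
      case False
      then have B: "B = 0" using True by simp
      have "2 * S \<le> S / A * A" using le[of "S / A"] B False assms(1) S by simp
      then show False using S False by simp
    qed
  qed
  then show ?thesis using True by auto
qed

lemma bessel_family_cnj:
  assumes "bessel_family n r q"
  shows "(\<Sum>i<r. (cmod (\<Sum>j<n. q i j * c j))\<^sup>2) \<le> (\<Sum>j<n. (cmod (c j))\<^sup>2)"
proof -
  have "cmod (\<Sum>j<n. q i j * c j) = cmod (\<Sum>j<n. cnj (q i j) * cnj (c j))" for i
  proof -
    have "(\<Sum>j<n. cnj (q i j) * cnj (c j)) = cnj (\<Sum>j<n. q i j * c j)" by simp
    then show ?thesis by (simp only: complex_mod_cnj)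
  qed
  then show ?thesis using assms[unfolded bessel_family_def, rule_format, of "\<lambda>j. cnj (c j)"] by simp
qed

lemma integrable_mult_of_square:
  fixes f g :: "'m \<Rightarrow> complex"
  assumes [measurable]: "f \<in> borel_measurable M" "g \<in> borel_measurable M"
    and "integrable M (\<lambda>x. (cmod (f x))\<^sup>2)" "integrable M (\<lambda>x. (cmod (g x))\<^sup>2)"
  shows "integrable M (\<lambda>x. f x * g x)"
proof (rule Bochner_Integration.integrable_bound[OF Bochner_Integration.integrable_add[OF assms(3,4)]])
  show "AE x in M. norm (f x * g x) \<le> norm ((cmod (f x))\<^sup>2 + (cmod (g x))\<^sup>2)"
  proof (rule AE_I2)
    fix x
    have "2 * (cmod (f x) * cmod (g x)) \<le> (cmod (f x))\<^sup>2 + (cmod (g x))\<^sup>2"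
      using sum_squares_bound[of "cmod (f x)" "cmod (g x)"] by simp
    moreover have "0 \<le> cmod (f x) * cmod (g x)" by simp
    ultimately have "cmod (f x) * cmod (g x) \<le> (cmod (f x))\<^sup>2 + (cmod (g x))\<^sup>2" by linarith
    then show "norm (f x * g x) \<le> norm ((cmod (f x))\<^sup>2 + (cmod (g x))\<^sup>2)" by (simp add: norm_mult)
  qed
qed simp

text \<open>Bounds norms in \<open>L_2(\<kappa>)\<close>. The pairing that goes with it is the
  integral of \<open>v j x * w k x\<close>, bilinear and without conjugation, so one predicate
  serves rows and columns.\<close>

definition gram_factor :: "'m measure \<Rightarrow> nat \<Rightarrow> (nat \<Rightarrow> 'm \<Rightarrow> complex) \<Rightarrow> (nat \<Rightarrow> real) \<Rightarrow> bool" where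
  "gram_factor \<kappa> n v \<alpha> \<longleftrightarrow> (\<forall>j<n. v j \<in> borel_measurable \<kappa> \<and> integrable \<kappa> (\<lambda>x. (cmod (v j x))\<^sup>2) \<and>
     (\<integral>x. (cmod (v j x))\<^sup>2 \<partial>\<kappa>) \<le> (\<alpha> j)\<^sup>2)"

text \<open>The trace norm is at most a product of two Hilbert--Schmidt norms. The
  \<open>i\<close>-th sum is the integral of \<open>V i x * W i x\<close>; after AM-GM with
  parameter \<open>t\<close>, contractivity of \<open>q\<close> is applied at each point
  \<open>x\<close>, which removes \<open>q\<close> and \<open>r\<close> before integration.\<close>

lemma gram_trace_bound:
  assumes v: "gram_factor \<kappa> n v \<alpha>" and w: "gram_factor \<kappa> n w \<beta>" and q: "bessel_family n r q"
  shows "(\<Sum>i<r. cmod (\<Sum>j<n. \<Sum>k<n. cnj (q i j) *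
      (complex_of_real (a j) * (\<integral>x. v j x * w k x \<partial>\<kappa>) * complex_of_real (b k)) * q i k))
    \<le> sqrt (\<Sum>j<n. (a j * \<alpha> j)\<^sup>2) * sqrt (\<Sum>k<n. (b k * \<beta> k)\<^sup>2)"
proof -
  have vm: "v j \<in> borel_measurable \<kappa>" "integrable \<kappa> (\<lambda>x. (cmod (v j x))\<^sup>2)" "(\<integral>x. (cmod (v j x))\<^sup>2 \<partial>\<kappa>) \<le> (\<alpha> j)\<^sup>2"
    and wm: "w j \<in> borel_measurable \<kappa>" "integrable \<kappa> (\<lambda>x. (cmod (w j x))\<^sup>2)" "(\<integral>x. (cmod (w j x))\<^sup>2 \<partial>\<kappa>) \<le> (\<beta> j)\<^sup>2"
    if "j < n" for j using v w that by (auto simp: gram_factor_def)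
  have vw: "integrable \<kappa> (\<lambda>x. v j x * w k x)" if "j < n" "k < n" for j k
    using that by (intro integrable_mult_of_square vm wm)
  define V where "V i x = (\<Sum>j<n. cnj (q i j) * (complex_of_real (a j) * v j x))" for i x
  define W where "W i x = (\<Sum>k<n. q i k * (complex_of_real (b k) * w k x))" for i x
  define A where "A = (\<Sum>j<n. (a j * \<alpha> j)\<^sup>2)"
  define B where "B = (\<Sum>k<n. (b k * \<beta> k)\<^sup>2)"
  have VW_eq: "V i x * W i x = (\<Sum>j<n. \<Sum>k<n. cnj (q i j) * complex_of_real (a j) * complex_of_real (b k) * q i k * (v j x * w k x))" for i x
    unfolding V_def W_def sum_product by (intro sum.cong refl) (simp add: mult_ac)
  have VW_int: "integrable \<kappa> (\<lambda>x. V i x * W i x)" for i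
    unfolding VW_eq using vw by (intro Bochner_Integration.integrable_sum integrable_mult_right) auto
  have S_eq: "(\<Sum>j<n. \<Sum>k<n. cnj (q i j) * (complex_of_real (a j) * (\<integral>x. v j x * w k x \<partial>\<kappa>) * complex_of_real (b k)) * q i k)
      = (\<integral>x. V i x * W i x \<partial>\<kappa>)" for i
  proof -
    have "(\<integral>x. V i x * W i x \<partial>\<kappa>) = (\<Sum>j<n. \<Sum>k<n. \<integral>x. cnj (q i j) * complex_of_real (a j) * complex_of_real (b k) * q i k * (v j x * w k x) \<partial>\<kappa>)"
      unfolding VW_eq using vw
      by (subst Bochner_Integration.integral_sum, force intro!: Bochner_Integration.integrable_sum integrable_mult_right,
          intro sum.cong refl, subst Bochner_Integration.integral_sum) (auto intro!: integrable_mult_right)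
    also have "\<dots> = (\<Sum>j<n. \<Sum>k<n. cnj (q i j) * (complex_of_real (a j) * (\<integral>x. v j x * w k x \<partial>\<kappa>) * complex_of_real (b k)) * q i k)"
      by (intro sum.cong refl, subst integral_mult_right_zero) (simp only: mult_ac)
    finally show ?thesis by simp
  qed
  have "(\<Sum>i<r. cmod (\<integral>x. V i x * W i x \<partial>\<kappa>)) \<le> sqrt A * sqrt B"
  proof (rule le_sqrt_mult_sqrt)
    show "0 \<le> A" "0 \<le> B" unfolding A_def B_def by (auto intro: sum_nonneg)
    fix t :: real assume t: "0 < t"
    let ?h = "\<lambda>x. t * (\<Sum>j<n. (a j)\<^sup>2 * (cmod (v j x))\<^sup>2) + (\<Sum>k<n. (b k)\<^sup>2 * (cmod (w k x))\<^sup>2) / t"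
    have hi: "integrable \<kappa> (\<lambda>x. \<Sum>j<n. (a j)\<^sup>2 * (cmod (v j x))\<^sup>2)" "integrable \<kappa> (\<lambda>x. \<Sum>k<n. (b k)\<^sup>2 * (cmod (w k x))\<^sup>2)"
      using vm wm by (auto intro!: Bochner_Integration.integrable_sum integrable_mult_right)
    have "2 * (\<Sum>i<r. cmod (\<integral>x. V i x * W i x \<partial>\<kappa>)) \<le> 2 * (\<Sum>i<r. \<integral>x. cmod (V i x * W i x) \<partial>\<kappa>)"
      by (intro mult_left_mono sum_mono integral_norm_bound) auto
    also have "\<dots> = (\<integral>x. 2 * (\<Sum>i<r. cmod (V i x * W i x)) \<partial>\<kappa>)"
      using VW_int by (simp add: Bochner_Integration.integral_sum integrable_norm)
    also have "\<dots> \<le> (\<integral>x. ?h x \<partial>\<kappa>)"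
    proof (rule integral_mono)
      show "integrable \<kappa> (\<lambda>x. 2 * (\<Sum>i<r. cmod (V i x * W i x)))"
        using VW_int by (intro integrable_mult_right Bochner_Integration.integrable_sum integrable_norm)
      show "integrable \<kappa> ?h" using hi by (intro Bochner_Integration.integrable_add integrable_mult_right integrable_divide_zero) auto
      fix x
      have "2 * (\<Sum>i<r. cmod (V i x * W i x)) \<le> (\<Sum>i<r. t * (cmod (V i x))\<^sup>2 + (cmod (W i x))\<^sup>2 / t)"
        unfolding sum_distrib_left
      proof (rule sum_mono)
        fix i
        have "0 \<le> (t * cmod (V i x) - cmod (W i x))\<^sup>2 / t" using t by simp
        also have "\<dots> = t * (cmod (V i x))\<^sup>2 + (cmod (W i x))\<^sup>2 / t - 2 * cmod (V i x * W i x)"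
          using t by (simp add: power2_diff norm_mult field_simps power2_eq_square)
        finally show "2 * cmod (V i x * W i x) \<le> t * (cmod (V i x))\<^sup>2 + (cmod (W i x))\<^sup>2 / t" by simp
      qed
      also have "\<dots> = t * (\<Sum>i<r. (cmod (V i x))\<^sup>2) + (\<Sum>i<r. (cmod (W i x))\<^sup>2) / t"
        by (simp add: sum.distrib sum_distrib_left sum_divide_distrib)
      also have "\<dots> \<le> t * (\<Sum>j<n. (cmod (complex_of_real (a j) * v j x))\<^sup>2) + (\<Sum>k<n. (cmod (complex_of_real (b k) * w k x))\<^sup>2) / t"
        unfolding V_def W_def using t q bessel_family_cnj[OF q]
        by (intro add_mono mult_left_mono divide_right_mono) (auto simp: bessel_family_def)
      finally show "2 * (\<Sum>i<r. cmod (V i x * W i x)) \<le> ?h x"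
        by (simp add: norm_mult power_mult_distrib)
    qed
    also have "\<dots> = t * (\<Sum>j<n. (a j)\<^sup>2 * (\<integral>x. (cmod (v j x))\<^sup>2 \<partial>\<kappa>)) + (\<Sum>k<n. (b k)\<^sup>2 * (\<integral>x. (cmod (w k x))\<^sup>2 \<partial>\<kappa>)) / t"
      using hi vm wm by (simp add: Bochner_Integration.integral_sum)
    also have "\<dots> \<le> t * A + B / t"
      unfolding A_def B_def power_mult_distrib using t vm wm
      by (intro add_mono mult_left_mono divide_right_mono sum_mono) auto
    finally show "2 * (\<Sum>i<r. cmod (\<integral>x. V i x * W i x \<partial>\<kappa>)) \<le> t * A + B / t" .
  qed
  then show ?thesis unfolding S_eq A_def B_def .
qed

text \<open>For fixed \<open>n\<close>, \<open>r\<close>, \<open>q\<close>, \<open>a\<close> and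
  \<open>b\<close> the inequality is a closed condition on finitely many entries. So approximate
  Gram representations suffice, and their measure may vary with \<open>n\<close> and
  \<open>e\<close>.\<close>

lemma trace_bound_approx:
  assumes ap: "\<And>n e. 0 < e \<Longrightarrow> \<exists>(\<kappa>::'m measure) v w. gram_factor \<kappa> n v \<alpha> \<and> gram_factor \<kappa> n w \<beta> \<and>
    (\<forall>j<n. \<forall>k<n. cmod (m j k - (\<integral>x. v j x * w k x \<partial>\<kappa>)) \<le> e)"
  shows "trace_bound m \<alpha> \<beta>"
  unfolding trace_bound_def
proof (intro allI impI)
  fix n r q and a b :: "nat \<Rightarrow> real" assume q: "bessel_family n r q"
  define S where "S m' i = (\<Sum>j<n. \<Sum>k<n. cnj (q i j) * (complex_of_real (a j) * m' j k * complex_of_real (b k)) * q i k)" for m' i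
  define Cst where "Cst = (\<Sum>i<r. \<Sum>j<n. \<Sum>k<n. cmod (q i j) * \<bar>a j\<bar> * \<bar>b k\<bar> * cmod (q i k))"
  have C0: "0 \<le> Cst" unfolding Cst_def by (intro sum_nonneg) auto
  let ?R = "sqrt (\<Sum>j<n. (a j * \<alpha> j)\<^sup>2) * sqrt (\<Sum>k<n. (b k * \<beta> k)\<^sup>2)"
  have "(\<Sum>i<r. cmod (S m i)) \<le> ?R + e" if e: "0 < e" for e
  proof -
    define e' where "e' = e / (Cst + 1)"
    have e': "0 < e'" using e C0 by (simp add: e'_def)
    obtain \<kappa> :: "'m measure" and v w where vw: "gram_factor \<kappa> n v \<alpha>" "gram_factor \<kappa> n w \<beta>"
      "\<And>j k. j < n \<Longrightarrow> k < n \<Longrightarrow> cmod (m j k - (\<integral>x. v j x * w k x \<partial>\<kappa>)) \<le> e'"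
      using ap[OF e', of n] by blast
    define m' where "m' j k = (\<integral>x. v j x * w k x \<partial>\<kappa>)" for j k
    have "cmod (S m i) \<le> cmod (S m' i) + e' * (\<Sum>j<n. \<Sum>k<n. cmod (q i j) * \<bar>a j\<bar> * \<bar>b k\<bar> * cmod (q i k))" for i
    proof -
      have "S m i - S m' i = (\<Sum>j<n. \<Sum>k<n. cnj (q i j) * (complex_of_real (a j) * (m j k - m' j k) * complex_of_real (b k)) * q i k)"
        by (simp add: S_def sum_subtractf algebra_simps)
      also have "cmod \<dots> \<le> (\<Sum>j<n. \<Sum>k<n. e' * (cmod (q i j) * \<bar>a j\<bar> * \<bar>b k\<bar> * cmod (q i k)))"
      proof (intro sum_norm_le)
        fix j k assume "j \<in> {..<n}" "k \<in> {..<n}"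
        then have "cmod (m j k - m' j k) \<le> e'" using vw(3) by (simp add: m'_def)
        then have "cmod (m j k - m' j k) * (cmod (q i j) * \<bar>a j\<bar> * \<bar>b k\<bar> * cmod (q i k)) \<le> e' * (cmod (q i j) * \<bar>a j\<bar> * \<bar>b k\<bar> * cmod (q i k))"
          by (intro mult_right_mono) auto
        then show "cmod (cnj (q i j) * (complex_of_real (a j) * (m j k - m' j k) * complex_of_real (b k)) * q i k)
           \<le> e' * (cmod (q i j) * \<bar>a j\<bar> * \<bar>b k\<bar> * cmod (q i k))"
          by (simp add: norm_mult mult_ac)
      qed
      finally show ?thesis using norm_triangle_sub[of "S m i" "S m' i"] by (simp add: sum_distrib_left)
    qed
    then have "(\<Sum>i<r. cmod (S m i)) \<le> (\<Sum>i<r. cmod (S m' i) + e' * (\<Sum>j<n. \<Sum>k<n. cmod (q i j) * \<bar>a j\<bar> * \<bar>b k\<bar> * cmod (q i k)))"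
      by (intro sum_mono)
    also have "\<dots> = (\<Sum>i<r. cmod (S m' i)) + e' * Cst"
      by (simp add: sum.distrib Cst_def sum_distrib_left)
    also have "\<dots> \<le> ?R + e"
    proof (rule add_mono)
      show "(\<Sum>i<r. cmod (S m' i)) \<le> ?R" unfolding S_def m'_def by (rule gram_trace_bound[OF vw(1,2) q])
      have "e' * Cst \<le> e' * (Cst + 1)" using e' by (intro mult_left_mono) auto
      then show "e' * Cst \<le> e" using C0 by (simp add: e'_def)
    qed
    finally show ?thesis .
  qed
  then show "(\<Sum>i<r. cmod (\<Sum>j<n. \<Sum>k<n. cnj (q i j) * (complex_of_real (a j) * m j k * complex_of_real (b k)) * q i k)) \<le> ?R"
    unfolding S_def by (rule field_le_epsilon)
qed

section \<open>The duality map of \<open>L_r\<close> and approximate representation of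
  functionals\<close>

lemma powr_tangent:
  fixes x y r :: real
  assumes "1 < r" "0 \<le> x" "0 \<le> y"
  shows "y powr r + r * y powr (r - 1) * (x - y) \<le> x powr r"
proof (cases "y = 0")
  case False
  then have y: "0 < y" using assms by simp
  have "x * y powr (r - 1) \<le> x powr r / r + (y powr (r - 1)) powr (r / (r - 1)) / (r / (r - 1))"
    using assms by (intro Youngs_inequality) (auto simp: field_simps)
  also have "(y powr (r - 1)) powr (r / (r - 1)) = y powr r" using assms by (simp add: powr_powr)
  finally have "r * (x * y powr (r - 1)) \<le> r * (x powr r / r + y powr r / (r / (r - 1)))"
    using assms by (intro mult_left_mono) auto
  also have "\<dots> = x powr r + (r - 1) * y powr r" using assms by (simp add: field_simps)
  finally have "r * (x * y powr (r - 1)) \<le> x powr r + (r - 1) * y powr r" .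
  moreover have "y powr (r - 1) * y = y powr r" using y by (simp add: powr_diff)
  ultimately show ?thesis by (simp add: algebra_simps)
qed (use assms in simp)

text \<open>Encodes the gradient of \<open>cmod h powr r / r\<close>: the derivative in direction
  \<open>b\<close> is \<open>Re (duality_map r h * b)\<close>. Applied to an \<open>L_r\<close>
  function it yields a function in the dual exponent.\<close>

definition duality_map :: "real \<Rightarrow> complex \<Rightarrow> complex" where
  "duality_map r h = complex_of_real (cmod h powr (r - 2)) * cnj h"

lemma duality_map_measurable [measurable]:
  assumes [measurable]: "f \<in> borel_measurable M"
  shows "(\<lambda>x. duality_map r (f x)) \<in> borel_measurable M"
proof -
  have [measurable]: "(\<lambda>x. cnj (f x)) \<in> borel_measurable M"
    by (rule borel_measurable_continuous_on[of cnj]) (auto intro: continuous_intros)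
  show ?thesis unfolding duality_map_def by measurable
qed

lemma cmod_duality_map: "r \<noteq> 1 \<Longrightarrow> cmod (duality_map r h) = cmod h powr (r - 1)"
proof (cases "h = 0")
  case False
  then have "cmod h powr (r - 1) = cmod h powr (r - 2) * cmod h"
    using powr_add[of "cmod h" "r - 2" 1] by simp
  then show ?thesis by (simp add: duality_map_def norm_mult)
qed (simp add: duality_map_def)

text \<open>The tangent is taken at the end point \<open>a + b\<close>, so convexity bounds the
  increment from above. The price is a duality map at the moved point, brought back later by
  \<open>duality_map_lipschitz\<close>.\<close>

lemma norm_powr_tangent:
  assumes r: "1 < r"
  shows "cmod (a + b) powr r \<le> cmod a powr r + r * Re (duality_map r (a + b) * b)"
proof (cases "a + b = 0")
  case True
  then show ?thesis using r by (simp add: duality_map_def)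
next
  case False
  define h where "h = a + b"
  have h: "0 < cmod h" using False by (simp add: h_def)
  have a: "a = h - b" by (simp add: h_def)
  have "Re (cnj h * a) \<le> cmod h * cmod a" using complex_Re_le_cmod[of "cnj h * a"] by (simp add: norm_mult)
  moreover have "Re (cnj h * a) = (cmod h)\<^sup>2 - Re (cnj h * b)"
  proof -
    have "cnj h * a = cnj h * h - cnj h * b" unfolding a by (rule right_diff_distrib)
    moreover have "Re (cnj h * h) = (cmod h)\<^sup>2" unfolding cmod_power2 by (simp add: power2_eq_square)
    ultimately show ?thesis by (simp only: minus_complex.simps)
  qed
  ultimately have 1: "(cmod h)\<^sup>2 - Re (cnj h * b) \<le> cmod h * cmod a" by simp
  have "cmod h powr r + r * cmod h powr (r - 1) * (cmod a - cmod h) \<le> cmod a powr r"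
    using r by (intro powr_tangent) auto
  moreover have "cmod h powr (r - 1) * (cmod a - cmod h) \<ge> - (cmod h powr (r - 2) * Re (cnj h * b))"
  proof -
    have "cmod h powr (r - 1) * (cmod a - cmod h) = cmod h powr (r - 2) * (cmod h * cmod a - (cmod h)\<^sup>2)"
    proof -
      have "cmod h powr (r - 1) = cmod h powr (r - 2) * cmod h"
        using h powr_add[of "cmod h" "r - 2" 1] by simp
      then show ?thesis by (simp add: algebra_simps power2_eq_square)
    qed
    also have "\<dots> \<ge> cmod h powr (r - 2) * (- Re (cnj h * b))" using 1 by (intro mult_left_mono) auto
    finally show ?thesis by (simp only: mult_minus_right)
  qed
  then have "r * (cmod h powr (r - 1) * (cmod a - cmod h)) \<ge> r * (- (cmod h powr (r - 2) * Re (cnj h * b)))"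
    using r by (intro mult_left_mono) auto
  moreover have "Re (duality_map r h * b) = cmod h powr (r - 2) * Re (cnj h * b)"
    by (simp add: duality_map_def mult.assoc)
  ultimately show ?thesis unfolding h_def[symmetric] by (simp add: mult.assoc)
qed

text \<open>Follows from \<open>1 + u \<le> exp u\<close> and \<open>ln u \<le> u - 1\<close>. The
  extra factor \<open>y\<close> makes the bound hold also for \<open>q < 1\<close>, where
  \<open>x powr q\<close> is not Lipschitz near 0.\<close>

lemma powr_diff_bound:
  fixes x y q :: real
  assumes "0 \<le> q" "0 \<le> y" "y \<le> x"
  shows "(x powr q - y powr q) * y \<le> q * x powr q * (x - y)"
proof (cases "y = 0")
  case False
  then have y: "0 < y" and x: "0 < x" using assms by auto
  have "ln (x / y) \<le> x / y - 1" using x y by (intro ln_le_minus_one) simp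
  then have "q * (- (x / y - 1)) \<le> q * ln (y / x)" using assms x y by (intro mult_left_mono) (auto simp: ln_div)
  also have "1 + q * ln (y / x) \<le> exp (q * ln (y / x))" by (rule exp_ge_add_one_self)
  finally have "1 - q * (x / y - 1) \<le> (y / x) powr q" using x y by (simp add: powr_def algebra_simps)
  then have "x powr q * (1 - q * (x / y - 1)) \<le> x powr q * (y / x) powr q" by (intro mult_left_mono) auto
  also have "\<dots> = y powr q" using x by (simp add: powr_divide)
  finally have "x powr q - y powr q \<le> x powr q * (q * (x / y - 1))" by (simp add: algebra_simps)
  then have "(x powr q - y powr q) * y \<le> x powr q * (q * (x / y - 1)) * y" using y by (intro mult_right_mono) auto
  also have "\<dots> = q * x powr q * (x - y)" using y by (simp add: field_simps)
  finally show ?thesis .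
qed (use assms in simp)

text \<open>With \<open>x\<close> the larger and \<open>y\<close> the smaller modulus, the
  difference splits into \<open>x powr q\<close> times \<open>cnj (u - v)\<close> and
  \<open>x powr q - y powr q\<close> times \<open>cnj v\<close>; the second summand is the case of
  \<open>powr_diff_bound\<close>.\<close>

lemma duality_map_lipschitz:
  assumes r: "2 \<le> r"
  shows "cmod (duality_map r u - duality_map r v) \<le> r * (cmod u + cmod v) powr (r - 2) * cmod (u - v)"
proof -
  have main: "cmod (duality_map r u - duality_map r v) \<le> r * (cmod u + cmod v) powr (r - 2) * cmod (u - v)"
    if vu: "cmod v \<le> cmod u" for u v
  proof -
    define x where "x = cmod u"
    define y where "y = cmod v"
    define q where "q = r - 2"
    have q: "0 \<le> q" and xy: "0 \<le> y" "y \<le> x" using r vu by (auto simp: q_def x_def y_def)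
    have "duality_map r u - duality_map r v = complex_of_real (x powr q) * cnj (u - v) + complex_of_real (x powr q - y powr q) * cnj v"
      by (simp add: duality_map_def x_def y_def q_def algebra_simps)
    also have "cmod \<dots> \<le> x powr q * cmod (u - v) + (x powr q - y powr q) * y"
    proof (rule order.trans[OF norm_triangle_ineq])
      have "cmod (complex_of_real (x powr q - y powr q) * cnj v) = \<bar>x powr q - y powr q\<bar> * y"
        by (simp only: norm_mult norm_of_real complex_mod_cnj y_def)
      also have "\<bar>x powr q - y powr q\<bar> = x powr q - y powr q" using powr_mono2[OF q xy] by simp
      finally show "cmod (complex_of_real (x powr q) * cnj (u - v)) + cmod (complex_of_real (x powr q - y powr q) * cnj v)
        \<le> x powr q * cmod (u - v) + (x powr q - y powr q) * y"
        by (simp add: norm_mult del: complex_cnj_diff)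
    qed
    also have "\<dots> \<le> x powr q * cmod (u - v) + q * x powr q * (x - y)"
      using powr_diff_bound[OF q xy] by simp
    also have "\<dots> \<le> x powr q * cmod (u - v) + q * x powr q * cmod (u - v)"
      using q norm_triangle_ineq2[of u v] by (intro add_left_mono mult_left_mono) (auto simp: x_def y_def)
    also have "\<dots> = (1 + q) * (x powr q * cmod (u - v))" by (simp add: algebra_simps)
    also have "\<dots> \<le> r * ((cmod u + cmod v) powr (r - 2) * cmod (u - v))"
      using q r by (intro mult_mono mult_right_mono) (auto simp: q_def x_def intro!: powr_mono2)
    finally show ?thesis by (simp add: mult.assoc)
  qed
  show ?thesis using main[of v u] main[of u v]
    by (cases "cmod v \<le> cmod u") (simp_all add: norm_minus_commute add.commute)
qed

lemma add_powr_le: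
  fixes x y r :: real
  assumes "0 \<le> x" "0 \<le> y" "0 \<le> r"
  shows "(x + y) powr r \<le> 2 powr r * (x powr r + y powr r)"
proof -
  have "(x + y) powr r \<le> (2 * max x y) powr r" using assms by (intro powr_mono2) auto
  also have "\<dots> = 2 powr r * (max x y) powr r" by (rule powr_mult)
  also have "(max x y) powr r \<le> x powr r + y powr r" by (simp add: max_def)
  then have "2 powr r * (max x y) powr r \<le> 2 powr r * (x powr r + y powr r)" by (intro mult_left_mono) auto
  finally show ?thesis .
qed

lemma integrable_powr_bound:
  fixes f :: "'m \<Rightarrow> complex"
  assumes "integrable M h" "f \<in> borel_measurable M" "\<And>x. cmod (f x) powr r \<le> h x"
  shows "integrable M (\<lambda>x. cmod (f x) powr r)"
proof (rule Bochner_Integration.integrable_bound[OF assms(1)])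
  show "(\<lambda>x. cmod (f x) powr r) \<in> borel_measurable M" using assms(2) by measurable
  show "AE x in M. norm (cmod (f x) powr r) \<le> norm (h x)"
    using assms(3) by (intro AE_I2) (metis abs_ge_self abs_of_nonneg order.trans powr_ge_zero real_norm_def)
qed

lemma integrable_powr_linear_comb:
  fixes g :: "nat \<Rightarrow> 'm \<Rightarrow> complex"
  assumes r: "0 < r" and g: "\<And>k. k < n \<Longrightarrow> g k \<in> borel_measurable M" "\<And>k. k < n \<Longrightarrow> integrable M (\<lambda>x. cmod (g k x) powr r)"
  shows "integrable M (\<lambda>x. cmod (\<Sum>k<n. c k * g k x) powr r)"
  using g
proof (induction n)
  case 0
  then show ?case using r by simp
next
  case (Suc n)
  show ?case
  proof (rule integrable_powr_bound)
    show "integrable M (\<lambda>x. 2 powr r * (cmod (\<Sum>k<n. c k * g k x) powr r + cmod (c n) powr r * cmod (g n x) powr r))"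
      using Suc by (intro integrable_mult_right Bochner_Integration.integrable_add) auto
    show "(\<lambda>x. \<Sum>k<Suc n. c k * g k x) \<in> borel_measurable M" using Suc.prems(1) by (intro borel_measurable_sum borel_measurable_times) auto
    show "cmod (\<Sum>k<Suc n. c k * g k x) powr r \<le> 2 powr r * (cmod (\<Sum>k<n. c k * g k x) powr r + cmod (c n) powr r * cmod (g n x) powr r)" for x
    proof -
      have "cmod (\<Sum>k<Suc n. c k * g k x) powr r \<le> (cmod (\<Sum>k<n. c k * g k x) + cmod (c n) * cmod (g n x)) powr r"
        using r norm_triangle_ineq[of "\<Sum>k<n. c k * g k x" "c n * g n x"] by (intro powr_mono2) (auto simp: norm_mult)
      also have "\<dots> \<le> 2 powr r * (cmod (\<Sum>k<n. c k * g k x) powr r + (cmod (c n) * cmod (g n x)) powr r)"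
        using r by (intro add_powr_le) auto
      finally show ?thesis by (simp add: powr_mult)
    qed
  qed
qed

text \<open>Bounds every \<open>I \<ge> 0\<close> with
  \<open>I / r \<le> C * I powr (1 / r) + 1\<close>: for \<open>N = I powr (1 / r)\<close> at least
  1 this forces \<open>N powr (r - 1) \<le> r * (C + 1)\<close>. The leading 1 covers
  \<open>I \<le> 1\<close>.\<close>

definition duality_bound :: "real \<Rightarrow> real \<Rightarrow> real" where
  "duality_bound r C = (1 + r * (C + 1)) powr (r / (r - 1))"

lemma duality_bound_ge_1: "2 \<le> r \<Longrightarrow> 0 \<le> C \<Longrightarrow> 1 \<le> duality_bound r C"
  unfolding duality_bound_def by (intro ge_one_powr_ge_zero) auto

lemma duality_bound:
  assumes r: "2 \<le> r" and C: "0 \<le> C" and I: "0 \<le> I" and le: "I / r - C * I powr (1 / r) \<le> 1"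
  shows "I \<le> duality_bound r C"
proof (cases "I \<le> 1")
  case True
  then show ?thesis using duality_bound_ge_1[OF r C] by simp
next
  case False
  define N where "N = I powr (1 / r)"
  have N1: "1 \<le> N" unfolding N_def using False r by (intro ge_one_powr_ge_zero) auto
  have IN: "I = N powr r" using I r by (simp add: N_def powr_powr)
  have "I / r \<le> C * N + 1" using le by (simp add: N_def)
  then have "I \<le> r * (C * N + 1)" using r by (simp add: field_simps)
  then have "N powr r \<le> r * (C * N + 1)" by (simp only: IN[symmetric])
  also have "\<dots> \<le> r * ((C + 1) * N)" using r N1 by (intro mult_left_mono) (auto simp: algebra_simps)
  finally have "N powr r \<le> (r * (C + 1)) * N" by simp
  then have "N powr (r - 1) \<le> r * (C + 1)" using N1 by (simp add: powr_diff field_simps)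
  then have "N powr (r - 1) \<le> 1 + r * (C + 1)" by simp
  then have "(N powr (r - 1)) powr (r / (r - 1)) \<le> (1 + r * (C + 1)) powr (r / (r - 1))"
    using r by (intro powr_mono2) auto
  then show ?thesis using r by (simp add: IN duality_bound_def powr_powr)
qed

text \<open>Approximate representation of a functional on a finite-dimensional subspace of $L_r$ by an
  $L_{r'}$ function: take a near-minimiser of $\|G\|_r^r/r - \mathrm{Re}\,\phi$ up to $t^2$ and
  vary it in direction $t\,g_k$. No Hahn-Banach theorem, completeness or $\sigma$-finiteness is used.\<close>

lemma approx_duality:
  fixes \<kappa> :: "'m measure" and g :: "nat \<Rightarrow> 'm \<Rightarrow> complex" and \<phi> :: "nat \<Rightarrow> complex"
  assumes r: "2 \<le> r" and C: "0 \<le> C" and e: "0 < e"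
    and g: "\<And>k. k < n \<Longrightarrow> g k \<in> borel_measurable \<kappa>" "\<And>k. k < n \<Longrightarrow> integrable \<kappa> (\<lambda>x. cmod (g k x) powr r)"
    and \<phi>: "\<And>c. cmod (\<Sum>k<n. c k * \<phi> k) \<le> C * (\<integral>x. cmod (\<Sum>k<n. c k * g k x) powr r \<partial>\<kappa>) powr (1 / r)"
  shows "\<exists>f. f \<in> borel_measurable \<kappa> \<and> integrable \<kappa> (\<lambda>x. cmod (f x) powr (r / (r - 1))) \<and>
    (\<integral>x. cmod (f x) powr (r / (r - 1)) \<partial>\<kappa>) \<le> duality_bound r C \<and>
    (\<forall>k<n. cmod (\<phi> k - (\<integral>x. f x * g k x \<partial>\<kappa>)) \<le> e)"
proof -
  define G where "G c x = (\<Sum>k<n. c k * g k x)" for c x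
  define I where "I c = (\<integral>x. cmod (G c x) powr r \<partial>\<kappa>)" for c
  define \<Phi> where "\<Phi> c = I c / r - Re (\<Sum>k<n. c k * \<phi> k)" for c
  have Gm [measurable]: "G c \<in> borel_measurable \<kappa>" for c unfolding G_def using g(1) by measurable
  have Gi: "integrable \<kappa> (\<lambda>x. cmod (G c x) powr r)" for c
    unfolding G_def using r g by (intro integrable_powr_linear_comb) auto
  have I0: "0 \<le> I c" for c unfolding I_def by (intro Bochner_Integration.integral_nonneg) auto
  have lower: "I c / r - C * I c powr (1 / r) \<le> \<Phi> c" for c
    using \<phi>[of c] complex_Re_le_cmod[of "\<Sum>k<n. c k * \<phi> k"] by (simp add: \<Phi>_def I_def G_def)
  have bdd: "bdd_below (range \<Phi>)"
  proof (rule bdd_belowI2)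
    fix c
    show "min 0 (- C * (duality_bound r C) powr (1 / r)) \<le> \<Phi> c"
    proof (cases "I c / r - C * I c powr (1 / r) \<le> 1")
      case True
      then have "I c \<le> duality_bound r C" by (intro duality_bound r C I0)
      then have "C * I c powr (1 / r) \<le> C * (duality_bound r C) powr (1 / r)"
        using C I0 r by (intro mult_left_mono powr_mono2) auto
      moreover have "0 \<le> I c / r" using I0 r by simp
      ultimately show ?thesis using lower[of c] by linarith
    next
      case False
      then show ?thesis using lower[of c] by linarith
    qed
  qed
  define H where "H = (\<Sum>k<n. \<integral>x. cmod (g k x) powr r \<partial>\<kappa>)"
  have H: "(\<integral>x. cmod (g k x) powr r \<partial>\<kappa>) \<le> H" if "k < n" for k
    unfolding H_def using that by (intro member_le_sum) (auto intro: Bochner_Integration.integral_nonneg)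
  have H0: "0 \<le> H" unfolding H_def by (intro sum_nonneg Bochner_Integration.integral_nonneg) auto
  \<comment> \<open>\<open>B * t\<close> bounds the change of the pairing when one coefficient moves
    by at most \<open>t\<close>. One factor \<open>2 powr r\<close> comes from the moved modulus,
    another from \<open>add_powr_le\<close>.\<close>
  define B where "B = r * (4 powr r * (duality_bound r C + H))"
  have B0: "0 \<le> B" unfolding B_def using r duality_bound_ge_1[OF r C] H0 by (intro mult_nonneg_nonneg) auto
  define t where "t = min 1 (e / (1 + B))"
  have t: "0 < t" "t \<le> 1" using e B0 by (auto simp: t_def)
  have "t \<le> e / (1 + B)" by (simp add: t_def)
  then have t_le: "t * (1 + B) \<le> e" using B0 by (simp add: pos_le_divide_eq)
  \<comment> \<open>Minimal up to the square of \<open>t\<close>, so that dividing by the step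
    length \<open>t\<close> leaves an error \<open>t\<close>.\<close>
  obtain c where c: "\<Phi> c < Inf (range \<Phi>) + t\<^sup>2"
    using cInf_lessD[of "range \<Phi>" "Inf (range \<Phi>) + t\<^sup>2"] t(1) by auto
  have min: "\<Phi> c - t\<^sup>2 \<le> \<Phi> c'" for c'
    using cInf_lower[OF rangeI bdd, of c'] c by linarith
  \<comment> \<open>Comparison with zero coefficients bounds the energy of the near-minimiser, and
    thereby the norm of \<open>f\<close>.\<close>
  have "\<Phi> (\<lambda>_. 0) = 0" using r by (simp add: \<Phi>_def I_def G_def)
  then have "\<Phi> c \<le> t\<^sup>2" using min[of "\<lambda>_. 0"] by simp
  also have "t\<^sup>2 \<le> 1" using t by (simp add: power_le_one)
  finally have Ic: "I c \<le> duality_bound r C" using lower[of c] by (intro duality_bound r C I0) linarith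
  define f where "f x = duality_map r (G c x)" for x
  have fm [measurable]: "f \<in> borel_measurable \<kappa>" unfolding f_def by measurable
  have f_powr: "cmod (f x) powr (r / (r - 1)) = cmod (G c x) powr r" for x
    using r by (simp add: f_def cmod_duality_map powr_powr)
  have prod_le: "cmod (duality_map r u * v) \<le> (cmod u + cmod v) powr r" for u v
  proof -
    have "cmod (duality_map r u * v) = cmod u powr (r - 1) * cmod v" using r by (simp add: norm_mult cmod_duality_map)
    also have "\<dots> \<le> (cmod u + cmod v) powr (r - 1) * (cmod u + cmod v)"
      using r by (intro mult_mono powr_mono2) auto
    also have "\<dots> = (cmod u + cmod v) powr r"
      using powr_mult_base[of "cmod u + cmod v" "r - 1"] by (simp add: mult.commute)
    finally show ?thesis .
  qed
  have sum_int: "integrable \<kappa> (\<lambda>x. (cmod (G c' x) + cmod (g k x)) powr r)"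
    and sum_le: "(\<integral>x. (cmod (G c' x) + cmod (g k x)) powr r \<partial>\<kappa>) \<le> 2 powr r * (I c' + H)" if k: "k < n" for c' k
  proof -
    have gk [measurable]: "g k \<in> borel_measurable \<kappa>" by (rule g(1)[OF k])
    have i: "integrable \<kappa> (\<lambda>x. 2 powr r * (cmod (G c' x) powr r + cmod (g k x) powr r))"
      using Gi g(2)[OF k] by (intro integrable_mult_right Bochner_Integration.integrable_add)
    have le: "(cmod (G c' x) + cmod (g k x)) powr r \<le> 2 powr r * (cmod (G c' x) powr r + cmod (g k x) powr r)" for x
      using r by (intro add_powr_le) auto
    show 1: "integrable \<kappa> (\<lambda>x. (cmod (G c' x) + cmod (g k x)) powr r)"
      by (rule Bochner_Integration.integrable_bound[OF i]) (use le in \<open>auto intro!: AE_I2 order.trans[OF _ abs_ge_self]\<close>)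
    have "(\<integral>x. (cmod (G c' x) + cmod (g k x)) powr r \<partial>\<kappa>) \<le> (\<integral>x. 2 powr r * (cmod (G c' x) powr r + cmod (g k x) powr r) \<partial>\<kappa>)"
      by (rule integral_mono[OF 1 i le])
    also have "\<dots> = 2 powr r * (I c' + (\<integral>x. cmod (g k x) powr r \<partial>\<kappa>))"
      using Gi g(2)[OF k] by (simp add: I_def)
    also have "\<dots> \<le> 2 powr r * (I c' + H)" using H[OF k] by (intro mult_left_mono) auto
    finally show "(\<integral>x. (cmod (G c' x) + cmod (g k x)) powr r \<partial>\<kappa>) \<le> 2 powr r * (I c' + H)" .
  qed
  have dint: "integrable \<kappa> (\<lambda>x. duality_map r (G c' x) * g k x)" if k: "k < n" for c' k
  proof (rule Bochner_Integration.integrable_bound[OF sum_int[OF k]])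
    show "(\<lambda>x. duality_map r (G c' x) * g k x) \<in> borel_measurable \<kappa>" using g(1)[OF k] by measurable
    show "AE x in \<kappa>. norm (duality_map r (G c' x) * g k x) \<le> norm ((cmod (G c' x) + cmod (g k x)) powr r)"
      using prod_le by (intro AE_I2) simp
  qed
  have "cmod (\<phi> k - (\<integral>x. f x * g k x \<partial>\<kappa>)) \<le> e" if k: "k < n" for k
  proof -
    define d where "d = (\<integral>x. f x * g k x \<partial>\<kappa>) - \<phi> k"
    \<comment> \<open>The direction in which the defect \<open>d\<close> lowers the functional
      fastest; it is 0 if \<open>d\<close> is 0.\<close>
    define \<omega> where "\<omega> = - cnj (sgn d)"
    have \<omega>: "cmod \<omega> \<le> 1" "\<omega> * d = - complex_of_real (cmod d)"
    proof -
      show "cmod \<omega> \<le> 1" by (simp add: \<omega>_def norm_sgn)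
      have "cnj (sgn d) * d = complex_of_real (cmod d)"
      proof (cases "d = 0")
        case False
        have "cnj (sgn d) * d = (d * cnj d) / complex_of_real (cmod d)" by (simp add: sgn_eq)
        also have "\<dots> = complex_of_real (cmod d)"
          using False by (simp add: complex_norm_square[symmetric] power2_eq_square)
        finally show ?thesis .
      qed simp
      then show "\<omega> * d = - complex_of_real (cmod d)" by (simp add: \<omega>_def)
    qed
    define c' where "c' = c(k := c k + complex_of_real t * \<omega>)"
    have G': "G c' x = G c x + complex_of_real t * \<omega> * g k x" for x
    proof -
      have "G c' x = (\<Sum>j<n. c j * g j x + (if j = k then complex_of_real t * \<omega> * g k x else 0))"
        unfolding G_def c'_def by (intro sum.cong) (auto simp: algebra_simps)
      then show ?thesis using k by (simp add: sum.distrib G_def)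
    qed
    have \<phi>': "(\<Sum>j<n. c' j * \<phi> j) = (\<Sum>j<n. c j * \<phi> j) + complex_of_real t * \<omega> * \<phi> k"
    proof -
      have "(\<Sum>j<n. c' j * \<phi> j) = (\<Sum>j<n. c j * \<phi> j + (if j = k then complex_of_real t * \<omega> * \<phi> k else 0))"
        unfolding c'_def by (intro sum.cong) (auto simp: algebra_simps)
      then show ?thesis using k by (simp add: sum.distrib)
    qed
    define Y where "Y = (\<integral>x. duality_map r (G c' x) * g k x \<partial>\<kappa>)"
    have "I c' \<le> (\<integral>x. cmod (G c x) powr r + r * Re (complex_of_real t * \<omega> * (duality_map r (G c' x) * g k x)) \<partial>\<kappa>)"
      unfolding I_def
    proof (rule integral_mono)
      show "integrable \<kappa> (\<lambda>x. cmod (G c x) powr r + r * Re (complex_of_real t * \<omega> * (duality_map r (G c' x) * g k x)))"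
        using Gi dint[OF k] by (intro Bochner_Integration.integrable_add integrable_mult_right integrable_Re) auto
      show "cmod (G c' x) powr r \<le> cmod (G c x) powr r + r * Re (complex_of_real t * \<omega> * (duality_map r (G c' x) * g k x))" for x
      proof -
        have eq: "duality_map r (G c' x) * (complex_of_real t * \<omega> * g k x) = complex_of_real t * \<omega> * (duality_map r (G c' x) * g k x)"
          by (simp only: mult_ac)
        have "1 < r" using r by simp
        from norm_powr_tangent[OF this, of "G c x" "complex_of_real t * \<omega> * g k x"]
        show ?thesis unfolding G'[symmetric] eq .
      qed
    qed (rule Gi)
    also have "\<dots> = I c + r * Re (complex_of_real t * \<omega> * Y)"
    proof -
      have i: "integrable \<kappa> (\<lambda>x. complex_of_real t * \<omega> * (duality_map r (G c' x) * g k x))"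
        using dint[OF k] by (rule integrable_mult_right)
      show ?thesis using Gi dint[OF k] i
        by (subst Bochner_Integration.integral_add)
          (auto simp: I_def Y_def integral_Re[OF i] intro!: integrable_mult_right integrable_Re simp del: Re_complex_of_real Complex.times_complex.simps)
    qed
    finally have "I c' \<le> I c + r * Re (complex_of_real t * \<omega> * Y)" .
    then have "I c' / r \<le> I c / r + Re (complex_of_real t * \<omega> * Y)" using r by (simp add: field_simps)
    then have "- t\<^sup>2 \<le> Re (complex_of_real t * \<omega> * Y) - Re (complex_of_real t * \<omega> * \<phi> k)"
      using min[of c'] unfolding \<Phi>_def \<phi>' by simp
    also have "\<dots> = t * Re (\<omega> * (Y - \<phi> k))" by (simp add: algebra_simps)
    finally have "- t\<^sup>2 / t \<le> Re (\<omega> * (Y - \<phi> k))" using t by (simp add: field_simps)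
    then have 1: "- t \<le> Re (\<omega> * (Y - \<phi> k))" using t by (simp add: power2_eq_square)
    have Yd: "cmod (Y - (\<integral>x. f x * g k x \<partial>\<kappa>)) \<le> B * t"
    proof -
      have i1: "integrable \<kappa> (\<lambda>x. f x * g k x)" unfolding f_def by (rule dint[OF k])
      have "Y - (\<integral>x. f x * g k x \<partial>\<kappa>) = (\<integral>x. duality_map r (G c' x) * g k x - f x * g k x \<partial>\<kappa>)"
        unfolding Y_def using dint[OF k] i1 by simp
      also have "cmod \<dots> \<le> (\<integral>x. cmod (duality_map r (G c' x) * g k x - f x * g k x) \<partial>\<kappa>)"
        by (rule integral_norm_bound)
      also have "\<dots> \<le> (\<integral>x. r * t * 2 powr r * (cmod (G c x) + cmod (g k x)) powr r \<partial>\<kappa>)"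
      proof (rule integral_mono)
        show "integrable \<kappa> (\<lambda>x. cmod (duality_map r (G c' x) * g k x - f x * g k x))"
          using dint[OF k] i1 by (intro integrable_norm Bochner_Integration.integrable_diff)
        show "integrable \<kappa> (\<lambda>x. r * t * 2 powr r * (cmod (G c x) + cmod (g k x)) powr r)"
          using sum_int[OF k] by (rule integrable_mult_right)
        fix x
        define s where "s = cmod (G c x) + cmod (g k x)"
        have s0: "0 \<le> s" by (simp add: s_def)
        have tw: "cmod (complex_of_real t * \<omega> * g k x) \<le> t * cmod (g k x)"
          using t \<omega>(1) by (simp add: norm_mult mult_left_le mult_right_mono mult_le_cancel_left)
        also have "\<dots> \<le> 1 * cmod (g k x)" using t by (intro mult_right_mono) auto
        finally have tw1: "cmod (complex_of_real t * \<omega> * g k x) \<le> cmod (g k x)" by simp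
        have "cmod (G c' x) \<le> cmod (G c x) + cmod (g k x)"
          unfolding G' by (rule order.trans[OF norm_triangle_ineq add_left_mono[OF tw1]])
        moreover have "0 \<le> cmod (g k x)" by simp
        ultimately have "cmod (G c' x) + cmod (G c x) \<le> 2 * s"
          unfolding s_def distrib_left by linarith
        then have A: "(cmod (G c' x) + cmod (G c x)) powr (r - 2) \<le> (2 * s) powr (r - 2)"
          using r by (intro powr_mono2) auto
        have "cmod (duality_map r (G c' x) * g k x - f x * g k x) = cmod (duality_map r (G c' x) - duality_map r (G c x)) * cmod (g k x)"
          by (simp add: f_def norm_mult[symmetric] algebra_simps)
        also have "\<dots> \<le> (r * (cmod (G c' x) + cmod (G c x)) powr (r - 2) * cmod (G c' x - G c x)) * cmod (g k x)"
          by (intro mult_right_mono duality_map_lipschitz r) auto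
        also have "\<dots> \<le> (r * (2 * s) powr (r - 2) * (t * s)) * s"
        proof (intro mult_mono mult_left_mono A)
          have "cmod (G c' x - G c x) \<le> t * cmod (g k x)" using tw by (simp add: G')
          also have "\<dots> \<le> t * s" using t by (intro mult_left_mono) (auto simp: s_def)
          finally show "cmod (G c' x - G c x) \<le> t * s" .
        qed (use r t s0 in \<open>auto simp: s_def\<close>)
        also have "\<dots> = r * t * (2 powr (r - 2) * (s powr (r - 2) * (s * s)))"
          by (simp add: powr_mult mult_ac)
        also have "s powr (r - 2) * (s * s) = s powr r"
        proof (cases "s = 0")
          case False
          then have "0 < s" using s0 by simp
          then have "s * s = s powr 2" by (simp add: powr_numeral power2_eq_square)
          then show ?thesis by (simp add: powr_add[symmetric])
        qed (use r in simp)
        also have "r * t * (2 powr (r - 2) * s powr r) \<le> r * t * (2 powr r * s powr r)"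
          using r t by (intro mult_left_mono mult_right_mono powr_mono) auto
        finally show "cmod (duality_map r (G c' x) * g k x - f x * g k x) \<le> r * t * 2 powr r * (cmod (G c x) + cmod (g k x)) powr r"
          by (simp add: s_def mult.assoc)
      qed
      also have "\<dots> = r * t * 2 powr r * (\<integral>x. (cmod (G c x) + cmod (g k x)) powr r \<partial>\<kappa>)" by simp
      also have "\<dots> \<le> r * t * 2 powr r * (2 powr r * (duality_bound r C + H))"
        using r t Ic by (intro mult_left_mono order.trans[OF sum_le[OF k]]) auto
      also have "\<dots> = B * t"
      proof -
        have "2 powr r * (2 powr r) = (4::real) powr r" by (simp add: powr_mult[symmetric])
        then show ?thesis by (simp add: B_def mult_ac)
      qed
      finally show ?thesis .
    qed
    have "cmod (\<omega> * (Y - (\<integral>x. f x * g k x \<partial>\<kappa>))) \<le> B * t"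
      using \<omega>(1) Yd by (simp add: norm_mult) (meson mult_left_le_one_le norm_ge_zero order.trans)
    then have 2: "Re (\<omega> * (Y - (\<integral>x. f x * g k x \<partial>\<kappa>))) \<le> B * t"
      using complex_Re_le_cmod order.trans by blast
    have "\<omega> * (Y - \<phi> k) = \<omega> * (Y - (\<integral>x. f x * g k x \<partial>\<kappa>)) + \<omega> * d"
      by (simp add: d_def algebra_simps)
    then have "Re (\<omega> * (Y - \<phi> k)) = Re (\<omega> * (Y - (\<integral>x. f x * g k x \<partial>\<kappa>))) - cmod d"
      unfolding \<omega>(2) by simp
    then have "cmod d \<le> t * (1 + B)" using 1 2 by (simp add: algebra_simps)
    then show ?thesis using t_le by (simp add: d_def norm_minus_commute)
  qed
  moreover have "integrable \<kappa> (\<lambda>x. cmod (f x) powr (r / (r - 1)))" unfolding f_powr by (rule Gi)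
  moreover have "(\<integral>x. cmod (f x) powr (r / (r - 1)) \<partial>\<kappa>) \<le> duality_bound r C" unfolding f_powr using Ic by (simp add: I_def)
  ultimately show ?thesis using fm by blast
qed

section \<open>Trace bounds in the three ranges of \<open>p\<close>\<close>

lemma trace_bound_sup:
  assumes \<sigma>: "\<And>k. 0 < \<sigma> k" "summable \<sigma>" and m: "\<And>j k. cmod (m j k) \<le> \<sigma> k powr (3/2)"
  shows "trace_bound m (\<lambda>_. sqrt (suminf \<sigma>)) \<sigma>"
proof (rule trace_bound_approx)
  fix n :: nat and e :: real assume e: "0 < e"
  \<comment> \<open>A factorisation through \<open>l_2\<close> that rests on the size of the
    entries: \<open>w k\<close> is \<open>\<sigma> k\<close> times a unit vector, and the exponent
    3/2 makes the squared norm of \<open>v j\<close> at most the sum of the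
    \<open>\<sigma> l\<close>.\<close>
  define v where "v j l = m j l / complex_of_real (\<sigma> l)" for j l
  define w where "w k l = (if l = k then complex_of_real (\<sigma> k) else 0)" for k l :: nat
  have cs: "(\<integral>x. h x \<partial>count_space {..<n}) = (\<Sum>l<n. h l)" for h :: "nat \<Rightarrow> 'b::{banach, second_countable_topology}"
    by (rule lebesgue_integral_count_space_finite) simp
  have ci: "integrable (count_space {..<n}) h" for h :: "nat \<Rightarrow> 'b::{banach, second_countable_topology}"
    by (rule integrable_count_space) simp
  have S: "0 \<le> suminf \<sigma>" using \<sigma> by (intro suminf_nonneg) (auto intro: less_imp_le)
  have "gram_factor (count_space {..<n}) n v (\<lambda>_. sqrt (suminf \<sigma>))"
    unfolding gram_factor_def
  proof (intro allI impI conjI)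
    fix j
    have "(\<integral>x. (cmod (v j x))\<^sup>2 \<partial>count_space {..<n}) \<le> (\<Sum>l<n. \<sigma> l)"
      unfolding cs
    proof (rule sum_mono)
      fix l
      have "(cmod (m j l))\<^sup>2 \<le> (\<sigma> l powr (3/2))\<^sup>2" using m by (intro power_mono) auto
      also have "\<dots> = \<sigma> l * (\<sigma> l)\<^sup>2"
      proof -
        have "(\<sigma> l powr (3/2))\<^sup>2 = \<sigma> l powr 3" by (simp add: power2_eq_square powr_add[symmetric])
        also have "\<dots> = \<sigma> l ^ 3" using \<sigma>(1)[of l] by (simp add: powr_numeral)
        finally show ?thesis by (simp add: power3_eq_cube power2_eq_square)
      qed
      finally show "(cmod (v j l))\<^sup>2 \<le> \<sigma> l"
        using \<sigma>(1)[of l] by (simp add: v_def norm_divide power_divide divide_le_eq)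
    qed
    also have "\<dots> \<le> suminf \<sigma>" using \<sigma> by (intro sum_le_suminf) (auto intro: less_imp_le)
    finally show "(\<integral>x. (cmod (v j x))\<^sup>2 \<partial>count_space {..<n}) \<le> (sqrt (suminf \<sigma>))\<^sup>2" using S by simp
  qed (auto intro: ci)
  moreover have "gram_factor (count_space {..<n}) n w \<sigma>"
    unfolding gram_factor_def
  proof (intro allI impI conjI)
    fix k assume "k < n"
    have "(\<Sum>l<n. (cmod (w k l))\<^sup>2) = (\<Sum>l<n. if l = k then (\<sigma> k)\<^sup>2 else 0)"
      by (intro sum.cong) (auto simp: w_def)
    then show "(\<integral>x. (cmod (w k x))\<^sup>2 \<partial>count_space {..<n}) \<le> (\<sigma> k)\<^sup>2" unfolding cs using \<open>k < n\<close> by simp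
  qed (auto intro: ci)
  moreover have "cmod (m j k - (\<integral>x. v j x * w k x \<partial>count_space {..<n})) \<le> e" if "k < n" for j k
  proof -
    have "(\<Sum>l<n. v j l * w k l) = (\<Sum>l<n. if l = k then m j k else 0)"
      using \<sigma>(1)[of k] by (intro sum.cong) (auto simp: v_def w_def)
    then show ?thesis unfolding cs using that e by simp
  qed
  ultimately show "\<exists>(\<kappa>::nat measure) v w. gram_factor \<kappa> n v (\<lambda>_. sqrt (suminf \<sigma>)) \<and> gram_factor \<kappa> n w \<sigma> \<and>
    (\<forall>j<n. \<forall>k<n. cmod (m j k - (\<integral>x. v j x * w k x \<partial>\<kappa>)) \<le> e)" by blast
qed

text \<open>Change of density on the side of the vectors: the measure \<open>\<kappa>\<close> has
  density \<open>H\<close> and \<open>w k\<close> is \<open>g k\<close> divided by \<open>H\<close>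
  to the power \<open>1 / p\<close>. As \<open>\<kappa>\<close> is finite and \<open>p\<close> is at
  most 2, its \<open>L_2\<close> norm dominates its \<open>L_p\<close> norm, so the functionals stay
  bounded on the \<open>w k\<close> in \<open>L_2(\<kappa>)\<close> and are represented there by
  \<open>approx_duality\<close> with \<open>r = 2\<close>.\<close>

lemma trace_bound_Lp_le_2:
  fixes \<nu> :: "'m measure" and g :: "nat \<Rightarrow> 'm \<Rightarrow> complex" and m :: "nat \<Rightarrow> nat \<Rightarrow> complex"
  assumes p: "1 \<le> p" "p \<le> 2" and \<sigma>: "\<And>k. 0 < \<sigma> k" "summable \<sigma>" and C: "0 < C"
    and gm [measurable]: "\<And>k. g k \<in> borel_measurable \<nu>" and gi: "\<And>k. integrable \<nu> (\<lambda>x. cmod (g k x) powr p)"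
    and g_le: "\<And>k. (\<integral>x. cmod (g k x) powr p \<partial>\<nu>) \<le> (C * \<sigma> k powr (1/2 + 1/p)) powr p"
    and m: "\<And>j n c. cmod (\<Sum>k<n. c k * m j k) \<le> C * (\<integral>x. cmod (\<Sum>k<n. c k * g k x) powr p \<partial>\<nu>) powr (1/p)"
  shows "\<exists>A1>0. \<exists>A2>0. trace_bound m (\<lambda>_. A1) (\<lambda>k. A2 * \<sigma> k)"
proof -
  define S0 where "S0 = C powr p * suminf \<sigma>"
  have S: "0 \<le> suminf \<sigma>" using \<sigma> by (intro suminf_nonneg) (auto intro: less_imp_le)
  have S0: "0 \<le> S0" using S by (simp add: S0_def)
  define C' where "C' = C * (S0 + 1) powr (1/p)"
  have C': "0 < C'" using C S0 by (simp add: C'_def)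
  define A1 where "A1 = sqrt (duality_bound 2 C')"
  define A2 where "A2 = C powr (p/2)"
  have DB: "1 \<le> duality_bound 2 C'" using C' by (intro duality_bound_ge_1) auto
  have g_le': "(\<integral>x. cmod (g k x) powr p \<partial>\<nu>) \<le> C powr p * \<sigma> k powr (p/2 + 1)" for k
  proof -
    have "(C * \<sigma> k powr (1/2 + 1/p)) powr p = C powr p * \<sigma> k powr ((1/2 + 1/p) * p)"
      by (simp only: powr_mult powr_powr)
    also have "(1/2 + 1/p) * p = p/2 + 1" using p by (simp add: field_simps)
    finally show ?thesis using g_le[of k] by simp
  qed
  have "trace_bound m (\<lambda>_. A1) (\<lambda>k. A2 * \<sigma> k)"
  proof (rule trace_bound_approx)
    fix n :: nat and e :: real assume e: "0 < e"
    \<comment> \<open>The weight makes the integral of the \<open>k\<close>-th summand at most a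
      constant times \<open>\<sigma> k\<close>, so the mass of \<open>\<kappa>\<close> is bounded
      independently of \<open>n\<close>. It also forces
      \<open>cmod (w k x) \<le> sqrt (\<sigma> k)\<close> for \<open>k < n\<close>.\<close>
    define H where "H x = (\<Sum>k<n. \<sigma> k powr (-p/2) * cmod (g k x) powr p)" for x
    have Hm [measurable]: "H \<in> borel_measurable \<nu>" unfolding H_def by measurable
    have H0: "0 \<le> H x" for x unfolding H_def by (intro sum_nonneg) auto
    have H_ge: "\<sigma> k powr (-p/2) * cmod (g k x) powr p \<le> H x" if "k < n" for k x
      unfolding H_def using that by (intro member_le_sum[where f = "\<lambda>k. \<sigma> k powr (-p/2) * cmod (g k x) powr p"]) auto
    have Hi: "integrable \<nu> H" unfolding H_def using gi by (intro Bochner_Integration.integrable_sum integrable_mult_right)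
    have H_int: "(\<integral>x. H x \<partial>\<nu>) \<le> S0"
    proof -
      have "(\<integral>x. H x \<partial>\<nu>) = (\<Sum>k<n. \<sigma> k powr (-p/2) * (\<integral>x. cmod (g k x) powr p \<partial>\<nu>))"
        unfolding H_def using gi by (subst Bochner_Integration.integral_sum) auto
      also have "\<dots> \<le> (\<Sum>k<n. \<sigma> k powr (-p/2) * (C powr p * \<sigma> k powr (p/2 + 1)))"
        using g_le' by (intro sum_mono mult_left_mono) auto
      also have "\<dots> = (\<Sum>k<n. C powr p * \<sigma> k)"
      proof (intro sum.cong refl)
        fix k
        have "\<sigma> k powr (-p/2) * \<sigma> k powr (p/2 + 1) = \<sigma> k powr (-p/2 + (p/2 + 1))" by (rule powr_add[symmetric])
        also have "\<dots> = \<sigma> k" using \<sigma>(1)[of k] by simp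
        finally show "\<sigma> k powr (-p/2) * (C powr p * \<sigma> k powr (p/2 + 1)) = C powr p * \<sigma> k"
          by (simp only: mult.left_commute)
      qed
      also have "\<dots> = C powr p * (\<Sum>k<n. \<sigma> k)" by (simp add: sum_distrib_left)
      also have "\<dots> \<le> S0" unfolding S0_def
        using \<sigma> by (intro mult_left_mono sum_le_suminf) (auto intro: less_imp_le)
      finally show ?thesis .
    qed
    define w where "w k x = g k x * complex_of_real (H x powr (-1/p))" for k x
    have wm [measurable]: "w k \<in> borel_measurable \<nu>" for k unfolding w_def by measurable
    define \<kappa> where "\<kappa> = density \<nu> (\<lambda>x. ennreal (H x))"
    have \<kappa>m: "f \<in> borel_measurable \<kappa> \<longleftrightarrow> f \<in> borel_measurable \<nu>" for f :: "'m \<Rightarrow> complex" by (simp add: \<kappa>_def)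
    have \<kappa>i: "integrable \<kappa> f \<longleftrightarrow> integrable \<nu> (\<lambda>x. H x * f x)" if "f \<in> borel_measurable \<nu>" for f :: "'m \<Rightarrow> real"
      unfolding \<kappa>_def using that H0 by (subst integrable_density) auto
    have \<kappa>I: "(\<integral>x. f x \<partial>\<kappa>) = (\<integral>x. H x * f x \<partial>\<nu>)" if "f \<in> borel_measurable \<nu>" for f :: "'m \<Rightarrow> real"
      unfolding \<kappa>_def using that H0 by (subst integral_density) auto
    have w_le: "H x * (cmod (w k x))\<^sup>2 \<le> \<sigma> k powr (1 - p/2) * cmod (g k x) powr p" if k: "k < n" for k x
    proof (cases "g k x = 0")
      case False
      define y where "y = cmod (g k x)"
      define h0 where "h0 = \<sigma> k powr (-p/2) * y powr p"
      have y: "0 < y" using False by (simp add: y_def)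
      have h0: "0 < h0" using \<sigma>(1)[of k] y by (simp add: h0_def)
      have hH: "h0 \<le> H x" unfolding h0_def y_def by (rule H_ge[OF k])
      then have Hp: "0 < H x" using h0 by simp
      have "H x * (cmod (w k x))\<^sup>2 = y\<^sup>2 * (H x powr 1 * (H x powr (-1/p) * H x powr (-1/p)))"
        using Hp by (simp add: w_def norm_mult power_mult_distrib y_def power2_eq_square)
      also have "H x powr 1 * (H x powr (-1/p) * H x powr (-1/p)) = H x powr (1 - 2/p)"
      proof -
        have "H x powr 1 * (H x powr (-1/p) * H x powr (-1/p)) = H x powr (1 + (-1/p + -1/p))" by (simp only: powr_add)
        also have "1 + (-1/p + -1/p) = 1 - 2/p" by simp
        finally show ?thesis .
      qed
      \<comment> \<open>Here \<open>p \<le> 2\<close> enters: the exponent is not positive, so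
        replacing \<open>H x\<close> by its smaller \<open>k\<close>-th summand increases the
        power.\<close>
      also have "H x powr (1 - 2/p) \<le> h0 powr (1 - 2/p)" using p h0 hH by (intro powr_mono2') (auto simp: field_simps)
      also have "h0 powr (1 - 2/p) = \<sigma> k powr ((-p/2) * (1 - 2/p)) * y powr (p * (1 - 2/p))"
        unfolding h0_def by (simp only: powr_mult powr_powr)
      also have "(-p/2) * (1 - 2/p) = 1 - p/2" using p by (simp add: field_simps)
      also have "p * (1 - 2/p) = p - 2" using p by (simp add: field_simps)
      finally have "H x * (cmod (w k x))\<^sup>2 \<le> y\<^sup>2 * (\<sigma> k powr (1 - p/2) * y powr (p - 2))"
        by (simp add: mult_left_mono)
      also have "\<dots> = \<sigma> k powr (1 - p/2) * (y powr 2 * y powr (p - 2))"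
        using y by (simp add: powr_numeral mult_ac)
      also have "y powr 2 * y powr (p - 2) = y powr p" by (simp only: powr_add[symmetric]) simp
      finally show ?thesis by (simp add: y_def)
    qed (simp add: w_def)
    have wi': "integrable \<nu> (\<lambda>x. H x * (cmod (w k x))\<^sup>2)" if "k < n" for k
    proof (rule Bochner_Integration.integrable_bound)
      show "integrable \<nu> (\<lambda>x. \<sigma> k powr (1 - p/2) * cmod (g k x) powr p)" using gi by (rule integrable_mult_right)
      show "AE x in \<nu>. norm (H x * (cmod (w k x))\<^sup>2) \<le> norm (\<sigma> k powr (1 - p/2) * cmod (g k x) powr p)"
        using w_le[OF that] H0 by (intro AE_I2) simp
    qed measurable
    have wi: "integrable \<kappa> (\<lambda>x. (cmod (w k x))\<^sup>2)" if "k < n" for k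
      using wi'[OF that] by (subst \<kappa>i) auto
    have w_int: "(\<integral>x. (cmod (w k x))\<^sup>2 \<partial>\<kappa>) \<le> (A2 * \<sigma> k)\<^sup>2" if k: "k < n" for k
    proof -
      have "(\<integral>x. (cmod (w k x))\<^sup>2 \<partial>\<kappa>) = (\<integral>x. H x * (cmod (w k x))\<^sup>2 \<partial>\<nu>)" by (rule \<kappa>I) measurable
      also have "\<dots> \<le> (\<integral>x. \<sigma> k powr (1 - p/2) * cmod (g k x) powr p \<partial>\<nu>)"
        using w_le[OF k] by (intro integral_mono wi' k integrable_mult_right gi)
      also have "\<dots> \<le> \<sigma> k powr (1 - p/2) * (C powr p * \<sigma> k powr (p/2 + 1))"
        using g_le'[of k] by (simp add: mult_left_mono)
      also have "\<dots> = C powr p * (\<sigma> k powr (1 - p/2) * \<sigma> k powr (p/2 + 1))" by simp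
      also have "\<sigma> k powr (1 - p/2) * \<sigma> k powr (p/2 + 1) = (\<sigma> k)\<^sup>2"
        using \<sigma>(1)[of k] by (simp only: powr_add[symmetric]) (simp add: powr_numeral)
      also have "C powr p = A2\<^sup>2" by (simp add: A2_def power2_eq_square powr_add[symmetric])
      finally show ?thesis by (simp add: power_mult_distrib)
    qed
    have wi2: "integrable \<kappa> (\<lambda>x. cmod (w k x) powr 2)" if "k < n" for k
      using wi[OF that] by (simp add: powr_numeral)
    have \<phi>: "cmod (\<Sum>k<n. c k * m j k) \<le> C' * (\<integral>x. cmod (\<Sum>k<n. c k * w k x) powr 2 \<partial>\<kappa>) powr (1/2)" for c j
    proof -
      define W where "W x = (\<Sum>k<n. c k * w k x)" for x
      have Wm [measurable]: "W \<in> borel_measurable \<nu>" unfolding W_def by measurable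
      define I where "I = (\<integral>x. cmod (W x) powr 2 \<partial>\<kappa>)"
      have I0: "0 \<le> I" unfolding I_def by (intro Bochner_Integration.integral_nonneg) auto
      have Wi: "integrable \<nu> (\<lambda>x. H x * cmod (W x) powr 2)"
      proof -
        have "integrable \<kappa> (\<lambda>x. cmod (W x) powr 2)"
          unfolding W_def using wi2 by (intro integrable_powr_linear_comb) (auto simp: \<kappa>m)
        then show ?thesis by (subst (asm) \<kappa>i) auto
      qed
      have IW: "I = (\<integral>x. H x * cmod (W x) powr 2 \<partial>\<nu>)" unfolding I_def by (rule \<kappa>I) measurable
      have gW: "cmod (\<Sum>k<n. c k * g k x) powr p = H x * cmod (W x) powr p" for x
      proof (cases "H x = 0")
        case True
        have "g k x = 0" if "k < n" for k
        proof (rule ccontr)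
          assume "g k x \<noteq> 0"
          then have "0 < \<sigma> k powr (-p/2) * cmod (g k x) powr p" using \<sigma>(1)[of k] by simp
          then show False using H_ge[OF that, of x] True by simp
        qed
        then show ?thesis using True p by simp
      next
        case False
        then have Hp: "0 < H x" using H0[of x] by simp
        have "c k * g k x = complex_of_real (H x powr (1/p)) * (c k * w k x)" for k
        proof -
          have "complex_of_real (H x powr (1/p)) * complex_of_real (H x powr (-1/p)) = 1"
            using Hp by (simp add: of_real_mult[symmetric] powr_add[symmetric] del: of_real_mult)
          then show ?thesis by (simp add: w_def mult_ac)
        qed
        then have "(\<Sum>k<n. c k * g k x) = complex_of_real (H x powr (1/p)) * W x"
          by (simp only: W_def sum_distrib_left)
        then show ?thesis using Hp p by (simp add: norm_mult powr_mult powr_powr)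
      qed
      \<comment> \<open>A number \<open>s\<close> above the \<open>L_2\<close> norm, in place of the
        norm itself, permits division also when \<open>I = 0\<close>.\<close>
      have bound: "cmod (\<Sum>k<n. c k * m j k) \<le> C' * s" if s: "sqrt I < s" for s
      proof -
        have s0: "0 < s" using s I0 by (meson le_less_trans real_sqrt_ge_zero)
        have Is: "I \<le> s\<^sup>2" using s I0 s0 real_sqrt_le_iff[of I "s\<^sup>2"] by simp
        have pt: "H x * cmod (W x) powr p \<le> s powr p * (H x + H x * cmod (W x) powr 2 / s\<^sup>2)" for x
        proof -
          define y where "y = cmod (W x) / s"
          have y: "0 \<le> y" using s0 by (simp add: y_def)
          \<comment> \<open>This elementary bound replaces Hoelder's inequality on the finite
            measure \<open>\<kappa>\<close>; after integration the two terms give \<open>S0\<close>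
            and 1.\<close>
          have "y powr p \<le> 1 + y powr 2"
          proof (cases "y \<le> 1")
            case True
            then have "y powr p \<le> 1" using y p by (intro powr_le1) auto
            then show ?thesis using powr_ge_zero[of y 2] by linarith
          next
            case False
            then have "y powr p \<le> y powr 2" using p by (intro powr_mono) auto
            then show ?thesis by simp
          qed
          then have "s powr p * (H x * y powr p) \<le> s powr p * (H x * (1 + y powr 2))"
            using H0 by (intro mult_left_mono) auto
          moreover have "s powr p * y powr p = cmod (W x) powr p"
            using s0 by (simp add: powr_mult[symmetric] y_def)
          moreover have "y powr 2 = cmod (W x) powr 2 / s\<^sup>2"
            using s0 by (simp add: y_def powr_divide powr_numeral)
          ultimately show ?thesis by (simp add: algebra_simps)
        qed
        have "(\<integral>x. cmod (\<Sum>k<n. c k * g k x) powr p \<partial>\<nu>) \<le> (\<integral>x. s powr p * (H x + H x * cmod (W x) powr 2 / s\<^sup>2) \<partial>\<nu>)"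
        proof (rule integral_mono)
          show "integrable \<nu> (\<lambda>x. cmod (\<Sum>k<n. c k * g k x) powr p)"
            using p gi by (intro integrable_powr_linear_comb) auto
          show "integrable \<nu> (\<lambda>x. s powr p * (H x + H x * cmod (W x) powr 2 / s\<^sup>2))"
            using Hi Wi by (intro integrable_mult_right Bochner_Integration.integrable_add integrable_divide) auto
        qed (simp only: gW pt)
        also have "\<dots> = s powr p * ((\<integral>x. H x \<partial>\<nu>) + I / s\<^sup>2)"
          using Hi Wi by (simp add: IW)
        also have "\<dots> \<le> s powr p * (S0 + 1)"
          using H_int Is s0 by (intro mult_left_mono add_mono) auto
        finally have "(\<integral>x. cmod (\<Sum>k<n. c k * g k x) powr p \<partial>\<nu>) powr (1/p) \<le> (s powr p * (S0 + 1)) powr (1/p)"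
          using p by (intro powr_mono2) (auto intro: Bochner_Integration.integral_nonneg)
        also have "\<dots> = s * (S0 + 1) powr (1/p)" using s0 p by (simp add: powr_mult powr_powr)
        finally have "C * (\<integral>x. cmod (\<Sum>k<n. c k * g k x) powr p \<partial>\<nu>) powr (1/p) \<le> C * (s * (S0 + 1) powr (1/p))"
          using C by (intro mult_left_mono) auto
        then show ?thesis using m[where n = n and c = c and j = j] by (simp add: C'_def mult_ac)
      qed
      have "cmod (\<Sum>k<n. c k * m j k) \<le> C' * sqrt I"
      proof (rule field_le_epsilon)
        fix d :: real assume "0 < d"
        then have "cmod (\<Sum>k<n. c k * m j k) \<le> C' * (sqrt I + d / C')" using C' by (intro bound) auto
        then show "cmod (\<Sum>k<n. c k * m j k) \<le> C' * sqrt I + d" using C' by (simp add: distrib_left)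
      qed
      then show ?thesis using I0 by (simp add: powr_half_sqrt I_def W_def)
    qed
    have ex: "\<exists>f. f \<in> borel_measurable \<kappa> \<and> integrable \<kappa> (\<lambda>x. cmod (f x) powr (2 / (2 - 1))) \<and>
      (\<integral>x. cmod (f x) powr (2 / (2 - 1)) \<partial>\<kappa>) \<le> duality_bound 2 C' \<and>
      (\<forall>k<n. cmod (m j k - (\<integral>x. f x * w k x \<partial>\<kappa>)) \<le> e)" for j
      using C' e wi2 \<phi>[of _ j] by (intro approx_duality) (auto simp: \<kappa>m)
    have "\<exists>f. \<forall>j. f j \<in> borel_measurable \<kappa> \<and> integrable \<kappa> (\<lambda>x. cmod (f j x) powr (2 / (2 - 1))) \<and>
      (\<integral>x. cmod (f j x) powr (2 / (2 - 1)) \<partial>\<kappa>) \<le> duality_bound 2 C' \<and>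
      (\<forall>k<n. cmod (m j k - (\<integral>x. f j x * w k x \<partial>\<kappa>)) \<le> e)"
      by (rule choice, rule allI, rule ex)
    then obtain f where f: "\<And>j. f j \<in> borel_measurable \<kappa>" "\<And>j. integrable \<kappa> (\<lambda>x. cmod (f j x) powr (2 / (2 - 1)))"
      "\<And>j. (\<integral>x. cmod (f j x) powr (2 / (2 - 1)) \<partial>\<kappa>) \<le> duality_bound 2 C'"
      "\<And>j k. k < n \<Longrightarrow> cmod (m j k - (\<integral>x. f j x * w k x \<partial>\<kappa>)) \<le> e" by blast
    have "gram_factor \<kappa> n f (\<lambda>_. A1)"
    proof -
      have "cmod (f j x) powr (2 / (2 - 1)) = (cmod (f j x))\<^sup>2" for j x by (simp add: powr_numeral)
      then have "integrable \<kappa> (\<lambda>x. (cmod (f j x))\<^sup>2)" "(\<integral>x. (cmod (f j x))\<^sup>2 \<partial>\<kappa>) \<le> duality_bound 2 C'" for j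
        using f(2,3)[of j] by simp_all
      then show ?thesis unfolding gram_factor_def A1_def using f(1) DB by simp
    qed
    moreover have "gram_factor \<kappa> n w (\<lambda>k. A2 * \<sigma> k)"
      unfolding gram_factor_def using wi w_int by (simp add: \<kappa>m)
    moreover have "\<forall>j<n. \<forall>k<n. cmod (m j k - (\<integral>x. f j x * w k x \<partial>\<kappa>)) \<le> e" using f(4) by simp
    ultimately show "\<exists>(\<kappa>::'m measure) v w. gram_factor \<kappa> n v (\<lambda>_. A1) \<and> gram_factor \<kappa> n w (\<lambda>k. A2 * \<sigma> k) \<and>
      (\<forall>j<n. \<forall>k<n. cmod (m j k - (\<integral>x. v j x * w k x \<partial>\<kappa>)) \<le> e)" by blast
  qed
  moreover have "0 < A1" "0 < A2" using DB C by (auto simp: A1_def A2_def)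
  ultimately show ?thesis by blast
qed

text \<open>For \<open>p\<close> above 2 an \<open>L_2\<close> norm no longer dominates the
  \<open>L_p\<close> norm on a finite measure, so the density is built from the functionals: they
  are represented by functions \<open>f j\<close> in the dual exponent \<open>p'\<close>, and a
  power of \<open>F\<close> is moved from \<open>f j\<close> to \<open>g k\<close>.\<close>

lemma trace_bound_Lp_ge_2:
  fixes \<nu> :: "'m measure" and g :: "nat \<Rightarrow> 'm \<Rightarrow> complex" and m :: "nat \<Rightarrow> nat \<Rightarrow> complex"
  assumes p: "2 \<le> p" and \<sigma>: "\<And>k. 0 < \<sigma> k" "summable \<sigma>" and C: "0 < C"
    and gm [measurable]: "\<And>k. g k \<in> borel_measurable \<nu>" and gi: "\<And>k. integrable \<nu> (\<lambda>x. cmod (g k x) powr p)"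
    and g_le: "\<And>k. (\<integral>x. cmod (g k x) powr p \<partial>\<nu>) \<le> (C * \<sigma> k powr (3/2 - 1/p)) powr p"
    and m: "\<And>j n c. cmod (\<Sum>k<n. c k * m j k) \<le> C * (\<integral>x. cmod (\<Sum>k<n. c k * g k x) powr p \<partial>\<nu>) powr (1/p)"
  shows "\<exists>A1>0. \<exists>A2>0. trace_bound m (\<lambda>k. A1 * \<sigma> k powr (- (1 - 2/p) / 2)) (\<lambda>k. A2 * \<sigma> k powr (1 + (1 - 2/p) / 2))"
proof -
  define \<theta> where "\<theta> = 1 - 2/p"
  define p' where "p' = p / (p - 1)"
  have \<theta>: "0 \<le> \<theta>" "\<theta> \<le> 1" "2/p + \<theta> = 1" using p by (auto simp: \<theta>_def)
  \<comment> \<open>The identity that makes \<open>\<theta>\<close> the right exponent: dividing the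
    square of \<open>f j\<close> by \<open>F powr \<theta>\<close> leaves the integrable power
    \<open>p'\<close>.\<close>
  have p'\<theta>: "2 - p' * \<theta> = p'" using p by (simp add: p'_def \<theta>_def field_simps)
  define B where "B = duality_bound p C"
  have B: "1 \<le> B" unfolding B_def using p C by (intro duality_bound_ge_1) auto
  have S: "0 \<le> suminf \<sigma>" using \<sigma> by (intro suminf_nonneg) (auto intro: less_imp_le)
  define A1 where "A1 = sqrt B"
  define A2 where "A2 = C * sqrt (1 + B * suminf \<sigma>)"
  have "trace_bound m (\<lambda>k. A1 * \<sigma> k powr (- \<theta> / 2)) (\<lambda>k. A2 * \<sigma> k powr (1 + \<theta> / 2))"
  proof (rule trace_bound_approx)
    fix n :: nat and e :: real assume e: "0 < e"
    have ex: "\<exists>f. f \<in> borel_measurable \<nu> \<and> integrable \<nu> (\<lambda>x. cmod (f x) powr (p / (p - 1))) \<and>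
      (\<integral>x. cmod (f x) powr (p / (p - 1)) \<partial>\<nu>) \<le> duality_bound p C \<and>
      (\<forall>k<n. cmod (m j k - (\<integral>x. f x * g k x \<partial>\<nu>)) \<le> e)" for j
      using p C e gi m by (intro approx_duality) auto
    have "\<exists>f. \<forall>j. f j \<in> borel_measurable \<nu> \<and> integrable \<nu> (\<lambda>x. cmod (f j x) powr (p / (p - 1))) \<and>
      (\<integral>x. cmod (f j x) powr (p / (p - 1)) \<partial>\<nu>) \<le> duality_bound p C \<and>
      (\<forall>k<n. cmod (m j k - (\<integral>x. f j x * g k x \<partial>\<nu>)) \<le> e)"
      by (rule choice, rule allI, rule ex)
    then obtain f where f [measurable]: "\<And>j. f j \<in> borel_measurable \<nu>" and fi: "\<And>j. integrable \<nu> (\<lambda>x. cmod (f j x) powr p')"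
      and f_le: "\<And>j. (\<integral>x. cmod (f j x) powr p' \<partial>\<nu>) \<le> B"
      and mf: "\<And>j k. k < n \<Longrightarrow> cmod (m j k - (\<integral>x. f j x * g k x \<partial>\<nu>)) \<le> e" unfolding p'_def B_def by blast
    \<comment> \<open>The \<open>f j\<close> are only uniformly bounded, so the factor
      \<open>\<sigma> j\<close> is what bounds the integral of \<open>F\<close> independently of
      \<open>n\<close>. It costs the growing factor \<open>\<sigma> j powr (- \<theta> / 2)\<close>
      in the row weights, repaid in the column weights.\<close>
    define F where "F x = (\<Sum>j<n. \<sigma> j * cmod (f j x) powr p')" for x
    have Fm [measurable]: "F \<in> borel_measurable \<nu>" unfolding F_def by measurable
    have F0: "0 \<le> F x" for x unfolding F_def using \<sigma>(1) by (intro sum_nonneg mult_nonneg_nonneg) (auto intro: less_imp_le)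
    have F_ge: "\<sigma> j * cmod (f j x) powr p' \<le> F x" if "j < n" for j x
      unfolding F_def using that \<sigma>(1) by (intro member_le_sum[where f = "\<lambda>j. \<sigma> j * cmod (f j x) powr p'"])
        (auto intro!: mult_nonneg_nonneg less_imp_le[OF \<sigma>(1)])
    have Fi: "integrable \<nu> F" unfolding F_def using fi by (intro Bochner_Integration.integrable_sum integrable_mult_right)
    have F_int: "(\<integral>x. F x \<partial>\<nu>) \<le> B * suminf \<sigma>"
    proof -
      have "(\<integral>x. F x \<partial>\<nu>) = (\<Sum>j<n. \<sigma> j * (\<integral>x. cmod (f j x) powr p' \<partial>\<nu>))"
        unfolding F_def using fi by (subst Bochner_Integration.integral_sum) auto
      also have "\<dots> \<le> (\<Sum>j<n. \<sigma> j * B)" using f_le \<sigma>(1) by (intro sum_mono mult_left_mono) (auto intro: less_imp_le)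
      also have "\<dots> = (\<Sum>j<n. \<sigma> j) * B" by (simp add: sum_distrib_right)
      also have "\<dots> \<le> suminf \<sigma> * B" using \<sigma> B by (intro mult_right_mono sum_le_suminf) (auto intro: less_imp_le)
      finally show ?thesis by (simp add: mult.commute)
    qed
    define v where "v j x = f j x * complex_of_real (F x powr (- \<theta> / 2))" for j x
    define w where "w k x = g k x * complex_of_real (F x powr (\<theta> / 2))" for k x
    have vm [measurable]: "v j \<in> borel_measurable \<nu>" and wm [measurable]: "w j \<in> borel_measurable \<nu>" for j
      unfolding v_def w_def by measurable
    have vw: "v j x * w k x = f j x * g k x" if j: "j < n" for j k x
    proof (cases "f j x = 0")
      case False
      then have "0 < \<sigma> j * cmod (f j x) powr p'" using \<sigma>(1)[of j] by simp
      then have Fp: "0 < F x" using F_ge[OF j, of x] by linarith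
      have "complex_of_real (F x powr (- \<theta> / 2)) * complex_of_real (F x powr (\<theta> / 2)) = complex_of_real (F x powr (- \<theta> / 2 + \<theta> / 2))"
        by (simp only: of_real_mult[symmetric] powr_add[symmetric])
      also have "\<dots> = 1" using Fp by simp
      finally show ?thesis unfolding v_def w_def by (metis (no_types, lifting) mult.assoc mult.commute mult.left_neutral)
    qed (simp add: v_def)
    have v_le: "(cmod (v j x))\<^sup>2 \<le> \<sigma> j powr (- \<theta>) * cmod (f j x) powr p'" if j: "j < n" for j x
    proof (cases "f j x = 0")
      case False
      define y where "y = cmod (f j x)"
      have y: "0 < y" using False by (simp add: y_def)
      define h0 where "h0 = \<sigma> j * y powr p'"
      have h0: "0 < h0" using \<sigma>(1)[of j] y by (simp add: h0_def)
      have hF: "h0 \<le> F x" unfolding h0_def y_def by (rule F_ge[OF j])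
      have "(cmod (v j x))\<^sup>2 = y\<^sup>2 * (F x powr (- \<theta> / 2) * F x powr (- \<theta> / 2))"
        by (simp add: v_def norm_mult power_mult_distrib y_def power2_eq_square)
      also have "F x powr (- \<theta> / 2) * F x powr (- \<theta> / 2) = F x powr (- \<theta>)" by (simp add: powr_add[symmetric])
      also have "F x powr (- \<theta>) \<le> h0 powr (- \<theta>)" using \<theta> h0 hF by (intro powr_mono2') auto
      also have "h0 powr (- \<theta>) = \<sigma> j powr (- \<theta>) * y powr (p' * (- \<theta>))" unfolding h0_def by (simp only: powr_mult powr_powr)
      finally have "(cmod (v j x))\<^sup>2 \<le> y\<^sup>2 * (\<sigma> j powr (- \<theta>) * y powr (p' * (- \<theta>)))" by (simp add: mult_left_mono)
      also have "\<dots> = \<sigma> j powr (- \<theta>) * (y powr 2 * y powr (p' * (- \<theta>)))" using y by (simp add: powr_numeral mult_ac)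
      also have "y powr 2 * y powr (p' * (- \<theta>)) = y powr (2 - p' * \<theta>)" by (simp add: powr_add[symmetric])
      finally show ?thesis unfolding p'\<theta> by (simp add: y_def)
    qed (simp add: v_def)
    \<comment> \<open>An upper bound for the integral of \<open>cmod (g k x) powr p\<close>; after
      division by it the first term of Young's inequality integrates to at most 1.\<close>
    define s where "s k = (C * \<sigma> k powr (3/2 - 1/p)) powr p" for k
    have s: "0 < s k" for k using C \<sigma>(1)[of k] by (simp add: s_def)
    have s2: "s k powr (2/p) = C\<^sup>2 * (\<sigma> k powr (1 + \<theta>/2))\<^sup>2" for k
    proof -
      have "s k powr (2/p) = C powr (p * (2/p)) * \<sigma> k powr ((3/2 - 1/p) * p * (2/p))"
        unfolding s_def by (simp only: powr_mult powr_powr mult.assoc)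
      also have "p * (2/p) = 2" using p by simp
      also have "(3/2 - 1/p) * p * (2/p) = (1 + \<theta>/2) + (1 + \<theta>/2)" using p by (simp add: \<theta>_def field_simps)
      also have "\<sigma> k powr ((1 + \<theta>/2) + (1 + \<theta>/2)) = (\<sigma> k powr (1 + \<theta>/2))\<^sup>2" by (simp only: powr_add power2_eq_square)
      finally show ?thesis using C by (simp add: powr_numeral)
    qed
    have w_le: "(cmod (w k x))\<^sup>2 \<le> s k powr (2/p) * (cmod (g k x) powr p / s k + F x)" for k x
    proof (cases "g k x = 0 \<or> F x = 0")
      case True
      then show ?thesis using F0[of x] s[of k] by (auto simp: w_def)
    next
      case False
      define a where "a = cmod (g k x) powr p / s k"
      have a: "0 < a" and Fp: "0 < F x" using False s[of k] F0[of x] by (auto simp: a_def)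
      have "(cmod (w k x))\<^sup>2 = (cmod (g k x))\<^sup>2 * (F x powr (\<theta> / 2) * F x powr (\<theta> / 2))"
        by (simp add: w_def norm_mult power_mult_distrib power2_eq_square)
      also have "F x powr (\<theta> / 2) * F x powr (\<theta> / 2) = F x powr \<theta>" by (simp add: powr_add[symmetric])
      also have "(cmod (g k x))\<^sup>2 = s k powr (2/p) * a powr (2/p)"
        using s[of k] p by (simp add: a_def powr_divide powr_powr powr_numeral)
      also have "s k powr (2/p) * a powr (2/p) * F x powr \<theta> = s k powr (2/p) * (a powr (2/p) * F x powr \<theta>)" by simp
      \<comment> \<open>Weighted Young inequality with the weights \<open>2/p\<close> and
        \<open>\<theta>\<close>, which add up to 1.\<close>
      also have "\<dots> \<le> s k powr (2/p) * (2/p * a + \<theta> * F x)"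
        using \<theta> p a Fp by (intro mult_left_mono Youngs_inequality_0) auto
      also have "\<dots> \<le> s k powr (2/p) * (1 * a + 1 * F x)"
        using \<theta> p a Fp by (intro mult_left_mono add_mono mult_right_mono) auto
      finally show ?thesis by (simp add: a_def)
    qed
    have w_bound_int: "integrable \<nu> (\<lambda>x. s k powr (2/p) * (cmod (g k x) powr p / s k + F x))" for k
      using gi[of k] Fi by (intro integrable_mult_right Bochner_Integration.integrable_add integrable_divide) auto
    have vi: "integrable \<nu> (\<lambda>x. (cmod (v j x))\<^sup>2)" if "j < n" for j
    proof (rule Bochner_Integration.integrable_bound)
      show "integrable \<nu> (\<lambda>x. \<sigma> j powr (- \<theta>) * cmod (f j x) powr p')" using fi by (rule integrable_mult_right)
    qed (use v_le[OF that] in auto)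
    have wi: "integrable \<nu> (\<lambda>x. (cmod (w k x))\<^sup>2)" for k
    proof (rule Bochner_Integration.integrable_bound[OF w_bound_int])
      show "AE x in \<nu>. norm ((cmod (w k x))\<^sup>2) \<le> norm (s k powr (2/p) * (cmod (g k x) powr p / s k + F x))"
        using w_le by (intro AE_I2) (auto intro: order.trans[OF _ abs_ge_self])
    qed measurable
    have "gram_factor \<nu> n v (\<lambda>k. A1 * \<sigma> k powr (- \<theta> / 2))"
      unfolding gram_factor_def
    proof (intro allI impI conjI vi vm)
      fix j assume j: "j < n"
      have "(\<integral>x. (cmod (v j x))\<^sup>2 \<partial>\<nu>) \<le> (\<integral>x. \<sigma> j powr (- \<theta>) * cmod (f j x) powr p' \<partial>\<nu>)"
        using v_le[OF j] by (intro integral_mono vi j integrable_mult_right fi)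
      also have "\<dots> \<le> \<sigma> j powr (- \<theta>) * B" using f_le by (simp add: mult_left_mono)
      also have "\<sigma> j powr (- \<theta>) = (\<sigma> j powr (- \<theta> / 2))\<^sup>2" by (simp add: power2_eq_square powr_add[symmetric])
      finally show "(\<integral>x. (cmod (v j x))\<^sup>2 \<partial>\<nu>) \<le> (A1 * \<sigma> j powr (- \<theta> / 2))\<^sup>2"
        using B by (simp add: A1_def power_mult_distrib mult.commute)
    qed
    moreover have "gram_factor \<nu> n w (\<lambda>k. A2 * \<sigma> k powr (1 + \<theta> / 2))"
      unfolding gram_factor_def
    proof (intro allI impI conjI wi wm)
      fix k
      have "(\<integral>x. (cmod (w k x))\<^sup>2 \<partial>\<nu>) \<le> (\<integral>x. s k powr (2/p) * (cmod (g k x) powr p / s k + F x) \<partial>\<nu>)"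
        using w_le by (intro integral_mono wi w_bound_int)
      also have "\<dots> = s k powr (2/p) * ((\<integral>x. cmod (g k x) powr p \<partial>\<nu>) / s k + (\<integral>x. F x \<partial>\<nu>))"
        using gi[of k] Fi by simp
      also have "\<dots> \<le> s k powr (2/p) * (1 + B * suminf \<sigma>)"
        using g_le[of k] s[of k] F_int by (intro mult_left_mono add_mono) (auto simp: s_def[symmetric])
      finally show "(\<integral>x. (cmod (w k x))\<^sup>2 \<partial>\<nu>) \<le> (A2 * \<sigma> k powr (1 + \<theta> / 2))\<^sup>2"
        using B S by (simp add: s2 A2_def power_mult_distrib mult_ac)
    qed
    moreover have "\<forall>j<n. \<forall>k<n. cmod (m j k - (\<integral>x. v j x * w k x \<partial>\<nu>)) \<le> e"
      using mf vw by simp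
    ultimately show "\<exists>(\<kappa>::'m measure) v w. gram_factor \<kappa> n v (\<lambda>k. A1 * \<sigma> k powr (- \<theta> / 2)) \<and>
      gram_factor \<kappa> n w (\<lambda>k. A2 * \<sigma> k powr (1 + \<theta> / 2)) \<and>
      (\<forall>j<n. \<forall>k<n. cmod (m j k - (\<integral>x. v j x * w k x \<partial>\<kappa>)) \<le> e)" by blast
  qed
  moreover have "0 < A1" using B by (simp add: A1_def)
  moreover have "0 < A2"
  proof -
    have "0 < 1 + B * suminf \<sigma>" using B S by (intro add_pos_nonneg mult_nonneg_nonneg) auto
    then show ?thesis using C by (simp add: A2_def)
  qed
  ultimately show ?thesis unfolding \<theta>_def by blast
qed

section \<open>Nuclear operators on subspaces and quotients of $L_p$\<close>

lemma summable_powr: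
  fixes \<sigma> :: "nat \<Rightarrow> real"
  assumes "\<And>k. 0 < \<sigma> k" "summable \<sigma>" "1 \<le> q"
  shows "summable (\<lambda>k. \<sigma> k powr q)"
proof (rule summable_comparison_test_ev[OF _ assms(2)])
  have "eventually (\<lambda>k. \<sigma> k < 1) sequentially"
    by (rule order_tendstoD(2)[OF summable_LIMSEQ_zero[OF assms(2)]]) simp
  then show "eventually (\<lambda>k. norm (\<sigma> k powr q) \<le> \<sigma> k) sequentially"
  proof eventually_elim
    case (elim k)
    then show ?case using assms(1)[of k] assms(3) powr_le_one_le[of "\<sigma> k" q] by simp
  qed
qed

lemma cdual_sum_cscale:
  assumes J: "complex_structure J" and f: "cdual J f"
  shows "f (\<Sum>k<n. cscale J (c k) (y k)) = (\<Sum>k<n. c k * f (y k))"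
proof -
  have lin: "linear f" using f by (simp add: cdual_def bounded_linear.linear)
  have sc: "f (cscale J a x) = a * f x" for a x
  proof -
    have "f (J x) = \<i> * f x" using f by (simp add: cdual_def)
    then have "f (cscale J a x) = of_real (Re a) * f x + of_real (Im a) * (\<i> * f x)"
      by (simp add: cscale_def linear_add[OF lin] linear_scale[OF lin] scaleR_conv_of_real)
    also have "\<dots> = (of_real (Re a) + \<i> * of_real (Im a)) * f x" by (simp add: algebra_simps)
    finally show ?thesis by (simp add: complex_eq[symmetric])
  qed
  show ?thesis by (simp add: linear_sum[OF lin] sc)
qed

lemma powr_inverse_le:
  fixes X Y P :: real
  assumes "1 \<le> P" "0 \<le> X" "X powr (1 / P) \<le> Y"
  shows "X \<le> Y powr P"
proof -
  have "(X powr (1 / P)) powr P \<le> Y powr P" using assms by (intro powr_mono2) auto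
  then show ?thesis using assms by (simp add: powr_powr)
qed

text \<open>Here \<open>g k\<close> is the image of \<open>y k\<close>. The embedding is linear only
  almost everywhere, so additivity over finite sums is collected by induction before norms are
  compared.\<close>

lemma subspace_Lp_realization:
  fixes J :: "'a::real_normed_vector \<Rightarrow> 'a" and y :: "nat \<Rightarrow> 'a"
  assumes J: "complex_structure J" and P: "1 \<le> P" and Y: "iso_subspace_Lp J (ereal P) \<nu>"
  shows "\<exists>C>0. \<exists>g. (\<forall>k. g k \<in> borel_measurable \<nu> \<and> integrable \<nu> (\<lambda>x. cmod (g k x) powr P) \<and>
      (\<integral>x. cmod (g k x) powr P \<partial>\<nu>) \<le> (C * norm (y k)) powr P) \<and>
    (\<forall>n c. norm (\<Sum>k<n. cscale J (c k) (y k)) \<le> C * (\<integral>x. cmod (\<Sum>k<n. c k * g k x) powr P \<partial>\<nu>) powr (1 / P))"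
proof -
  obtain U :: "'a \<Rightarrow> 'b \<Rightarrow> complex" and c0 C0 where c0: "c0 > 0" and U: "\<And>y. Lp_mem (ereal P) \<nu> (U y)"
    and U_add: "\<And>y z. AE x in \<nu>. U (y + z) x = U y x + U z x"
    and U_sc: "\<And>a y. AE x in \<nu>. U (cscale J a y) x = a * U y x"
    and U_le: "\<And>y. c0 * norm y \<le> Lp_norm (ereal P) \<nu> (U y)" "\<And>y. Lp_norm (ereal P) \<nu> (U y) \<le> C0 * norm y"
    using Y unfolding iso_subspace_Lp_def by blast
  have Um [measurable]: "U y \<in> borel_measurable \<nu>" and Ui: "integrable \<nu> (\<lambda>x. cmod (U y x) powr P)" for y
    using U[of y] by (auto simp: Lp_mem_def)
  have Lp: "Lp_norm (ereal P) \<nu> f = (\<integral>x. cmod (f x) powr P \<partial>\<nu>) powr (1 / P)" for f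
    by (simp add: Lp_norm_def)
  define C where "C = max 1 (max C0 (1 / c0))"
  have C: "0 < C" "C0 \<le> C" "1 / c0 \<le> C" by (auto simp: C_def)
  have "(\<integral>x. cmod (U (y k) x) powr P \<partial>\<nu>) \<le> (C * norm (y k)) powr P" for k
  proof (rule powr_inverse_le[OF P])
    show "0 \<le> (\<integral>x. cmod (U (y k) x) powr P \<partial>\<nu>)" by (intro Bochner_Integration.integral_nonneg) auto
    have "C0 * norm (y k) \<le> C * norm (y k)" using C by (intro mult_right_mono) auto
    then show "(\<integral>x. cmod (U (y k) x) powr P \<partial>\<nu>) powr (1 / P) \<le> C * norm (y k)"
      using U_le(2)[of "y k"] unfolding Lp by linarith
  qed
  moreover have "norm (\<Sum>k<n. cscale J (c k) (y k)) \<le> C * (\<integral>x. cmod (\<Sum>k<n. c k * U (y k) x) powr P \<partial>\<nu>) powr (1 / P)" for n c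
  proof -
    have ae: "AE x in \<nu>. U (\<Sum>k<n. cscale J (c k) (y k)) x = (\<Sum>k<n. c k * U (y k) x)"
    proof (induction n)
      case 0
      have "cscale J 0 0 = 0" by (simp add: cscale_def)
      then show ?case using U_sc[of 0 0] by simp
    next
      case (Suc n)
      show ?case
        using Suc U_add[of "\<Sum>k<n. cscale J (c k) (y k)" "cscale J (c n) (y n)"] U_sc[of "c n" "y n"]
        by eventually_elim simp
    qed
    have "(\<integral>x. cmod (U (\<Sum>k<n. cscale J (c k) (y k)) x) powr P \<partial>\<nu>) = (\<integral>x. cmod (\<Sum>k<n. c k * U (y k) x) powr P \<partial>\<nu>)"
    proof (rule integral_cong_AE)
      show "AE x in \<nu>. cmod (U (\<Sum>k<n. cscale J (c k) (y k)) x) powr P = cmod (\<Sum>k<n. c k * U (y k) x) powr P"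
        using ae by eventually_elim simp
    qed measurable
    then have "c0 * norm (\<Sum>k<n. cscale J (c k) (y k)) \<le> (\<integral>x. cmod (\<Sum>k<n. c k * U (y k) x) powr P \<partial>\<nu>) powr (1 / P)"
      using U_le(1)[of "\<Sum>k<n. cscale J (c k) (y k)"] unfolding Lp by simp
    then have "norm (\<Sum>k<n. cscale J (c k) (y k)) \<le> (1 / c0) * (\<integral>x. cmod (\<Sum>k<n. c k * U (y k) x) powr P \<partial>\<nu>) powr (1 / P)"
      using c0 by (simp add: field_simps)
    also have "\<dots> \<le> C * (\<integral>x. cmod (\<Sum>k<n. c k * U (y k) x) powr P \<partial>\<nu>) powr (1 / P)"
      using C by (intro mult_right_mono) auto
    finally show ?thesis .
  qed
  ultimately show ?thesis using C(1) Um Ui by (intro exI[of _ C] conjI exI[of _ "\<lambda>k. U (y k)"]) auto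
qed

text \<open>Here \<open>g k\<close> is a lift of \<open>y k\<close> with controlled norm. The lifts
  are chosen separately for each \<open>k\<close>; linearity is demanded of the quotient map
  alone.\<close>

lemma quotient_Lp_realization:
  fixes J :: "'a::real_normed_vector \<Rightarrow> 'a" and y :: "nat \<Rightarrow> 'a"
  assumes J: "complex_structure J" and P: "1 \<le> P" and Y: "iso_quotient_Lp J (ereal P) \<nu>"
  shows "\<exists>C>0. \<exists>g. (\<forall>k. g k \<in> borel_measurable \<nu> \<and> integrable \<nu> (\<lambda>x. cmod (g k x) powr P) \<and>
      (\<integral>x. cmod (g k x) powr P \<partial>\<nu>) \<le> (C * norm (y k)) powr P) \<and>
    (\<forall>n c. norm (\<Sum>k<n. cscale J (c k) (y k)) \<le> C * (\<integral>x. cmod (\<Sum>k<n. c k * g k x) powr P \<partial>\<nu>) powr (1 / P))"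
proof -
  obtain Q :: "('b \<Rightarrow> complex) \<Rightarrow> 'a" and C0 where
    Q_add: "\<And>f g. Lp_mem (ereal P) \<nu> f \<Longrightarrow> Lp_mem (ereal P) \<nu> g \<Longrightarrow> Q (\<lambda>x. f x + g x) = Q f + Q g"
    and Q_sc: "\<And>a f. Lp_mem (ereal P) \<nu> f \<Longrightarrow> Q (\<lambda>x. a * f x) = cscale J a (Q f)"
    and Q_le: "\<And>f. Lp_mem (ereal P) \<nu> f \<Longrightarrow> norm (Q f) \<le> C0 * Lp_norm (ereal P) \<nu> f"
    and Q_surj: "\<And>y. \<exists>f. Lp_mem (ereal P) \<nu> f \<and> Q f = y \<and> Lp_norm (ereal P) \<nu> f \<le> C0 * norm y"
    using Y unfolding iso_quotient_Lp_def by blast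
  have Lp: "Lp_norm (ereal P) \<nu> f = (\<integral>x. cmod (f x) powr P \<partial>\<nu>) powr (1 / P)" for f
    by (simp add: Lp_norm_def)
  have mem: "Lp_mem (ereal P) \<nu> f \<longleftrightarrow> f \<in> borel_measurable \<nu> \<and> integrable \<nu> (\<lambda>x. cmod (f x) powr P)" for f
    by (simp add: Lp_mem_def)
  have "\<forall>k. \<exists>f. Lp_mem (ereal P) \<nu> f \<and> Q f = y k \<and> Lp_norm (ereal P) \<nu> f \<le> C0 * norm (y k)" using Q_surj by blast
  then obtain g where g: "\<And>k. Lp_mem (ereal P) \<nu> (g k)" "\<And>k. Q (g k) = y k" "\<And>k. Lp_norm (ereal P) \<nu> (g k) \<le> C0 * norm (y k)"
    by metis
  have gm [measurable]: "g k \<in> borel_measurable \<nu>" and gi: "integrable \<nu> (\<lambda>x. cmod (g k x) powr P)" for k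
    using g(1)[of k] by (auto simp: mem)
  define C where "C = max 1 C0"
  have C: "0 < C" "C0 \<le> C" by (auto simp: C_def)
  have "(\<integral>x. cmod (g k x) powr P \<partial>\<nu>) \<le> (C * norm (y k)) powr P" for k
  proof (rule powr_inverse_le[OF P])
    show "0 \<le> (\<integral>x. cmod (g k x) powr P \<partial>\<nu>)" by (intro Bochner_Integration.integral_nonneg) auto
    have "C0 * norm (y k) \<le> C * norm (y k)" using C by (intro mult_right_mono) auto
    then show "(\<integral>x. cmod (g k x) powr P \<partial>\<nu>) powr (1 / P) \<le> C * norm (y k)"
      using g(3)[of k] unfolding Lp by linarith
  qed
  moreover have "norm (\<Sum>k<n. cscale J (c k) (y k)) \<le> C * (\<integral>x. cmod (\<Sum>k<n. c k * g k x) powr P \<partial>\<nu>) powr (1 / P)" for n c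
  proof -
    have lc: "Lp_mem (ereal P) \<nu> (\<lambda>x. \<Sum>k<n. c k * g k x)" for n
      unfolding mem using gi P by (intro conjI integrable_powr_linear_comb) auto
    have Qs: "Q (\<lambda>x. \<Sum>k<n. c k * g k x) = (\<Sum>k<n. cscale J (c k) (y k))"
    proof (induction n)
      case 0
      have "Q (\<lambda>x. 0 * (\<Sum>k<0. c k * g k x)) = cscale J 0 (Q (\<lambda>x. \<Sum>k<0. c k * g k x))" by (rule Q_sc[OF lc])
      then show ?case by (simp add: cscale_def)
    next
      case (Suc n)
      have "Lp_mem (ereal P) \<nu> (\<lambda>x. c n * g n x)"
        using gi[of n] by (simp add: mem norm_mult powr_mult)
      from Q_add[OF lc[of n] this] show ?case using Suc Q_sc[OF g(1), of "c n" n] g(2)[of n] by simp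
    qed
    have "norm (\<Sum>k<n. cscale J (c k) (y k)) \<le> C0 * (\<integral>x. cmod (\<Sum>k<n. c k * g k x) powr P \<partial>\<nu>) powr (1 / P)"
      using Q_le[OF lc[of n]] unfolding Qs Lp .
    also have "\<dots> \<le> C * (\<integral>x. cmod (\<Sum>k<n. c k * g k x) powr P \<partial>\<nu>) powr (1 / P)"
      using C by (intro mult_right_mono) auto
    finally show ?thesis .
  qed
  ultimately show ?thesis using C(1) gm gi by (intro exI[of _ C] conjI exI[of _ g]) auto
qed

text \<open>Brings the ranges of \<open>p\<close> to a common shape: \<open>\<theta> = 0\<close> for
  \<open>p \<le> 2\<close> and for \<open>p = \<infinity>\<close>, and
  \<open>\<theta> = (1 - 2/P) / 2\<close> in between. In every case the product of the weights is
  proportional to \<open>\<sigma> k\<close> and their quotient to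
  \<open>\<sigma> k powr (1 + 2 * \<theta>)\<close>.\<close>

lemma trace_bound_weights:
  fixes J :: "'a::real_normed_vector \<Rightarrow> 'a" and p :: ereal
  assumes J: "complex_structure J" and p: "1 \<le> p"
    and s: "1 / s = 1 + \<bar>1/2 - real_of_ereal (1 / p)\<bar>"
    and Y: "iso_subspace_Lp J p \<nu> \<or> iso_quotient_Lp J p \<nu>"
    and yd: "\<And>k. cdual J (yd k)" "\<And>k x. cmod (yd k x) \<le> norm x"
    and \<sigma>: "\<And>k. 0 < \<sigma> k" "summable \<sigma>" and yv: "\<And>k. norm (yv k) \<le> \<sigma> k powr (1 / s)"
  shows "\<exists>A1>0. \<exists>A2>0. \<exists>\<theta>\<ge>0. trace_bound (\<lambda>j k. yd j (yv k)) (\<lambda>k. A1 * \<sigma> k powr (- \<theta>)) (\<lambda>k. A2 * \<sigma> k powr (1 + \<theta>))"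
proof (cases p)
  case PInf
  then have s32: "1 / s = 3/2" using s by simp
  have "trace_bound (\<lambda>j k. yd j (yv k)) (\<lambda>_. sqrt (suminf \<sigma>)) \<sigma>"
    using yd(2) yv unfolding s32 by (intro trace_bound_sup \<sigma>) (meson order.trans)
  moreover have "0 < suminf \<sigma>" using \<sigma> by (intro suminf_pos) auto
  moreover have "\<sigma> k powr 1 = \<sigma> k" "\<sigma> k powr 0 = 1" for k using \<sigma>(1)[of k] by simp_all
  ultimately show ?thesis
    by (intro exI[of _ "sqrt (suminf \<sigma>)"] conjI exI[of _ "1::real"] exI[of _ "0::real"]) simp_all
next
  case MInf
  then show ?thesis using p by simp
next
  case (real P)
  have P: "1 \<le> P" using p real by simp
  have sP: "1 / s = 1 + \<bar>1/2 - 1/P\<bar>" using s P real by (simp add: one_ereal_def)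
  have "\<exists>C>0. \<exists>g. (\<forall>k. g k \<in> borel_measurable \<nu> \<and> integrable \<nu> (\<lambda>x. cmod (g k x) powr P) \<and>
      (\<integral>x. cmod (g k x) powr P \<partial>\<nu>) \<le> (C * norm (yv k)) powr P) \<and>
    (\<forall>n c. norm (\<Sum>k<n. cscale J (c k) (yv k)) \<le> C * (\<integral>x. cmod (\<Sum>k<n. c k * g k x) powr P \<partial>\<nu>) powr (1 / P))"
    using Y unfolding real by (elim disjE) (rule subspace_Lp_realization[OF J P], assumption, rule quotient_Lp_realization[OF J P])
  then obtain C g where C: "0 < C" and gm: "\<And>k. g k \<in> borel_measurable \<nu>" and gi: "\<And>k. integrable \<nu> (\<lambda>x. cmod (g k x) powr P)"
    and g_le: "\<And>k. (\<integral>x. cmod (g k x) powr P \<partial>\<nu>) \<le> (C * norm (yv k)) powr P"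
    and lc: "\<And>n c. norm (\<Sum>k<n. cscale J (c k) (yv k)) \<le> C * (\<integral>x. cmod (\<Sum>k<n. c k * g k x) powr P \<partial>\<nu>) powr (1 / P)"
    by blast
  have g_le': "(\<integral>x. cmod (g k x) powr P \<partial>\<nu>) \<le> (C * \<sigma> k powr (1 / s)) powr P" for k
    using C P yv[of k] by (intro order.trans[OF g_le] powr_mono2 mult_left_mono) auto
  have m: "cmod (\<Sum>k<n. c k * yd j (yv k)) \<le> C * (\<integral>x. cmod (\<Sum>k<n. c k * g k x) powr P \<partial>\<nu>) powr (1 / P)" for j n c
    using order.trans[OF yd(2) lc, of j] unfolding cdual_sum_cscale[OF J yd(1)] .
  show ?thesis
  proof (cases "P \<le> 2")
    case True
    then have "1 / s = 1/2 + 1/P" using sP P by (simp add: field_simps abs_if)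
    then have "\<exists>A1>0. \<exists>A2>0. trace_bound (\<lambda>j k. yd j (yv k)) (\<lambda>_. A1) (\<lambda>k. A2 * \<sigma> k)"
      using g_le' by (intro trace_bound_Lp_le_2[OF P True \<sigma> C gm gi _ m]) simp
    then obtain A1 A2 where A: "0 < A1" "0 < A2" "trace_bound (\<lambda>j k. yd j (yv k)) (\<lambda>_. A1) (\<lambda>k. A2 * \<sigma> k)" by blast
    have "\<sigma> k powr 1 = \<sigma> k" "\<sigma> k powr 0 = 1" for k using \<sigma>(1)[of k] by simp_all
    then show ?thesis using A by (intro exI[of _ A1] conjI exI[of _ A2] exI[of _ "0::real"]) simp_all
  next
    case False
    then have P2: "2 \<le> P" by simp
    then have "1 / s = 3/2 - 1/P" using sP by (simp add: field_simps abs_if)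
    then have "\<exists>A1>0. \<exists>A2>0. trace_bound (\<lambda>j k. yd j (yv k)) (\<lambda>k. A1 * \<sigma> k powr (- (1 - 2/P) / 2)) (\<lambda>k. A2 * \<sigma> k powr (1 + (1 - 2/P) / 2))"
      using g_le' by (intro trace_bound_Lp_ge_2[OF P2 \<sigma> C gm gi _ m]) simp
    then obtain A1 A2 where A: "0 < A1" "0 < A2"
      "trace_bound (\<lambda>j k. yd j (yv k)) (\<lambda>k. A1 * \<sigma> k powr (- (1 - 2/P) / 2)) (\<lambda>k. A2 * \<sigma> k powr (1 + (1 - 2/P) / 2))" by blast
    have "- ((1 - 2/P) / 2) = - (1 - 2/P) / 2" by (rule minus_divide_left)
    moreover have "0 \<le> (1 - 2/P) / 2" using P2 by simp
    ultimately show ?thesis using A by (intro exI[of _ A1] conjI exI[of _ A2] exI[of _ "(1 - 2/P) / 2"]) (simp_all only:)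
  qed
qed

text \<open>The norms of the functionals are moved onto the vectors, which changes neither the
  rank-one terms nor the numbers whose sum is the trace.\<close>

lemma nuclear_rep_nuclear_operator:
  fixes J :: "'a::banach \<Rightarrow> 'a" and p :: ereal and \<nu> :: "'m measure"
  assumes J: "complex_structure J" and p: "1 \<le> p"
    and s: "1 / s = 1 + \<bar>1/2 - real_of_ereal (1 / p)\<bar>"
    and Y: "iso_subspace_Lp J p \<nu> \<or> iso_quotient_Lp J p \<nu>"
    and rep: "nuclear_rep J s T yd0 yv0"
  shows "\<exists>yd yv \<alpha> \<beta>. nuclear_operator J T yd yv \<alpha> \<beta> \<and> (\<forall>k. yd k (yv k) = yd0 k (yv0 k))"
proof -
  have s1: "1 \<le> 1 / s" using s by simp
  then have "0 < 1 / s" by linarith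
  then have s0: "0 < s" by (simp add: zero_less_divide_iff)
  interpret sc: bounded_bilinear "cscale J" by (rule bounded_bilinear_cscale[OF J])
  interpret vs: vector_space "cscale J" by (rule vector_space_cscale[OF J])
  have yd0: "\<And>k. cdual J (yd0 k)" and sm: "summable (\<lambda>k. (onorm (yd0 k) * norm (yv0 k)) powr s)"
    and T: "\<And>x. (\<lambda>k. cscale J (yd0 k x) (yv0 k)) sums T x"
    using rep by (auto simp: nuclear_rep_def)
  have bl: "bounded_linear (yd0 k)" and ydJ: "yd0 k (J x) = \<i> * yd0 k x" for k x using yd0[of k] by (auto simp: cdual_def)
  define N where "N k = onorm (yd0 k)" for k
  have N0: "0 \<le> N k" for k unfolding N_def by (rule onorm_pos_le[OF bl])
  have N: "cmod (yd0 k x) \<le> N k * norm x" for k x unfolding N_def by (rule onorm[OF bl])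
  \<comment> \<open>If \<open>N k = 0\<close>, division by zero gives \<open>yd k = 0\<close> and
    \<open>yv k = 0\<close>, in agreement with the vanishing original term.\<close>
  define yd where "yd k x = yd0 k x * complex_of_real (1 / N k)" for k x
  define yv where "yv k = cscale J (complex_of_real (N k)) (yv0 k)" for k
  \<comment> \<open>The geometric summand keeps \<open>\<sigma> k\<close> strictly positive, so that
    negative powers make sense, without losing summability.\<close>
  define \<sigma> where "\<sigma> k = (N k * norm (yv0 k)) powr s + (1/2) ^ k" for k
  have \<sigma>: "0 < \<sigma> k" for k unfolding \<sigma>_def by (intro add_nonneg_pos) auto
  have \<sigma>s: "summable \<sigma>" unfolding \<sigma>_def[abs_def] N_def by (intro summable_add sm summable_geometric) simp
  have yd_cdual: "cdual J (yd k)" for k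
  proof -
    have "bounded_linear (yd k)" unfolding yd_def by (rule bounded_linear_mult_const[OF bl])
    then show ?thesis by (simp add: cdual_def yd_def ydJ)
  qed
  have yd_le: "cmod (yd k x) \<le> norm x" for k x
  proof (cases "N k = 0")
    case False
    then show ?thesis using N[of k x] N0[of k] by (simp add: yd_def norm_mult norm_divide field_simps)
  qed (simp add: yd_def)
  have yv_norm: "norm (yv k) = N k * norm (yv0 k)" for k
    using J N0[of k] by (simp add: yv_def complex_structure_def)
  have yv_le: "norm (yv k) \<le> \<sigma> k powr (1 / s)" for k
  proof -
    have X: "0 \<le> N k * norm (yv0 k)" using N0 by simp
    have "((N k * norm (yv0 k)) powr s) powr (1 / s) \<le> \<sigma> k powr (1 / s)"
      using s0 by (intro powr_mono2) (auto simp: \<sigma>_def)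
    then show ?thesis using s0 X by (simp add: powr_powr yv_norm)
  qed
  have term_eq: "cscale J (yd k x) (yv k) = cscale J (yd0 k x) (yv0 k)" for k x
  proof (cases "N k = 0")
    case True
    then have "yd0 k x = 0" using N[of k x] by simp
    then show ?thesis using True by (simp add: yd_def)
  next
    case False
    then show ?thesis by (simp add: yd_def yv_def)
  qed
  have tr_eq: "yd k (yv k) = yd0 k (yv0 k)" for k
  proof -
    have "yd0 k (yv k) = complex_of_real (N k) * yd0 k (yv0 k)"
      using cdual_sum_cscale[OF J yd0[of k], of "\<lambda>_. complex_of_real (N k)" "\<lambda>_. yv0 k" "Suc 0"] by (simp add: yv_def lessThan_Suc)
    then show ?thesis using N[of k "yv0 k"] by (cases "N k = 0") (auto simp: yd_def)
  qed
  obtain A1 A2 \<theta> where A: "0 < A1" "0 < A2" "0 \<le> \<theta>"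
    and tb: "trace_bound (\<lambda>j k. yd j (yv k)) (\<lambda>k. A1 * \<sigma> k powr (- \<theta>)) (\<lambda>k. A2 * \<sigma> k powr (1 + \<theta>))"
    using trace_bound_weights[where J = J and p = p and s = s and \<nu> = \<nu> and yd = yd and yv = yv and \<sigma> = \<sigma>,
      OF J p s Y yd_cdual yd_le \<sigma> \<sigma>s yv_le] by blast
  have "nuclear_operator J T yd yv (\<lambda>k. A1 * \<sigma> k powr (- \<theta>)) (\<lambda>k. A2 * \<sigma> k powr (1 + \<theta>))"
  proof
    show "summable (\<lambda>k. norm (yv k))"
      by (rule summable_comparison_test'[OF summable_powr[OF \<sigma> \<sigma>s s1], of 0]) (use yv_le in auto)
    show "(\<lambda>k. cscale J (yd k x) (yv k)) sums T x" for x unfolding term_eq by (rule T)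
    show "0 < A1 * \<sigma> k powr (- \<theta>)" "0 < A2 * \<sigma> k powr (1 + \<theta>)" for k using A \<sigma>[of k] by auto
    have "A1 * \<sigma> k powr (- \<theta>) * (A2 * \<sigma> k powr (1 + \<theta>)) = (A1 * A2) * \<sigma> k" for k
    proof -
      have "\<sigma> k powr (- \<theta>) * \<sigma> k powr (1 + \<theta>) = \<sigma> k" using \<sigma>[of k] by (simp add: powr_add[symmetric])
      then show ?thesis by (simp only: mult_ac)
    qed
    then show "summable (\<lambda>k. A1 * \<sigma> k powr (- \<theta>) * (A2 * \<sigma> k powr (1 + \<theta>)))"
      using \<sigma>s by (simp only: summable_mult)
    have "A2 * \<sigma> k powr (1 + \<theta>) / (A1 * \<sigma> k powr (- \<theta>)) = (A2 / A1) * \<sigma> k powr (1 + 2 * \<theta>)" for k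
    proof -
      have "\<sigma> k powr (1 + \<theta>) / \<sigma> k powr (- \<theta>) = \<sigma> k powr (1 + \<theta> - (- \<theta>))" by (rule powr_diff[symmetric])
      also have "1 + \<theta> - (- \<theta>) = 1 + 2 * \<theta>" by simp
      finally show ?thesis by (simp only: times_divide_times_eq[symmetric])
    qed
    moreover have "summable (\<lambda>k. \<sigma> k powr (1 + 2 * \<theta>))" using A by (intro summable_powr \<sigma> \<sigma>s) simp
    ultimately show "summable (\<lambda>k. A2 * \<sigma> k powr (1 + \<theta>) / (A1 * \<sigma> k powr (- \<theta>)))"
      by (simp only: summable_mult)
  qed (rule J yd_cdual yd_le tb)+
  then show ?thesis using tr_eq by blast
qed

text \<open>The eigenvalue 0 is left out of the sums: it contributes nothing, and its root space may
  be infinite-dimensional. Uniqueness of the sum over the eigenvalues gives the same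
  \<open>tr\<close> for all representations.\<close>

theorem mainTheorem1:
  fixes J :: "'a::banach \<Rightarrow> 'a" and p :: ereal and s :: real
    and \<nu> :: "'m measure" and T :: "'a \<Rightarrow> 'a"
  assumes J: "complex_structure J"
    and p: "1 \<le> p"
    and s: "1 / s = 1 + \<bar>1/2 - real_of_ereal (1 / p)\<bar>"
    and Y: "iso_subspace_Lp J p \<nu> \<or> iso_quotient_Lp J p \<nu>"
    and T: "s_nuclear J s T"
  shows "\<exists>tr. (\<forall>yd yv. nuclear_rep J s T yd yv \<longrightarrow> (\<lambda>k. yd k (yv k)) sums tr) \<and>
             (\<lambda>z. real (alg_mult J T z) * cmod z) summable_on (eigenvalues J T - {0}) \<and>
             ((\<lambda>z. of_nat (alg_mult J T z) * z) has_sum tr) (eigenvalues J T - {0})"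
proof -
  let ?g = "\<lambda>z. of_nat (alg_mult J T z) * z" and ?E = "eigenvalues J T - {0}"
  have key: "summable (\<lambda>k. yd k (yv k)) \<and> (?g has_sum (\<Sum>k. yd k (yv k))) ?E \<and>
      (\<lambda>z. real (alg_mult J T z) * cmod z) summable_on ?E" if rep: "nuclear_rep J s T yd yv" for yd yv
  proof -
    obtain yd' yv' \<alpha> \<beta> where op: "nuclear_operator J T yd' yv' \<alpha> \<beta>" and eq: "\<And>k. yd' k (yv' k) = yd k (yv k)"
      using nuclear_rep_nuclear_operator[OF J p s Y rep] by blast
    interpret nuclear_operator J T yd' yv' \<alpha> \<beta> by (rule op)
    show ?thesis
      using summable_norm_cancel[OF trace_summable] trace_formula eigenvalue_sum_abs_summable unfolding eq by blast
  qed
  obtain yd0 yv0 where rep0: "nuclear_rep J s T yd0 yv0" using T unfolding s_nuclear_def by blast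
  define tr where "tr = (\<Sum>k. yd0 k (yv0 k))"
  have tr: "(?g has_sum tr) ?E" "(\<lambda>z. real (alg_mult J T z) * cmod z) summable_on ?E"
    using key[OF rep0] by (auto simp: tr_def)
  have "(\<lambda>k. yd k (yv k)) sums tr" if "nuclear_rep J s T yd yv" for yd yv
  proof -
    have "summable (\<lambda>k. yd k (yv k))" "(?g has_sum (\<Sum>k. yd k (yv k))) ?E" using key[OF that] by auto
    from has_sum_unique[OF tr(1) this(2)] summable_sums[OF this(1)] show ?thesis by simp
  qed
  then show ?thesis using tr by blast
qed

end
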